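(* Let $d\ge1$, $\tau\ge0$, and let $S$ be a (nonempty) irreducible subset of $M_d(\mathbb{R})$. Let $s_0\in\mathbb{RP}^{d-1}$ be such that the orbit $\mathcal{O}(s_0)$ is closed. Then there exists a unique invariant $\tau$ dwell-time control set ($\tau$-ICS) $D$ for the projected switched system on $\mathbb{RP}^{d-1}$ with modes $\{\pi_*A\mid A\in S\}$ contained in $\mathcal{O}(s_0)$. Moreover, $$D=\bigcap_{s\in\mathcal{O}(s_0)}\mathrm{cl}_{\mathcal{O}(s_0)}\big(\mathfrak{S}_S^\tau(s)\big)$$ and $\mathrm{int}_{\mathcal{O}(s_0)}D\neq\emptyset$, that is, $D$ has nonempty interior in the orbit topology.
   Context: $S\subset M_d(\mathbb{R})$ is irreducible if no nonzero proper linear subspace of $\mathbb{R}^d$ is invariant for all matrices in $S$. For a matrix $A$, $\pi_*A$ is the vector field on $\mathbb{RP}^{d-1}$ induced by $x\mapsto Ax$; invertible matrices act on $\mathbb{RP}^{d-1}$ in the usual way. Set $$\mathfrak{S}_S^\tau=\{e^{t_mA_m}\cdots e^{t_1A_1}\mid m\ge1,\ A_1,\dots,A_m\in S,\ t_1,\dots,t_m\ge\tau\},$$ $$\mathcal{P}_S=\{e^{t_mA_m}\cdots e^{t_1A_1}\mid m\ge1,\ A_1,\dots,A_m\in S,\ t_1,\dots,t_m\in\mathbb{R}\},$$ and $\mathcal{O}(s_0)=\{\Phi(s_0)\mid\Phi\in\mathcal{P}_S\}\subset\mathbb{RP}^{d-1}$, which is an immersed submanifold of $\mathbb{RP}^{d-1}$;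 $\mathrm{cl}_{\mathcal{O}(s_0)}$ and $\mathrm{int}_{\mathcal{O}(s_0)}$ are closure and interior in its orbit (manifold) topology. Let $\mathcal{S}^\tau$ be the set of $S$-valued functions on compact intervals $[0,T]$ which are finite concatenations of at least one constant piece, all pieces having length $\ge\tau$, and $\mathcal{S}^\tau_\infty$ the set of piecewise constant $u:[0,\infty)\to S$ such that $u|_{[0,T_n]}\in\mathcal{S}^\tau$ for some sequence $T_n\to+\infty$; $\phi(t,q,u)$ is the trajectory from $q$ of $\dot s(t)=(\pi_*u(t))(s(t))$. Membership of $u|_{[t,+\infty)}$ is understood after shifting time to start at $0$. A set $D\subset\mathbb{RP}^{d-1}$ is a $\tau$ dwell-time control set ($\tau$-CS) if (i) for every $q\in D$ there is $u\in\mathcal{S}^\tau_\infty$ such that $\phi(t,q,u)\in D$ for all $t>0$ for which both $u|_{[0,t]}\in\mathcal{S}^\tau$ and $u|_{[t,+\infty)}\in\mathcal{S}^\tau_\infty$; (ii) $D\subset\overline{\mathfrak{S}_S^\tau(q)}$ for every $q\in D$; (iii) $D$ is maximal: if $D'\supset D$ satisfies (i) and (ii) then $D'=D$. A $\tau$-ICS is a $\tau$-CS $D$ with $\overline{D}=\overline{\mathfrak{S}_S^\tau(q)}$ for every $q\in D$. *)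

theory Defs
  imports "HOL-Analysis.Analysis"
begin

section \<open>Matrices\<close>

definition irreducible_matrices :: "(real^'d^'d) set \<Rightarrow> bool" where
  "irreducible_matrices S \<longleftrightarrow>
     \<not> (\<exists>V. subspace V \<and> V \<noteq> {0} \<and> V \<noteq> UNIV \<and> (\<forall>A\<in>S. \<forall>x\<in>V. A *v x \<in> V))"

(* The multiplication of the type real^'d^'d is componentwise, so neither the power operator nor
   the constant exp gives the matrix power and the matrix exponential. *)
definition mat_exp :: "real^'d^'d \<Rightarrow> real^'d^'d" where
  "mat_exp A = (\<Sum>k. (1 / fact k) *\<^sub>R (((**) A) ^^ k) (mat 1))"

(* flow_prod [(A1,t1), ..., (Am,tm)] = exp (tm Am) ** ... ** exp (t1 A1) *)
fun flow_prod :: "((real^'d^'d) \<times> real) list \<Rightarrow> real^'d^'d" where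
  "flow_prod [] = mat 1"
| "flow_prod ((A, t) # ws) = flow_prod ws ** mat_exp (t *\<^sub>R A)"

definition dwell_semigroup :: "(real^'d^'d) set \<Rightarrow> real \<Rightarrow> (real^'d^'d) set" where
  "dwell_semigroup S \<tau> =
     {flow_prod ws | ws. ws \<noteq> [] \<and> (\<forall>(A, t)\<in>set ws. A \<in> S \<and> \<tau> \<le> t)}"

definition flow_group :: "(real^'d^'d) set \<Rightarrow> (real^'d^'d) set" where
  "flow_group S = {flow_prod ws | ws. ws \<noteq> [] \<and> (\<forall>(A, t)\<in>set ws. A \<in> S)}"


section \<open>Real projective space\<close>

(* Points are the lines through the origin of real^'d, so that the dimension of the space is
   CARD('d) - 1. *)
definition proj_points :: "(real^'d) set set" where
  "proj_points = {L. subspace L \<and> dim L = 1}"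

(* Quotient topology of the map sending x to span {x} on the nonzero vectors. *)
definition proj_space :: "(real^'d) set topology" where
  "proj_space = topology (\<lambda>U. U \<subseteq> proj_points \<and> open {x. x \<noteq> 0 \<and> span {x} \<in> U})"

definition proj_act :: "real^'d^'d \<Rightarrow> (real^'d) set \<Rightarrow> (real^'d) set" where
  "proj_act M L = (\<lambda>x. M *v x) ` L"

definition reach :: "(real^'d^'d) set \<Rightarrow> real \<Rightarrow> (real^'d) set \<Rightarrow> (real^'d) set set" where
  "reach S \<tau> q = (\<lambda>M. proj_act M q) ` dwell_semigroup S \<tau>"

definition orbit :: "(real^'d^'d) set \<Rightarrow> (real^'d) set \<Rightarrow> (real^'d) set set" where
  "orbit S q = (\<lambda>M. proj_act M q) ` flow_group S"

(* The manifold topology of the orbit, as in Sussmann's orbit theorem: the finest topology for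
   which all the maps sending (t1, ..., tm) in R^m to exp (tm Am) ... exp (t1 A1) q are
   continuous, for m arbitrary and A1, ..., Am in S. It is in general finer than the
   subspace topology. *)
definition orbit_topology :: "(real^'d^'d) set \<Rightarrow> (real^'d) set \<Rightarrow> (real^'d) set topology" where
  "orbit_topology S q = topology (\<lambda>U. U \<subseteq> orbit S q \<and>
     (\<forall>As. As \<noteq> [] \<and> set As \<subseteq> S \<longrightarrow>
        openin (powertop_real {..<length As})
          {t \<in> topspace (powertop_real {..<length As}).
             proj_act (flow_prod (zip As (map t [0..<length As]))) q \<in> U}))"

lemma openin_proj_space:
  fixes U :: "(real^'d) set set"
  shows "openin proj_space U \<longleftrightarrow> U \<subseteq> proj_points \<and> open {x. x \<noteq> 0 \<and> span {x} \<in> U}"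
proof -
  have "istopology (\<lambda>U::(real^'d) set set. U \<subseteq> proj_points \<and> open {x. x \<noteq> 0 \<and> span {x} \<in> U})"
    unfolding istopology_def
  proof (intro conjI allI impI)
    fix U V :: "(real^'d) set set"
    assume "U \<subseteq> proj_points \<and> open {x. x \<noteq> 0 \<and> span {x} \<in> U}"
      and "V \<subseteq> proj_points \<and> open {x. x \<noteq> 0 \<and> span {x} \<in> V}"
    moreover have "{x. x \<noteq> 0 \<and> span {x} \<in> U \<inter> V}
        = {x. x \<noteq> 0 \<and> span {x} \<in> U} \<inter> {x. x \<noteq> 0 \<and> span {x} \<in> V}"
      by auto
    ultimately show "U \<inter> V \<subseteq> proj_points" "open {x. x \<noteq> 0 \<and> span {x} \<in> U \<inter> V}"
      by (auto intro: open_Int)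
  next
    fix K :: "(real^'d) set set set"
    assume *: "\<forall>U\<in>K. U \<subseteq> proj_points \<and> open {x. x \<noteq> 0 \<and> span {x} \<in> U}"
    then show "\<Union>K \<subseteq> proj_points" by blast
    have "{x. x \<noteq> 0 \<and> span {x} \<in> \<Union>K} = (\<Union>U\<in>K. {x. x \<noteq> 0 \<and> span {x} \<in> U})"
      by auto
    then show "open {x. x \<noteq> 0 \<and> span {x} \<in> \<Union>K}"
      using * by (simp add: open_UN)
  qed
  then show ?thesis
    by (simp only: proj_space_def topology_inverse')
qed

lemma openin_orbit_topology:
  fixes S :: "(real^'d^'d) set" and U :: "(real^'d) set set"
  shows "openin (orbit_topology S q) U \<longleftrightarrow> U \<subseteq> orbit S q \<and>
     (\<forall>As. As \<noteq> [] \<and> set As \<subseteq> S \<longrightarrow>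
        openin (powertop_real {..<length As})
          {t \<in> topspace (powertop_real {..<length As}).
             proj_act (flow_prod (zip As (map t [0..<length As]))) q \<in> U})"
proof -
  let ?T = "\<lambda>As::(real^'d^'d) list. powertop_real {..<length As}"
  let ?P = "\<lambda>As U. {t \<in> topspace (?T As).
              proj_act (flow_prod (zip As (map t [0..<length As]))) q \<in> U}"
  have "istopology (\<lambda>U. U \<subseteq> orbit S q \<and>
      (\<forall>As. As \<noteq> [] \<and> set As \<subseteq> S \<longrightarrow> openin (?T As) (?P As U)))"
    unfolding istopology_def
  proof (intro conjI allI impI; (elim conjE)?)
    fix U V As
    assume "\<forall>As. As \<noteq> [] \<and> set As \<subseteq> S \<longrightarrow> openin (?T As) (?P As U)"
      and "\<forall>As. As \<noteq> [] \<and> set As \<subseteq> S \<longrightarrow> openin (?T As) (?P As V)"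
      and "As \<noteq> []" "set As \<subseteq> S"
    moreover have "?P As (U \<inter> V) = ?P As U \<inter> ?P As V"
      by blast
    ultimately show "openin (?T As) (?P As (U \<inter> V))"
      by (metis (no_types, lifting) openin_Int)
  next
    fix K As
    assume *: "\<forall>U\<in>K. U \<subseteq> orbit S q \<and>
        (\<forall>As. As \<noteq> [] \<and> set As \<subseteq> S \<longrightarrow> openin (?T As) (?P As U))"
      and "As \<noteq> []" "set As \<subseteq> S"
    have "?P As (\<Union>K) = \<Union> (?P As ` K)"
      by blast
    moreover have "openin (?T As) (\<Union> (?P As ` K))"
      using * \<open>As \<noteq> []\<close> \<open>set As \<subseteq> S\<close> by (intro openin_Union) blast
    ultimately show "openin (?T As) (?P As (\<Union>K))"
      by simp
  qed blast+
  then show ?thesis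
    by (simp only: orbit_topology_def topology_inverse')
qed


section \<open>Switching signals and trajectories\<close>

(* The restriction of u to [0,T] is a concatenation of m constant pieces of length at least tau
   with values in S. The value at an endpoint of a piece can be any element of S, because it
   has no influence on the trajectories. *)
definition dwell_signal ::
  "(real^'d^'d) set \<Rightarrow> real \<Rightarrow> real \<Rightarrow> (real \<Rightarrow> real^'d^'d) \<Rightarrow> bool" where
  "dwell_signal S \<tau> T u \<longleftrightarrow>
     (\<forall>r\<in>{0..T}. u r \<in> S) \<and>
     (\<exists>m p. 1 \<le> m \<and> p 0 = 0 \<and> p m = T \<and>
        (\<forall>i<m::nat. \<tau> \<le> p (Suc i) - p i \<and> p i \<le> p (Suc i) \<and>
           (\<exists>A\<in>S. \<forall>r\<in>{p i<..<p (Suc i)}. u r = A)))"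

(* Only the values of u on [0,\<infinity>) matter. *)
definition dwell_signal_inf ::
  "(real^'d^'d) set \<Rightarrow> real \<Rightarrow> (real \<Rightarrow> real^'d^'d) \<Rightarrow> bool" where
  "dwell_signal_inf S \<tau> u \<longleftrightarrow>
     (\<exists>T::nat \<Rightarrow> real. filterlim T at_top sequentially \<and> (\<forall>n. dwell_signal S \<tau> (T n) u))"

(* The curve s in projective space satisfies s'(t) = (\<pi>_* A)(s(t)). Writing \<pi> for the map
   sending x to span {x} and s = \<pi> o x near t with x differentiable at t, this equation reads
   d\<pi>(x(t)) (x'(t)) = d\<pi>(x(t)) (A x(t)), and the kernel of d\<pi>(x(t)) is span {x(t)}. *)
definition solves_proj_ode_at ::
  "(real \<Rightarrow> (real^'d) set) \<Rightarrow> real^'d^'d \<Rightarrow> real \<Rightarrow> bool" where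
  "solves_proj_ode_at s A t \<longleftrightarrow>
     (\<exists>x v. (\<forall>\<^sub>F r in nhds t. x r \<noteq> 0 \<and> s r = span {x r}) \<and>
            (x has_vector_derivative v) (at t) \<and> v - A *v x t \<in> span {x t})"

(* Since u is piecewise constant, solutions are continuous curves that satisfy the equation
   outside a locally finite set of times. *)
definition proj_trajectory ::
  "(real \<Rightarrow> real^'d^'d) \<Rightarrow> (real^'d) set \<Rightarrow> (real \<Rightarrow> (real^'d) set) \<Rightarrow> bool" where
  "proj_trajectory u q s \<longleftrightarrow>
     continuous_map (top_of_set {0..}) proj_space s \<and> s 0 = q \<and>
     (\<exists>N. (\<forall>T. finite (N \<inter> {0..T})) \<and>
          (\<forall>t>0. t \<notin> N \<longrightarrow> solves_proj_ode_at s (u t) t))"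


section \<open>Dwell-time control sets\<close>

definition cs_viable :: "(real^'d^'d) set \<Rightarrow> real \<Rightarrow> (real^'d) set set \<Rightarrow> bool" where
  "cs_viable S \<tau> D \<longleftrightarrow>
     (\<forall>q\<in>D. \<exists>u s. dwell_signal_inf S \<tau> u \<and> proj_trajectory u q s \<and>
        (\<forall>t>0. dwell_signal S \<tau> t u \<and> dwell_signal_inf S \<tau> (\<lambda>r. u (t + r)) \<longrightarrow> s t \<in> D))"

definition cs_approx_reachable :: "(real^'d^'d) set \<Rightarrow> real \<Rightarrow> (real^'d) set set \<Rightarrow> bool" where
  "cs_approx_reachable S \<tau> D \<longleftrightarrow> (\<forall>q\<in>D. D \<subseteq> proj_space closure_of (reach S \<tau> q))"

definition dwell_control_set :: "(real^'d^'d) set \<Rightarrow> real \<Rightarrow> (real^'d) set set \<Rightarrow> bool" where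
  "dwell_control_set S \<tau> D \<longleftrightarrow>
     D \<subseteq> proj_points \<and> cs_viable S \<tau> D \<and> cs_approx_reachable S \<tau> D \<and>
     (\<forall>D'. D' \<subseteq> proj_points \<and> D \<subseteq> D' \<and> cs_viable S \<tau> D' \<and> cs_approx_reachable S \<tau> D'
        \<longrightarrow> D' = D)"

definition invariant_dwell_control_set ::
  "(real^'d^'d) set \<Rightarrow> real \<Rightarrow> (real^'d) set set \<Rightarrow> bool" where
  "invariant_dwell_control_set S \<tau> D \<longleftrightarrow>
     dwell_control_set S \<tau> D \<and>
     (\<forall>q\<in>D. proj_space closure_of D = proj_space closure_of (reach S \<tau> q))"

end

theory Submission
  imports Defs
begin

text \<open>
Write \<open>\<Sigma>\<close> for the dwell-time semigroup, \<open>G\<close> for the flow group, \<open>O\<close> for the closed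
orbit and \<open>cl\<close> for the closure in projective space. Everything rests on one point \<open>p\<close> of \<open>O\<close>
that lies in \<open>cl (\<Sigma> s)\<close> for every \<open>s\<close> in \<open>O\<close>. Given \<open>p\<close>, the set \<open>D\<close> defined as the
intersection of all \<open>cl (\<Sigma> s)\<close> is nonempty, and \<open>cl (\<Sigma> q) = D\<close> for each \<open>q\<close> in \<open>D\<close>. So \<open>D\<close> is
closed under \<open>\<Sigma>\<close>, hence viable (use constant signals), and every larger set in which each point
is approximately reachable from each other point lies in \<open>cl (\<Sigma> p) = D\<close>.

Where \<open>p\<close> comes from (exists_common_limit_point). Let \<open>T\<close> be the closure of \<open>\<real> \<Sigma>\<close>, a
closed semigroup of matrices. Restricting its nonzero elements of least rank to a fixed image and a
fixed kernel yields a projection \<open>P\<close> and a set \<open>H\<close> containing \<open>P T P\<close> whose nonzero elements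
form a group with identity \<open>P\<close> (exists_scaled_matrix_group). By irreducibility, \<open>\<Sigma>\<close> moves every
line out of the kernel of \<open>P\<close>, so \<open>cl (\<Sigma> s)\<close> contains a line inside the image of \<open>P\<close>. Two
lines \<open>y\<close>, \<open>z\<close> of \<open>O\<close> inside the image of \<open>P\<close> satisfy \<open>y = g z = P g P z\<close> for some \<open>g\<close> in
\<open>G\<close>. If \<open>P g P\<close> is in \<open>H\<close>, it is a limit of multiples of elements of \<open>\<Sigma>\<close>, and \<open>y\<close> is in
\<open>cl (\<Sigma> z)\<close>. So any such line can serve as \<open>p\<close>. That \<open>P g P\<close> is in \<open>H\<close> is clear for \<open>g\<close>
in \<open>\<Sigma>\<close>; it extends to \<open>G\<close> because \<open>t \<mapsto> P X exp (t B) Y P\<close> is an analytic curve, and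
an analytic curve that lies in such a group with scalars for all large \<open>t\<close> lies in it always
(exp_curve_stays). This is analytic continuation: the logarithmic velocity of the curve is
analytic and takes values in the tangent space of the group for large \<open>t\<close>.

Interior and topology. The matrices tangent to \<open>G\<close> form a finite-dimensional space, which is
spanned by the logarithmic time derivatives of one word with times greater than \<open>\<tau>\<close>
(exists_word_spanning_ad_space). The inverse function theorem turns this word into a chart whose
image is contained in \<open>\<Sigma>\<close> and open for the finest topology on \<open>G\<close> making all words continuous in
their times (exists_fine_open_chart). Its translate through \<open>p\<close> is an open subset of \<open>D\<close> in the
orbit topology. Finitely many matrices occur in that word, so words in these matrices with rational
times give countably many translates of any smaller chart that cover \<open>G\<close>; Baire's theorem on the
compact set of unit vectors over \<open>O\<close> then shows that the orbit topology is the subspace topology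
(orbit_topology_eq_subtopology). Consequently the two closures of \<open>\<Sigma> s\<close> agree.

Uniqueness. If \<open>D'\<close> is any invariant control set in \<open>O\<close>, then \<open>D\<close> is contained in
\<open>cl (\<Sigma> q) = cl D'\<close> for \<open>q\<close> in \<open>D'\<close>. As \<open>D\<close> has interior, \<open>D'\<close> meets \<open>D\<close>, whence
\<open>D'\<close> is contained in \<open>D\<close>, and \<open>D' = D\<close> by maximality of \<open>D'\<close>.
\<close>

section \<open>Power series and the matrix exponential\<close>

lemma bounded_bilinear_matrix_mult:
  "bounded_bilinear ((**) :: real^'d^'d \<Rightarrow> real^'d^'d \<Rightarrow> real^'d^'d)"
  by (subst bilinear_conv_bounded_bilinear[symmetric], unfold bilinear_def)
    (auto intro!: linearI simp: vec_eq_iff matrix_matrix_mult_def sum.distrib algebra_simps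
      sum_distrib_left)

lemma bounded_bilinear_matrix_vector_mult:
  "bounded_bilinear ((*v) :: real^'d^'d \<Rightarrow> real^'d \<Rightarrow> real^'d)"
  by (subst bilinear_conv_bounded_bilinear[symmetric], unfold bilinear_def)
    (auto intro!: linearI simp: vec_eq_iff matrix_vector_mult_def sum.distrib algebra_simps
      sum_distrib_left)

interpretation mm: bounded_bilinear "(**) :: real^'d^'d \<Rightarrow> real^'d^'d \<Rightarrow> real^'d^'d"
  by (rule bounded_bilinear_matrix_mult)

interpretation mv: bounded_bilinear "(*v) :: real^'d^'d \<Rightarrow> real^'d \<Rightarrow> real^'d"
  by (rule bounded_bilinear_matrix_vector_mult)

text \<open>Everywhere convergent real power series at the origin. The curves to be continued analytically
are exponentials, so after a shift of time this single centre of expansion suffices.\<close>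

definition entire :: "(real \<Rightarrow> real) \<Rightarrow> bool" where
  "entire f \<longleftrightarrow> (\<exists>c. \<forall>t. (\<lambda>n. c n * t ^ n) sums f t)"

lemma entire_const [simp]: "entire (\<lambda>_. c)"
  unfolding entire_def
proof (intro exI allI)
  fix t :: real
  have "(\<lambda>n. if n = 0 then c else 0) sums c" by (rule sums_single)
  moreover have "(\<lambda>n. if n = 0 then c else 0) = (\<lambda>n. (if n = 0 then c else 0) * t ^ n)" by auto
  ultimately show "(\<lambda>n. (if n = 0 then c else 0) * t ^ n) sums c" by simp
qed

lemma entire_add: assumes "entire f" "entire g" shows "entire (\<lambda>t. f t + g t)"
proof -
  obtain c d where "\<And>t. (\<lambda>n. c n * t ^ n) sums f t" "\<And>t. (\<lambda>n. d n * t ^ n) sums g t"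
    using assms unfolding entire_def by metis
  then have "(\<lambda>n. (c n + d n) * t ^ n) sums (f t + g t)" for t
    unfolding distrib_right by (intro sums_add)
  then show ?thesis unfolding entire_def by (intro exI allI)
qed

lemma powser_everywhere_abs_summable:
  fixes c :: "nat \<Rightarrow> real"
  assumes "\<And>t. summable (\<lambda>n. c n * t ^ n)"
  shows "summable (\<lambda>n. norm (c n * t ^ n))"
  by (rule powser_insidea[OF assms[of "\<bar>t\<bar> + 1"]]) simp

lemma entire_mult: assumes "entire f" "entire g" shows "entire (\<lambda>t. f t * g t)"
proof -
  obtain c d where c: "\<And>t. (\<lambda>n. c n * t ^ n) sums f t" and d: "\<And>t. (\<lambda>n. d n * t ^ n) sums g t"
    using assms unfolding entire_def by metis
  have "(\<lambda>n. (\<Sum>i\<le>n. c i * d (n - i)) * t ^ n) sums (f t * g t)" for t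
  proof -
    have "(\<lambda>n. \<Sum>i\<le>n. (c i * t ^ i) * (d (n - i) * t ^ (n - i)))
        sums ((\<Sum>n. c n * t ^ n) * (\<Sum>n. d n * t ^ n))"
      by (rule Cauchy_product_sums)
        (use c d powser_everywhere_abs_summable sums_summable in blast)+
    moreover have "(\<Sum>i\<le>n. (c i * t ^ i) * (d (n - i) * t ^ (n - i)))
        = (\<Sum>i\<le>n. c i * d (n - i)) * t ^ n" for n
    proof -
      have "(c i * t ^ i) * (d (n - i) * t ^ (n - i)) = c i * d (n - i) * t ^ n" if "i \<le> n" for i
      proof -
        have "t ^ n = t ^ i * t ^ (n - i)" using that by (simp flip: power_add)
        then show ?thesis by simp
      qed
      then show ?thesis unfolding sum_distrib_right by (intro sum.cong refl) (simp only: atMost_iff)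
    qed
    ultimately show ?thesis
      using sums_unique[OF c[of t]] sums_unique[OF d[of t]] by simp
  qed
  then show ?thesis unfolding entire_def by (intro exI allI)
qed

lemma entire_sum: "(\<And>i. i \<in> I \<Longrightarrow> entire (f i)) \<Longrightarrow> entire (\<lambda>t. \<Sum>i\<in>I. f i t)"
  by (induction I rule: infinite_finite_induct) (auto intro: entire_add)

lemma entire_prod: "(\<And>i. i \<in> I \<Longrightarrow> entire (f i)) \<Longrightarrow> entire (\<lambda>t. \<Prod>i\<in>I. f i t)"
  by (induction I rule: infinite_finite_induct) (auto intro: entire_mult)

lemma entire_has_derivative:
  assumes "entire f"
  obtains f' where "entire f'" "\<And>t. (f has_field_derivative f' t) (at t)"
proof -
  obtain c where c: "\<And>t. (\<lambda>n. c n * t ^ n) sums f t"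
    using assms unfolding entire_def by metis
  then have sm: "summable (\<lambda>n. c n * t ^ n)" for t by (rule sums_summable)
  have f: "f = (\<lambda>t. \<Sum>n. c n * t ^ n)" using c by (simp add: sums_iff fun_eq_iff)
  have "summable (\<lambda>n. diffs c n * t ^ n)" for t
    by (rule termdiff_converges_all[OF sm])
  then have "entire (\<lambda>t. \<Sum>n. diffs c n * t ^ n)"
    unfolding entire_def using summable_sums by blast
  moreover have "(f has_field_derivative (\<Sum>n. diffs c n * t ^ n)) (at t)" for t
    unfolding f by (rule termdiffs_strong_converges_everywhere[OF sm])
  ultimately show ?thesis using that by blast
qed

lemma entire_isCont: "entire f \<Longrightarrow> isCont f t"
  by (metis DERIV_isCont entire_has_derivative)

text \<open>A zero of order at least \<open>m\<close> at the origin can be divided out. Applied to all entries of a matrix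
with their common order, this lets a curve pass through a zero with a well-defined direction.\<close>

lemma entire_shift_coeff:
  assumes c: "\<And>t. (\<lambda>n. c n * t ^ n) sums f t" and z: "\<And>n. n < m \<Longrightarrow> c n = 0"
  obtains g where "entire g" "\<And>t. f t = t ^ m * g t" "g 0 = c m" "\<And>t. (\<lambda>n. c (n + m) * t ^ n) sums g t"
proof -
  have sm: "summable (\<lambda>n. c (n + m) * t ^ n)" for t
  proof (cases "t = 0")
    case True then show ?thesis using powser_zero summable_0_powser by auto
  next
    case False
    have "summable (\<lambda>n. c (n + m) * t ^ (n + m))"
      using summable_ignore_initial_segment[OF sums_summable[OF c[of t]], of m] .
    then have "summable (\<lambda>n. c (n + m) * t ^ (n + m) * inverse (t ^ m))" by (rule summable_mult2)
    moreover have "c (n + m) * t ^ (n + m) * inverse (t ^ m) = c (n + m) * t ^ n" for n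
      using False by (simp add: power_add mult.assoc)
    ultimately show ?thesis by simp
  qed
  define g where "g t = (\<Sum>n. c (n + m) * t ^ n)" for t
  have g: "(\<lambda>n. c (n + m) * t ^ n) sums g t" for t
    unfolding g_def using sm by (rule summable_sums)
  have "f t = t ^ m * g t" for t
  proof -
    have "(\<lambda>n. c (n + m) * t ^ (n + m)) sums (f t - (\<Sum>i<m. c i * t ^ i))"
      using sums_split_initial_segment[OF c] by blast
    then have "(\<lambda>n. c (n + m) * t ^ (n + m)) sums f t" using z by simp
    moreover have "(\<lambda>n. t ^ m * (c (n + m) * t ^ n)) sums (t ^ m * g t)"
      using sums_mult[OF g] .
    ultimately show ?thesis
      by (simp add: power_add mult.assoc mult.commute mult.left_commute sums_iff)
  qed
  moreover have "g 0 = c m"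
    using sums_unique2[OF g[of 0] powser_sums_zero[of "\<lambda>n. c (n + m)"]] by simp
  moreover have "entire g" unfolding entire_def by (intro exI[of _ "\<lambda>n. c (n + m)"] allI g)
  ultimately show ?thesis using that g by blast
qed

text \<open>Identity theorem: the first nonzero coefficient would be the limit, from the right, of the function
divided by a power of \<open>t\<close>, which vanishes.\<close>

lemma entire_zero_right:
  assumes "entire f" and z: "\<And>t. 0 < t \<Longrightarrow> t < e \<Longrightarrow> f t = 0" and e: "0 < e"
  shows "f t = 0"
proof -
  obtain c where c: "\<And>t. (\<lambda>n. c n * t ^ n) sums f t"
    using assms unfolding entire_def by metis
  have "c m = 0" for m
  proof (induction m rule: less_induct)
    case (less m)
    then obtain g where g: "entire g" "\<And>t. f t = t ^ m * g t" "g 0 = c m"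
      using entire_shift_coeff[OF c, of m] by metis
    have "(g \<longlongrightarrow> g 0) (at_right 0)"
      using entire_isCont[OF g(1), of 0] unfolding isCont_def
      by (rule tendsto_mono[rotated]) (simp add: at_le)
    moreover have "\<forall>\<^sub>F t in at_right 0. g t = 0"
      using eventually_at_right_real[OF e]
      by eventually_elim (use g(2) z in \<open>auto simp: greaterThanLessThan_iff\<close>)
    then have "(g \<longlongrightarrow> 0) (at_right 0)" by (rule tendsto_eventually)
    ultimately have "g 0 = 0" by (rule tendsto_unique[OF trivial_limit_at_right_real])
    then show ?case using g(3) by simp
  qed
  then have "(\<lambda>n. 0) sums f t" using c[of t] by simp
  then show ?thesis using sums_unique2[OF sums_zero] by simp
qed

definition mpow :: "real^'d^'d \<Rightarrow> nat \<Rightarrow> real^'d^'d" where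
  "mpow A n = (((**) A) ^^ n) (mat 1)"

lemma mpow_simps [simp]: "mpow A 0 = mat 1" "mpow A (Suc n) = A ** mpow A n"
  by (simp_all add: mpow_def)

lemma mpow_commute: "mpow A n ** A = A ** mpow A n"
  by (induction n) (simp_all add: matrix_mul_assoc[symmetric])

lemma mpow_scaleR: "mpow (t *\<^sub>R A) n = t ^ n *\<^sub>R mpow A n"
  by (induction n) (simp_all add: mm.scaleR_left mm.scaleR_right mult.commute)

lemma mat_exp_series_summable:
  fixes A :: "real^'d^'d"
  shows "summable (\<lambda>n. t ^ n *\<^sub>R ((1 / fact n) *\<^sub>R mpow A n))"
proof -
  obtain C where C: "0 < C" "\<And>(X :: real^'d^'d) (Y :: real^'d^'d). norm (X ** Y) \<le> norm X * norm Y * C"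
    using mm.pos_bounded by blast
  have *: "norm (mpow A n) \<le> norm (mat 1 :: real^'d^'d) * (norm A * C) ^ n" for n
  proof (induction n)
    case (Suc n)
    have "norm (mpow A (Suc n)) \<le> norm A * norm (mpow A n) * C" unfolding mpow_simps by (rule C(2))
    also have "\<dots> = (norm A * C) * norm (mpow A n)" by simp
    also have "\<dots> \<le> (norm A * C) * (norm (mat 1 :: real^'d^'d) * (norm A * C) ^ n)"
      using Suc C(1) by (intro mult_left_mono) auto
    finally show ?case by (simp add: ac_simps)
  qed simp
  have "summable (\<lambda>n. norm (mat 1 :: real^'d^'d) * (inverse (fact n) * (\<bar>t\<bar> * (norm A * C)) ^ n))"
    by (intro summable_mult summable_exp)
  moreover have "norm (t ^ n *\<^sub>R ((1 / fact n) *\<^sub>R mpow A n))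
      \<le> norm (mat 1 :: real^'d^'d) * (inverse (fact n) * (\<bar>t\<bar> * (norm A * C)) ^ n)" for n
  proof -
    have "norm (t ^ n *\<^sub>R ((1 / fact n) *\<^sub>R mpow A n)) = (\<bar>t\<bar> ^ n / fact n) * norm (mpow A n)"
      by (simp add: power_abs)
    also have "\<dots> \<le> (\<bar>t\<bar> ^ n / fact n) * (norm (mat 1 :: real^'d^'d) * (norm A * C) ^ n)"
      by (intro mult_left_mono *) auto
    finally show ?thesis by (simp add: power_mult_distrib field_simps)
  qed
  ultimately show ?thesis by (rule summable_comparison_test'[where N = 0])
qed

lemma mat_exp_sums: "(\<lambda>n. t ^ n *\<^sub>R ((1 / fact n) *\<^sub>R mpow A n)) sums mat_exp (t *\<^sub>R A)"
  using summable_sums[OF mat_exp_series_summable[of t A]]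
  unfolding mat_exp_def mpow_def[symmetric] mpow_scaleR by (simp add: mult.commute)

lemma mat_exp_entry_sums:
  "(\<lambda>n. (1 / fact n * mpow A n $ i $ j) * t ^ n) sums (mat_exp (t *\<^sub>R A) $ i $ j)"
  using bounded_linear.sums[OF bounded_linear_vec_nth[of j]
      bounded_linear.sums[OF bounded_linear_vec_nth[of i] mat_exp_sums[of t A]]]
  by (simp add: ac_simps)

lemma has_vector_derivative_matrix:
  fixes b :: "real \<Rightarrow> real^'d^'d"
  assumes "\<And>i j. ((\<lambda>t. b t $ i $ j) has_field_derivative (B $ i $ j)) (at t)"
  shows "(b has_vector_derivative B) (at t)"
proof -
  have "((\<lambda>t. b t \<bullet> u) has_derivative (\<lambda>h. (h *\<^sub>R B) \<bullet> u)) (at t)" if bB: "u \<in> Basis" for u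
  proof -
    obtain i j where u: "u = axis i (axis j 1)" using bB unfolding Basis_vec_def by auto
    have "X \<bullet> u = X $ i $ j" for X :: "real^'d^'d" unfolding u inner_axis by simp
    then show ?thesis
      using assms[of i j] by (simp add: has_field_derivative_def mult_commute_abs)
  qed
  then show ?thesis
    unfolding has_vector_derivative_def has_derivative_componentwise_within[of b]
    by (intro ballI)
qed

lemma mat_exp_has_vector_derivative:
  fixes A :: "real^'d^'d"
  shows "((\<lambda>t. mat_exp (t *\<^sub>R A)) has_vector_derivative A ** mat_exp (t *\<^sub>R A)) (at t)"
proof -
  have "((\<lambda>t. mat_exp (t *\<^sub>R A) $ i $ j) has_field_derivative (A ** mat_exp (t *\<^sub>R A)) $ i $ j) (at t)"
    for i j
  proof -
    let ?c = "\<lambda>n. 1 / fact n * mpow A n $ i $ j"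
    have f: "(\<lambda>t. mat_exp (t *\<^sub>R A) $ i $ j) = (\<lambda>t. \<Sum>n. ?c n * t ^ n)"
      by (rule ext, rule sums_unique[OF mat_exp_entry_sums])
    have "(\<lambda>n. t ^ n *\<^sub>R ((1 / fact n) *\<^sub>R (A ** mpow A n))) sums (A ** mat_exp (t *\<^sub>R A))"
      using bounded_linear.sums[OF mm.bounded_linear_right[of A] mat_exp_sums[of t A]]
      by (simp add: mm.scaleR_right)
    then have "(\<lambda>n. (t ^ n *\<^sub>R ((1 / fact n) *\<^sub>R (A ** mpow A n))) $ i $ j)
        sums ((A ** mat_exp (t *\<^sub>R A)) $ i $ j)"
      by (intro bounded_linear.sums[OF bounded_linear_vec_nth])
    moreover have "(t ^ n *\<^sub>R ((1 / fact n) *\<^sub>R (A ** mpow A n))) $ i $ j = diffs ?c n * t ^ n" for n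
      by (simp add: diffs_def field_simps del: of_nat_Suc)
    ultimately have "(A ** mat_exp (t *\<^sub>R A)) $ i $ j = (\<Sum>n. diffs ?c n * t ^ n)"
      by (simp add: sums_iff)
    moreover have "summable (\<lambda>n. ?c n * y ^ n)" for y
      by (rule sums_summable[OF mat_exp_entry_sums])
    ultimately show ?thesis unfolding f
      by (simp only: termdiffs_strong_converges_everywhere)
  qed
  then show ?thesis by (rule has_vector_derivative_matrix)
qed

lemma mat_exp_zero [simp]: "mat_exp (0 :: real^'d^'d) = mat 1"
proof -
  have "(\<lambda>n. (0::real) ^ n *\<^sub>R ((1 / fact n) *\<^sub>R mpow (0::real^'d^'d) n)) sums
      (\<Sum>n\<in>{0}. (0::real) ^ n *\<^sub>R ((1 / fact n) *\<^sub>R mpow (0::real^'d^'d) n))"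
    by (rule sums_finite) auto
  from sums_unique2[OF mat_exp_sums this] show ?thesis by simp
qed

lemma mat_exp_commute: "mat_exp (t *\<^sub>R A) ** A = A ** mat_exp (t *\<^sub>R A)"
proof -
  have "(\<lambda>n. t ^ n *\<^sub>R ((1 / fact n) *\<^sub>R (A ** mpow A n))) sums (A ** mat_exp (t *\<^sub>R A))"
    using bounded_linear.sums[OF mm.bounded_linear_right[of A] mat_exp_sums[of t A]]
    by (simp add: mm.scaleR_right)
  moreover have "(\<lambda>n. t ^ n *\<^sub>R ((1 / fact n) *\<^sub>R (mpow A n ** A))) sums (mat_exp (t *\<^sub>R A) ** A)"
    using bounded_linear.sums[OF mm.bounded_linear_left[of A] mat_exp_sums[of t A]]
    by (simp add: mm.scaleR_left)
  ultimately show ?thesis unfolding mpow_commute by (rule sums_unique2[symmetric])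
qed

text \<open>The product of \<open>exp ((s + t) A)\<close> and \<open>exp (- t A)\<close> has derivative zero in \<open>t\<close>; so it is constant,
which gives the inverse (\<open>s = 0\<close>) and from it the addition law.\<close>

lemma mat_exp_add: "mat_exp ((s + t) *\<^sub>R A) = mat_exp (s *\<^sub>R A) ** mat_exp (t *\<^sub>R A)"
  and mat_exp_inverse: "mat_exp (t *\<^sub>R A) ** mat_exp ((- t) *\<^sub>R A) = mat 1"
proof -
  have const: "mat_exp ((s + t) *\<^sub>R A) ** mat_exp ((- t) *\<^sub>R A) = mat_exp (s *\<^sub>R A)" for s t
  proof -
    let ?f = "\<lambda>t. mat_exp ((s + t) *\<^sub>R A) ** mat_exp ((- t) *\<^sub>R A)"
    have "(?f has_derivative (\<lambda>h. 0)) (at t)" for t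
    proof -
      let ?E = "mat_exp ((s + t) *\<^sub>R A)" and ?F = "mat_exp ((- t) *\<^sub>R A)"
      have 1: "((\<lambda>t. mat_exp ((s + t) *\<^sub>R A)) has_derivative (\<lambda>h. h *\<^sub>R (A ** ?E))) (at t)"
        using vector_diff_chain_at[where f = "\<lambda>t. s + t" and f' = 1 and x = t,
            OF _ mat_exp_has_vector_derivative[of A]]
        by (simp add: has_vector_derivative_def o_def has_derivative_add_const has_derivative_ident
            has_derivative_add[OF has_derivative_const has_derivative_ident, simplified])
      have 2: "((\<lambda>t. mat_exp ((- t) *\<^sub>R A)) has_derivative (\<lambda>h. h *\<^sub>R (- (A ** ?F)))) (at t)"
        using vector_diff_chain_at[where f = "\<lambda>t. - t" and f' = "-1" and x = t,
            OF _ mat_exp_has_vector_derivative[of A]]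
        by (simp add: has_vector_derivative_def o_def)
      have "?E ** (h *\<^sub>R (- (A ** ?F))) + (h *\<^sub>R (A ** ?E)) ** ?F = 0" for h
      proof -
        have "?E ** (A ** ?F) = A ** ?E ** ?F"
          by (simp only: matrix_mul_assoc mat_exp_commute)
        then show ?thesis by (simp only: mm.scaleR_right mm.scaleR_left mm.minus_right) simp
      qed
      with mm.FDERIV[OF 1 2] show ?thesis by simp
    qed
    then have "?f t = ?f 0"
      by (intro has_derivative_zero_unique_connected[of UNIV]) auto
    then show ?thesis by simp
  qed
  have inv: "mat_exp (t *\<^sub>R A) ** mat_exp ((- t) *\<^sub>R A) = mat 1" for t
    using const[of 0 t] by (simp only: add_0 scaleR_zero_left mat_exp_zero)
  show "mat_exp (t *\<^sub>R A) ** mat_exp ((- t) *\<^sub>R A) = mat 1" by (rule inv)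
  from inv[of "- t"] have inv': "mat_exp ((- t) *\<^sub>R A) ** mat_exp (t *\<^sub>R A) = mat 1"
    by (simp only: minus_minus)
  have "mat_exp ((s + t) *\<^sub>R A)
      = mat_exp ((s + t) *\<^sub>R A) ** (mat_exp ((- t) *\<^sub>R A) ** mat_exp (t *\<^sub>R A))"
    by (simp only: inv' matrix_mul_rid)
  also have "\<dots> = mat_exp ((s + t) *\<^sub>R A) ** mat_exp ((- t) *\<^sub>R A) ** mat_exp (t *\<^sub>R A)"
    by (rule matrix_mul_assoc)
  also have "\<dots> = mat_exp (s *\<^sub>R A) ** mat_exp (t *\<^sub>R A)"
    by (simp only: const)
  finally show "mat_exp ((s + t) *\<^sub>R A) = mat_exp (s *\<^sub>R A) ** mat_exp (t *\<^sub>R A)" .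
qed

lemma flow_prod_append: "flow_prod (xs @ ys) = flow_prod ys ** flow_prod xs"
  by (induction xs rule: flow_prod.induct) (simp_all add: matrix_mul_assoc)

definition inv_word :: "((real^'d^'d) \<times> real) list \<Rightarrow> ((real^'d^'d) \<times> real) list" where
  "inv_word ws = rev (map (\<lambda>(A, t). (A, - t)) ws)"

lemma flow_prod_inv_left [simp]: "flow_prod (inv_word ws) ** flow_prod ws = mat 1"
  and flow_prod_inv_right [simp]: "flow_prod ws ** flow_prod (inv_word ws) = mat 1"
proof -
  show "flow_prod ws ** flow_prod (inv_word ws) = mat 1" for ws :: "((real^'d^'d) \<times> real) list"
  proof (induction ws rule: flow_prod.induct)
    case (2 A t ws)
    have "flow_prod ((A, t) # ws) ** flow_prod (inv_word ((A, t) # ws))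
        = flow_prod ws ** (mat_exp (t *\<^sub>R A) ** mat_exp ((- t) *\<^sub>R A)) ** flow_prod (inv_word ws)"
      by (simp add: inv_word_def flow_prod_append matrix_mul_assoc)
    then show ?case using 2 by (simp add: mat_exp_inverse del: scaleR_minus_left)
  qed (simp add: inv_word_def)
  then show "flow_prod (inv_word ws) ** flow_prod ws = mat 1"
    using matrix_left_right_inverse by blast
qed

section \<open>Analytic curves in matrix groups\<close>

text \<open>Gronwall's inequality for one-sided difference quotients. The supersolution
\<open>\<eta> exp ((L + 1) t)\<close> grows strictly faster than the hypothesis allows \<open>\<delta>\<close> to grow, so \<open>\<delta>\<close> cannot
cross it; then let \<open>\<eta>\<close> tend to zero. Distances to a set are not differentiable, which is
why the inequality is needed in this form.\<close>

lemma dini_comparison: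
  fixes \<delta> :: "real \<Rightarrow> real"
  assumes cont: "continuous_on {0..l} \<delta>" and zero: "\<delta> 0 \<le> 0" and L: "0 \<le> L"
    and step: "\<And>t \<eta>. 0 \<le> t \<Longrightarrow> t < l \<Longrightarrow> 0 < \<eta> \<Longrightarrow>
      \<exists>\<rho>>0. \<forall>h. 0 < h \<and> h < \<rho> \<and> t + h \<le> l \<longrightarrow> \<delta> (t + h) \<le> (1 + L * h) * \<delta> t + \<eta> * h"
    and t: "0 \<le> t" "t \<le> l"
  shows "\<delta> t \<le> 0"
proof -
  have main: "\<delta> t \<le> \<eta> * exp ((L + 1) * t)" if \<eta>: "0 < \<eta>" for \<eta>
  proof (rule ccontr)
    define \<phi> where "\<phi> s = \<eta> * exp ((L + 1) * s)" for s
    define B where "B = {s \<in> {0..l}. \<phi> s < \<delta> s}"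
    assume "\<not> \<delta> t \<le> \<eta> * exp ((L + 1) * t)"
    then have tB: "t \<in> B" using t by (auto simp: B_def \<phi>_def)
    define s0 where "s0 = Inf B"
    have bdd: "bdd_below B" by (rule bdd_belowI[of _ 0]) (auto simp: B_def)
    have lower: "s0 \<le> s" if "s \<in> B" for s
      unfolding s0_def using that bdd by (rule cInf_lower)
    have s00: "0 \<le> s0" unfolding s0_def using tB by (intro cInf_greatest) (auto simp: B_def)
    have s0l: "s0 \<le> l" using lower[OF tB] t by simp
    have "s0 \<notin> B"
    proof
      assume s0B: "s0 \<in> B"
      have "continuous_on {0..l} (\<lambda>s. \<delta> s - \<phi> s)"
        unfolding \<phi>_def by (intro continuous_intros cont)
      moreover have "0 < \<delta> s0 - \<phi> s0" using s0B by (simp add: B_def)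
      ultimately obtain e where e: "e > 0"
        and ce: "\<And>s. s \<in> {0..l} \<Longrightarrow> dist s s0 < e \<Longrightarrow> dist (\<delta> s - \<phi> s) (\<delta> s0 - \<phi> s0) < \<delta> s0 - \<phi> s0"
        using s00 s0l unfolding continuous_on_iff by (metis atLeastAtMost_iff)
      have "s0 \<noteq> 0" using s0B zero \<eta> by (auto simp: B_def \<phi>_def)
      define s where "s = max 0 (s0 - e / 2)"
      have s: "s \<in> {0..l}" "dist s s0 < e" "s < s0"
        using s00 s0l e \<open>s0 \<noteq> 0\<close> by (auto simp: s_def dist_real_def)
      have "s \<in> B" using ce[OF s(1,2)] s(1) by (auto simp: B_def dist_real_def)
      then show False using lower s(3) by force
    qed
    then have le0: "\<delta> s0 \<le> \<phi> s0" and "s0 < t"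
      using s00 s0l lower[OF tB] tB by (auto simp: B_def less_le)
    then obtain \<rho> where \<rho>: "\<rho> > 0"
      and st: "\<And>h. 0 < h \<Longrightarrow> h < \<rho> \<Longrightarrow> s0 + h \<le> l \<Longrightarrow> \<delta> (s0 + h) \<le> (1 + L * h) * \<delta> s0 + \<eta> * h"
      using step[OF s00 _ \<eta>] t by force
    have "s0 + \<rho> \<le> s" if sB: "s \<in> B" for s
    proof (rule ccontr)
      assume "\<not> s0 + \<rho> \<le> s"
      moreover have "s0 < s" using lower[OF sB] sB \<open>s0 \<notin> B\<close> by (cases "s = s0") auto
      ultimately have h: "0 < s - s0" "s - s0 < \<rho>" by auto
      let ?h = "s - s0"
      have "\<delta> s \<le> (1 + L * ?h) * \<delta> s0 + \<eta> * ?h"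
        using st[OF h] sB by (simp add: B_def)
      also have "\<dots> \<le> (1 + L * ?h) * \<phi> s0 + \<phi> s0 * ?h"
      proof (intro add_mono mult_left_mono mult_right_mono le0)
        have "0 \<le> (L + 1) * s0" using s00 L by simp
        then show "\<eta> \<le> \<phi> s0" using \<eta> by (simp add: \<phi>_def)
      qed (use h L in auto)
      also have "\<dots> = \<phi> s0 * (1 + (L + 1) * ?h)" by (simp add: algebra_simps)
      also have "\<dots> \<le> \<phi> s0 * exp ((L + 1) * ?h)"
        using \<eta> by (intro mult_left_mono exp_ge_add_one_self) (auto simp: \<phi>_def)
      also have "\<dots> = \<phi> s"
        by (simp add: \<phi>_def mult.assoc flip: exp_add) (simp add: algebra_simps)
      finally show False using sB by (simp add: B_def)
    qed
    then have "s0 + \<rho> \<le> Inf B" using tB by (intro cInf_greatest) auto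
    then show False using \<rho> by (simp add: s0_def)
  qed
  show ?thesis
  proof (rule ccontr)
    assume "\<not> \<delta> t \<le> 0"
    then show False using main[of "\<delta> t / (2 * exp ((L + 1) * t))"] by simp
  qed
qed

definition entire_matrix :: "(real \<Rightarrow> real^'d^'d) \<Rightarrow> bool" where
  "entire_matrix b \<longleftrightarrow> (\<forall>i j. entire (\<lambda>t. b t $ i $ j))"

lemma entire_matrix_const [simp]: "entire_matrix (\<lambda>_. X)"
  by (simp add: entire_matrix_def)

lemma entire_matrix_add:
  "entire_matrix b \<Longrightarrow> entire_matrix c \<Longrightarrow> entire_matrix (\<lambda>t. b t + c t)"
  by (simp add: entire_matrix_def entire_add)

lemma entire_matrix_mult:
  "entire_matrix b \<Longrightarrow> entire_matrix c \<Longrightarrow> entire_matrix (\<lambda>t. b t ** c t)"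
  by (simp add: entire_matrix_def matrix_matrix_mult_def entire_sum entire_mult)

lemma entire_det: "entire_matrix b \<Longrightarrow> entire (\<lambda>t. det (b t))"
  unfolding det_def by (intro entire_sum entire_mult entire_const entire_prod)
    (simp add: entire_matrix_def)

lemma entire_matrix_derivative:
  assumes "entire_matrix b"
  obtains b' where "entire_matrix b'" "\<And>t. (b has_vector_derivative b' t) (at t)"
proof -
  have "\<exists>f'. entire f' \<and> (\<forall>t. ((\<lambda>t. b t $ i $ j) has_field_derivative f' t) (at t))" for i j
    using assms entire_has_derivative unfolding entire_matrix_def by metis
  then obtain f' where f': "\<And>i j. entire (f' i j)"
    "\<And>i j t. ((\<lambda>t. b t $ i $ j) has_field_derivative f' i j t) (at t)" by metis
  show ?thesis
    by (rule that[of "\<lambda>t. \<chi> i j. f' i j t"])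
      (auto simp: entire_matrix_def f' intro!: has_vector_derivative_matrix)
qed

lemma entire_matrix_isCont: "entire_matrix b \<Longrightarrow> isCont b t"
  by (metis entire_matrix_derivative has_vector_derivative_continuous)

text \<open>The transposed matrix of cofactors, written as Cramer determinants. Its entries are polynomials in
those of \<open>A\<close>, so multiplying by it replaces the inverse without leaving the entire functions.\<close>

definition adjugate :: "real^'d^'d \<Rightarrow> real^'d^'d" where
  "adjugate A = (\<chi> k j. det (\<chi> i l. if l = k then axis j 1 $ i else A $ i $ l))"

lemma adjugate_inverse:
  fixes A B :: "real^'d^'d"
  assumes "A ** B = mat 1" shows "adjugate A = det A *\<^sub>R B"
proof -
  have "adjugate A $ k $ j = (det A *\<^sub>R B) $ k $ j" for k j
  proof -
    have "A *v (B *v axis j 1) = axis j 1"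
      by (simp add: matrix_vector_mul_assoc assms)
    then have "adjugate A $ k $ j
        = det (\<chi> i l. if l = k then (A *v (B *v axis j 1)) $ i else A $ i $ l)"
      by (simp only: adjugate_def vec_lambda_beta)
    also have "\<dots> = (B *v axis j 1) $ k * det A" by (rule cramer_lemma)
    finally have "adjugate A $ k $ j = (B *v axis j 1) $ k * det A" .
    then show ?thesis by (simp add: matrix_vector_mul_component inner_axis mult.commute)
  qed
  then show ?thesis by (simp add: vec_eq_iff)
qed

lemma entire_adjugate:
  fixes b :: "real \<Rightarrow> real^'d^'d"
  assumes "entire_matrix b" shows "entire_matrix (\<lambda>t. adjugate (b t))"
proof -
  have "entire_matrix (\<lambda>t. \<chi> i l. if l = k then (axis j 1 :: real^'d) $ i else b t $ i $ l)" for k j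
    unfolding entire_matrix_def
  proof (intro allI)
    fix i l show "entire (\<lambda>t. (\<chi> i l. if l = k then (axis j 1 :: real^'d) $ i else b t $ i $ l) $ i $ l)"
      using assms by (cases "l = k") (auto simp: entire_matrix_def)
  qed
  then have "entire (\<lambda>t. adjugate (b t) $ k $ j)" for k j
    unfolding adjugate_def vec_lambda_beta by (rule entire_det)
  then show ?thesis by (simp only: entire_matrix_def) blast
qed

lemma det_eq_0_inverse: "det (A :: real^'d^'d) \<noteq> 0 \<longleftrightarrow> (\<exists>B. A ** B = mat 1)"
  by (metis invertible_det_nz invertible_right_inverse)

lemma has_vector_derivative_affine_arg:
  fixes f :: "real \<Rightarrow> 'a::real_normed_vector"
  assumes "(f has_vector_derivative v) (at (a + c * t))"
  shows "((\<lambda>h. f (a + c * h)) has_vector_derivative c *\<^sub>R v) (at t)"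
proof -
  have "((\<lambda>h. a + c * h) has_vector_derivative c) (at t)"
    by (auto intro!: derivative_eq_intros)
  from vector_diff_chain_at[OF this assms] show ?thesis by (simp add: o_def)
qed

text \<open>Velocities, at time zero, of curves through the identity whose differentiability is asked only
there. This makes the set a subspace for elementary reasons: sums come from products of curves,
multiples from rescaling the parameter.\<close>

definition tangent_at_one :: "(real^'d^'d) set \<Rightarrow> (real^'d^'d) set" where
  "tangent_at_one \<Gamma> = {X. \<exists>\<kappa>::real \<Rightarrow> _. \<kappa> 0 = mat 1 \<and> (\<forall>h. \<kappa> h \<in> \<Gamma>) \<and>
     (\<kappa> has_vector_derivative X) (at 0)}"

lemma subspace_tangent_at_one:
  assumes one: "mat 1 \<in> \<Gamma>" and mult: "\<And>X Y. X \<in> \<Gamma> \<Longrightarrow> Y \<in> \<Gamma> \<Longrightarrow> X ** Y \<in> \<Gamma>"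
  shows "subspace (tangent_at_one \<Gamma>)"
  unfolding subspace_def
proof (intro conjI ballI allI)
  show "0 \<in> tangent_at_one \<Gamma>"
    unfolding tangent_at_one_def
    by (intro CollectI exI[of _ "\<lambda>_. mat 1"]) (auto simp: one)
next
  fix X Y assume "X \<in> tangent_at_one \<Gamma>" "Y \<in> tangent_at_one \<Gamma>"
  then obtain \<kappa> \<mu> :: "real \<Rightarrow> _" where \<kappa>: "\<kappa> 0 = mat 1" "\<And>h. \<kappa> h \<in> \<Gamma>" "(\<kappa> has_vector_derivative X) (at 0)"
    and \<mu>: "\<mu> 0 = mat 1" "\<And>h. \<mu> h \<in> \<Gamma>" "(\<mu> has_vector_derivative Y) (at 0)"
    unfolding tangent_at_one_def by blast
  have "((\<lambda>h. \<kappa> h ** \<mu> h) has_vector_derivative (\<kappa> 0 ** Y + X ** \<mu> 0)) (at 0)"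
    by (rule mm.has_vector_derivative[OF \<kappa>(3) \<mu>(3)])
  then show "X + Y \<in> tangent_at_one \<Gamma>"
    unfolding tangent_at_one_def using \<kappa> \<mu> mult
    by (intro CollectI exI[of _ "\<lambda>h. \<kappa> h ** \<mu> h"]) (auto simp: add.commute)
next
  fix c X assume "X \<in> tangent_at_one \<Gamma>"
  then obtain \<kappa> :: "real \<Rightarrow> _" where \<kappa>: "\<kappa> 0 = mat 1" "\<And>h. \<kappa> h \<in> \<Gamma>" "(\<kappa> has_vector_derivative X) (at 0)"
    unfolding tangent_at_one_def by blast
  have "((\<lambda>h. \<kappa> (c * h)) has_vector_derivative c *\<^sub>R X) (at 0)"
    using has_vector_derivative_affine_arg[of \<kappa> X 0 c 0] \<kappa>(3) by simp
  then show "c *\<^sub>R X \<in> tangent_at_one \<Gamma>"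
    unfolding tangent_at_one_def using \<kappa> by (intro CollectI exI[of _ "\<lambda>h. \<kappa> (c * h)"]) auto
qed

lemma has_vector_derivative_zero_bound:
  fixes f :: "real \<Rightarrow> 'a::real_normed_vector"
  assumes "(f has_vector_derivative v) (at 0)" "f 0 = 0" "norm v < c"
  obtains \<rho> where "0 < \<rho>" "\<And>h. \<bar>h\<bar> < \<rho> \<Longrightarrow> norm (f h) \<le> c * \<bar>h\<bar>"
proof -
  have "\<exists>d>0. \<forall>y. norm (y - 0) < d \<longrightarrow>
      norm (f y - f 0 - (y - 0) *\<^sub>R v) \<le> (c - norm v) * norm (y - 0)"
    using assms(1,3) unfolding has_vector_derivative_def has_derivative_at_alt by auto
  then obtain d where d: "d > 0" "\<And>y. \<bar>y\<bar> < d \<Longrightarrow> norm (f y - y *\<^sub>R v) \<le> (c - norm v) * \<bar>y\<bar>"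
    using assms(2) by auto
  have "norm (f h) \<le> c * \<bar>h\<bar>" if "\<bar>h\<bar> < d" for h
  proof -
    have "norm (f h) \<le> norm (f h - h *\<^sub>R v) + norm (h *\<^sub>R v)"
      using norm_triangle_ineq[of "f h - h *\<^sub>R v" "h *\<^sub>R v"] by simp
    also have "\<dots> \<le> (c - norm v) * \<bar>h\<bar> + \<bar>h\<bar> * norm v" using d(2)[OF that] by simp
    finally show ?thesis by (simp add: algebra_simps)
  qed
  then show ?thesis using that d(1) by blast
qed

text \<open>Analytic continuation to the left of the origin. The curve \<open>w = b' adj b\<close> is a multiple of the
logarithmic velocity \<open>b' b\<inverse>\<close>. It is tangent to the group for positive times, and since tangency is
given by linear equations on an entire function, it is tangent for all times. A curve with tangent
logarithmic velocity cannot leave the group: to first order, its distance to the group grows at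
most by a factor \<open>1 + L h\<close> in time \<open>h\<close>.\<close>

lemma entire_curve_stays_in_group:
  fixes \<Gamma> :: "(real^'d^'d) set" and b :: "real \<Rightarrow> real^'d^'d"
  assumes one: "mat 1 \<in> \<Gamma>" and mult: "\<And>X Y. X \<in> \<Gamma> \<Longrightarrow> Y \<in> \<Gamma> \<Longrightarrow> X ** Y \<in> \<Gamma>"
    and inv: "\<And>X. X \<in> \<Gamma> \<Longrightarrow> \<exists>Y\<in>\<Gamma>. X ** Y = mat 1"
    and closed: "\<And>X. X \<in> closure \<Gamma> \<Longrightarrow> det X \<noteq> 0 \<Longrightarrow> X \<in> \<Gamma>"
    and ent: "entire_matrix b" and nz: "\<And>t. \<bar>t\<bar> < \<epsilon> \<Longrightarrow> det (b t) \<noteq> 0"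
    and right: "\<And>t. 0 \<le> t \<Longrightarrow> t < \<epsilon> \<Longrightarrow> b t \<in> \<Gamma>" and t: "\<bar>t\<bar> < \<epsilon>"
  shows "b t \<in> \<Gamma>"
proof (cases "0 \<le> t")
  case True then show ?thesis using right t by simp
next
  case False
  have eps: "0 < \<epsilon>" using t by linarith
  obtain b' where b': "entire_matrix b'" "\<And>t. (b has_vector_derivative b' t) (at t)"
    using entire_matrix_derivative[OF ent] by blast
  let ?H = "tangent_at_one \<Gamma>"
  have sub: "subspace ?H" by (rule subspace_tangent_at_one[OF one mult])
  (* The determinant is the denominator that is cleared. *)
  define w where "w s = b' s ** adjugate (b s)" for s
  have w_inv: "w s = det (b s) *\<^sub>R (b' s ** Y)" if "b s ** Y = mat 1" for s Y
    unfolding w_def adjugate_inverse[OF that] by (rule mm.scaleR_right)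
  have w_ent: "entire_matrix w"
    unfolding w_def by (intro entire_matrix_mult b' entire_adjugate ent)
  have wright: "w s \<in> ?H" if s: "0 < s" "s < \<epsilon>" for s
  proof -
    obtain Y where Y: "Y \<in> \<Gamma>" "b s ** Y = mat 1" using inv right s by (meson less_imp_le)
    define e where "e = min s (\<epsilon> - s)"
    define \<kappa> where "\<kappa> h = (if \<bar>h\<bar> < e then b (s + h) ** Y else mat 1)" for h
    have e: "e > 0" using s by (simp add: e_def)
    have "\<kappa> 0 = mat 1" using e Y by (simp add: \<kappa>_def)
    moreover have "\<kappa> h \<in> \<Gamma>" for h
      unfolding \<kappa>_def using Y one by (auto intro!: mult right simp: e_def)
    moreover have "(\<kappa> has_vector_derivative b' s ** Y) (at 0)"
    proof -
      have "((\<lambda>h. b (s + h)) has_vector_derivative b' s) (at 0)"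
        using has_vector_derivative_affine_arg[of b "b' s" s 1 0] b'(2)[of s] by simp
      then have "((\<lambda>h. b (s + h) ** Y) has_vector_derivative b' s ** Y) (at 0)"
        by (rule bounded_linear.has_vector_derivative[OF mm.bounded_linear_left])
      then show ?thesis
        by (rule has_vector_derivative_transform_within_open[of _ _ _ "{-e<..<e}"])
          (use e in \<open>auto simp: \<kappa>_def\<close>)
    qed
    ultimately have "b' s ** Y \<in> ?H" unfolding tangent_at_one_def by blast
    then show ?thesis unfolding w_inv[OF Y(2)] by (rule subspace_mul[OF sub])
  qed
  have w_in: "w s \<in> ?H" for s
  proof -
    (* Membership in the tangent space is expressed by the vanishing of entire functions. *)
    have "orthogonal Z (w s)" if Z: "Z \<in> ?H\<^sup>\<bottom>" for Z
    proof -
      have "Z \<bullet> w s = 0"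
      proof (rule entire_zero_right[where f = "\<lambda>s. Z \<bullet> w s", OF _ _ eps])
        show "entire (\<lambda>s. Z \<bullet> w s)"
          unfolding inner_vec_def using w_ent
          by (auto simp: entire_matrix_def intro!: entire_sum entire_mult)
        show "Z \<bullet> w s = 0" if "0 < s" "s < \<epsilon>" for s
          using wright[OF that] Z by (auto simp: orthogonal_comp_def orthogonal_def inner_commute)
      qed
      then show ?thesis by (simp add: orthogonal_def)
    qed
    then have "w s \<in> ?H\<^sup>\<bottom>\<^sup>\<bottom>" by (simp add: orthogonal_comp_def)
    then show ?thesis using orthogonal_comp_self[OF sub] by simp
  qed
  define u where "u s = inverse (det (b s)) *\<^sub>R w s" for s
  have u_in: "u s \<in> ?H" for s unfolding u_def by (rule subspace_mul[OF sub w_in])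
  have ub: "u s ** b s = b' s" if sl: "\<bar>s\<bar> < \<epsilon>" for s
  proof -
    obtain Y where Y: "b s ** Y = mat 1" using nz[OF sl] det_eq_0_inverse by blast
    then have "Y ** b s = mat 1" by (simp add: matrix_left_right_inverse)
    then show ?thesis unfolding u_def w_inv[OF Y] using nz[OF sl]
      by (simp add: mm.scaleR_left flip: matrix_mul_assoc)
  qed
  define l where "l = - t"
  have l: "0 < l" "l < \<epsilon>" using False t by (auto simp: l_def)
  have "continuous_on {-l..0} u"
    unfolding u_def using l
    by (intro continuous_intros continuous_at_imp_continuous_on ballI entire_isCont entire_det ent
        entire_matrix_isCont w_ent nz) auto
  then have "bounded (u ` {-l..0})"
    by (rule compact_continuous_image[THEN compact_imp_bounded]) simp
  then obtain U where U: "\<And>s. s \<in> {-l..0} \<Longrightarrow> norm (u s) \<le> U"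
    unfolding bounded_iff by blast
  then have U0: "0 \<le> U" using order_trans[OF norm_ge_zero U[of 0]] l by simp
  obtain C where C: "0 < C" "\<And>(X :: real^'d^'d) (Y :: real^'d^'d). norm (X ** Y) \<le> norm X * norm Y * C"
    using mm.pos_bounded by blast
  define L where "L = C * (U + 1)"
  have L: "0 \<le> L" using C U0 by (simp add: L_def)
  define \<delta> where "\<delta> s = infdist (b (- s)) \<Gamma>" for s
  have "\<delta> l \<le> 0"
  proof (rule dini_comparison[where \<delta> = \<delta> and t = l and l = l and L = L])
    show "continuous_on {0..l} \<delta>"
    proof -
      have "continuous_on UNIV b"
        by (intro continuous_at_imp_continuous_on ballI entire_matrix_isCont ent)
      then have "continuous_on {0..l} (\<lambda>s. b (- s))"
        by (rule continuous_on_compose2) (auto intro: continuous_intros)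
      then show ?thesis unfolding \<delta>_def by (rule continuous_on_infdist)
    qed
    show "\<delta> 0 \<le> 0" using right[of 0] eps by (simp add: \<delta>_def)
    fix s \<eta> :: real assume s: "0 \<le> s" "s < l" and \<eta>: "0 < \<eta>"
    obtain \<kappa> :: "real \<Rightarrow> real^'d^'d" where \<kappa>: "\<kappa> 0 = mat 1" "\<And>h. \<kappa> h \<in> \<Gamma>"
      "(\<kappa> has_vector_derivative u (- s)) (at 0)"
      using u_in[of "- s"] unfolding tangent_at_one_def by blast
    have "((\<lambda>h. \<kappa> h - mat 1) has_vector_derivative u (- s)) (at 0)"
      using has_vector_derivative_diff[OF \<kappa>(3) has_vector_derivative_const[of "mat 1"]] by simp
    moreover have "norm (u (- s)) < U + 1" using U[of "- s"] s by simp
    ultimately obtain \<rho>1 where \<rho>1: "0 < \<rho>1" "\<And>h. \<bar>h\<bar> < \<rho>1 \<Longrightarrow> norm (\<kappa> h - mat 1) \<le> (U + 1) * \<bar>h\<bar>"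
      using has_vector_derivative_zero_bound[of "\<lambda>h. \<kappa> h - mat 1"] \<kappa>(1) by auto
    have "((\<lambda>h. b (- s + h)) has_vector_derivative b' (- s)) (at 0)"
      using has_vector_derivative_affine_arg[of b "b' (- s)" "- s" 1 0] b'(2)[of "- s"] by simp
    moreover have "((\<lambda>h. \<kappa> h ** b (- s)) has_vector_derivative u (- s) ** b (- s)) (at 0)"
      by (rule bounded_linear.has_vector_derivative[OF mm.bounded_linear_left \<kappa>(3)])
    ultimately have "((\<lambda>h. b (- s + h) - \<kappa> h ** b (- s)) has_vector_derivative
        b' (- s) - u (- s) ** b (- s)) (at 0)"
      by (rule has_vector_derivative_diff)
    then have "((\<lambda>h. b (- s + h) - \<kappa> h ** b (- s)) has_vector_derivative 0) (at 0)"
      using ub[of "- s"] s l by simp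
    then obtain \<rho>2 where \<rho>2: "0 < \<rho>2"
      "\<And>h. \<bar>h\<bar> < \<rho>2 \<Longrightarrow> norm (b (- s + h) - \<kappa> h ** b (- s)) \<le> \<eta> * \<bar>h\<bar>"
      using has_vector_derivative_zero_bound[of "\<lambda>h. b (- s + h) - \<kappa> h ** b (- s)" 0 \<eta>] \<kappa>(1) \<eta> by auto
    have "\<delta> (s + h) \<le> (1 + L * h) * \<delta> s + \<eta> * h" if h: "0 < h" "h < min \<rho>1 \<rho>2" for h
    proof -
      have "(\<delta> (s + h) - \<eta> * h) / (1 + L * h) \<le> dist (b (- s)) z" if z: "z \<in> \<Gamma>" for z
      proof -
        let ?k = "\<kappa> (- h)" and ?y = "b (- s) - z"
        have "\<delta> (s + h) \<le> dist (b (- (s + h))) (?k ** z)"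
          unfolding \<delta>_def by (rule infdist_le) (rule mult[OF \<kappa>(2) z])
        also have "\<dots> = norm ((b (- s + - h) - ?k ** b (- s)) + (?y + (?k - mat 1) ** ?y))"
          by (simp add: dist_norm mm.diff_left mm.diff_right)
        also have "\<dots> \<le> \<eta> * h + (norm ?y + norm ((?k - mat 1) ** ?y))"
          using \<rho>2(2)[of "- h"] h by (intro norm_triangle_le add_mono norm_triangle_ineq) auto
        also have "norm ((?k - mat 1) ** ?y) \<le> norm (?k - mat 1) * norm ?y * C" by (rule C(2))
        also have "\<dots> \<le> ((U + 1) * h) * norm ?y * C"
          using \<rho>1(2)[of "- h"] h C(1) by (intro mult_right_mono) auto
        finally have "\<delta> (s + h) \<le> \<eta> * h + (1 + L * h) * dist (b (- s)) z"
          by (simp add: L_def dist_norm algebra_simps)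
        moreover have "0 < 1 + L * h" using L h by (simp add: add_pos_nonneg)
        ultimately show ?thesis by (simp add: pos_divide_le_eq algebra_simps)
      qed
      then have "(\<delta> (s + h) - \<eta> * h) / (1 + L * h) \<le> \<delta> s"
        unfolding \<delta>_def[of s] using one
        by (subst infdist_notempty) (auto intro!: cINF_greatest)
      moreover have "0 < 1 + L * h" using L h by (simp add: add_pos_nonneg)
      ultimately show ?thesis by (simp add: pos_divide_le_eq algebra_simps)
    qed
    then show "\<exists>\<rho>>0. \<forall>h. 0 < h \<and> h < \<rho> \<and> s + h \<le> l \<longrightarrow> \<delta> (s + h) \<le> (1 + L * h) * \<delta> s + \<eta> * h"
      using \<rho>1(1) \<rho>2(1) by (intro exI[of _ "min \<rho>1 \<rho>2"]) auto
  qed (use L l in auto)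
  then have "infdist (b t) \<Gamma> = 0" using infdist_nonneg[of "b t" \<Gamma>] by (simp add: \<delta>_def l_def)
  then have "b t \<in> closure \<Gamma>" using in_closure_iff_infdist_zero one by blast
  then show ?thesis using closed nz t by blast
qed

section \<open>Matrix groups with scalars and a projection as identity\<close>

text \<open>A closed set of matrices whose nonzero elements form a group with identity \<open>P\<close>, where \<open>P\<close> is
only a projection. Scalars are included, so that membership is a projective property.\<close>

locale scaled_matrix_group =
  fixes H :: "(real^'d^'d) set" and P :: "real^'d^'d"
  assumes closed_H: "closed H"
    and scaleR_H: "R \<in> H \<Longrightarrow> c *\<^sub>R R \<in> H"
    and mult_H: "R \<in> H \<Longrightarrow> R' \<in> H \<Longrightarrow> R ** R' \<in> H"
    and P_H: "P \<in> H" and P_nz: "P \<noteq> 0"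
    and P_left: "R \<in> H \<Longrightarrow> P ** R = R" and P_right: "R \<in> H \<Longrightarrow> R ** P = R"
    and inverse_H: "R \<in> H \<Longrightarrow> R \<noteq> 0 \<Longrightarrow> \<exists>R'\<in>H. R ** R' = P"
begin

text \<open>The group of nonzero elements acts on the image of \<open>P\<close>; letting it act as the identity on the
kernel of \<open>P\<close> makes it a group of invertible matrices.\<close>

definition unital_extension :: "(real^'d^'d) set" where
  "unital_extension = {R + (mat 1 - P) | R. R \<in> H \<and> R \<noteq> 0}"

lemma unital_mult:
  assumes "R \<in> H" "R' \<in> H"
  shows "(R + (mat 1 - P)) ** (R' + (mat 1 - P)) = R ** R' + (mat 1 - P)"
  using P_left[OF assms(2)] P_right[OF assms(1)] P_left[OF P_H]
  by (simp add: mm.add_left mm.add_right mm.diff_left mm.diff_right)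

lemma mult_nz:
  assumes "R \<in> H" "R' \<in> H" "R \<noteq> 0" "R' \<noteq> 0" shows "R ** R' \<noteq> 0"
proof
  assume 0: "R ** R' = 0"
  obtain Y Y' where Y: "R ** Y = P" "Y \<in> H" "R' ** Y' = P" using inverse_H assms by meson
  have "P = R ** (R' ** Y') ** Y" using Y P_right[OF assms(1)] by simp
  also have "\<dots> = R ** R' ** (Y' ** Y)" by (simp add: matrix_mul_assoc)
  finally show False using 0 P_nz by simp
qed

lemma inverse_nz: assumes "R \<in> H" "R \<noteq> 0" obtains Y where "Y \<in> H" "Y \<noteq> 0" "R ** Y = P"
  using inverse_H[OF assms] P_nz by (metis mm.zero_right)

lemma unital_extension_group:
  shows unital_one: "mat 1 \<in> unital_extension"
    and unital_mult_closed: "X \<in> unital_extension \<Longrightarrow> Y \<in> unital_extension \<Longrightarrow> X ** Y \<in> unital_extension"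
    and unital_inverse: "X \<in> unital_extension \<Longrightarrow> \<exists>Y\<in>unital_extension. X ** Y = mat 1"
    and unital_closed: "X \<in> closure unital_extension \<Longrightarrow> det X \<noteq> 0 \<Longrightarrow> X \<in> unital_extension"
proof -
  show "mat 1 \<in> unital_extension"
    unfolding unital_extension_def using P_H P_nz by (intro CollectI exI[of _ P]) simp
  show "X ** Y \<in> unital_extension" if XY: "X \<in> unital_extension" "Y \<in> unital_extension"
  proof -
    obtain R R' where R: "X = R + (mat 1 - P)" "Y = R' + (mat 1 - P)" "R \<in> H" "R \<noteq> 0" "R' \<in> H" "R' \<noteq> 0"
      using XY unfolding unital_extension_def by blast
    show ?thesis
      unfolding R(1,2) unital_mult[OF R(3,5)] unital_extension_def
      using R mult_H mult_nz by blast
  qed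
  show "\<exists>Y\<in>unital_extension. X ** Y = mat 1" if X: "X \<in> unital_extension"
  proof -
    obtain R where R: "X = R + (mat 1 - P)" "R \<in> H" "R \<noteq> 0"
      using X unfolding unital_extension_def by blast
    obtain Y where Y: "Y \<in> H" "Y \<noteq> 0" "R ** Y = P" using inverse_nz[OF R(2,3)] .
    then have "X ** (Y + (mat 1 - P)) = mat 1" unfolding R(1) unital_mult[OF R(2) Y(1)] by simp
    then show ?thesis using Y unfolding unital_extension_def by blast
  qed
  show "X \<in> unital_extension" if X: "X \<in> closure unital_extension" "det X \<noteq> 0"
  proof -
    have "closed ((\<lambda>R. R + (mat 1 - P)) ` H)"
      using closed_translation[OF closed_H, of "mat 1 - P"] by (simp add: add.commute)
    then have "closure unital_extension \<subseteq> (\<lambda>R. R + (mat 1 - P)) ` H"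
      by (intro closure_minimal) (auto simp: unital_extension_def)
    then obtain R where R: "R \<in> H" "X = R + (mat 1 - P)" using X by blast
    have "R \<noteq> 0"
    proof
      assume "R = 0"
      then have "X ** P = 0" using P_left[OF P_H] by (simp add: R(2) mm.diff_left)
      moreover obtain Z where "Z ** X = mat 1"
        using X(2) det_eq_0_inverse matrix_left_right_inverse by blast
      ultimately have "P = 0" by (metis matrix_mul_assoc matrix_mul_lid mm.zero_right)
      then show False using P_nz by simp
    qed
    then show ?thesis using R unfolding unital_extension_def by blast
  qed
qed

lemma unital_det: "X \<in> unital_extension \<Longrightarrow> det X \<noteq> 0"
  using unital_inverse det_eq_0_inverse by blast

text \<open>At the time \<open>t1\<close> the curve may vanish. Dividing by the power \<open>(t - t1)\<^sup>m\<close> of its order of vanishing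
leaves an analytic curve that is still in \<open>H\<close> to the right of \<open>t1\<close>, because \<open>H\<close> contains all
multiples of its elements, and is nonzero at \<open>t1\<close>. Its unital extension is invertible near \<open>t1\<close>,
so it stays in the group to the left of \<open>t1\<close>. Scalars of both signs matter when \<open>m\<close> is odd.\<close>

lemma continuation_step:
  fixes L B M :: "real^'d^'d"
  assumes Pa: "\<And>t. P ** (L ** mat_exp (t *\<^sub>R B) ** M) ** P = L ** mat_exp (t *\<^sub>R B) ** M"
    and right: "\<And>t. t1 < t \<Longrightarrow> L ** mat_exp (t *\<^sub>R B) ** M \<in> H"
  obtains \<epsilon> where "0 < \<epsilon>" "\<And>t. t1 - \<epsilon> < t \<Longrightarrow> L ** mat_exp (t *\<^sub>R B) ** M \<in> H"
proof -
  define a where "a t = L ** mat_exp (t *\<^sub>R B) ** M" for t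
  define c where "c n = (1 / fact n) *\<^sub>R ((L ** mat_exp (t1 *\<^sub>R B)) ** mpow B n ** M)" for n
  have a_shift: "a (t1 + s) = (L ** mat_exp (t1 *\<^sub>R B)) ** mat_exp (s *\<^sub>R B) ** M" for s
    by (simp add: a_def mat_exp_add matrix_mul_assoc)
  have sums: "(\<lambda>n. c n $ i $ j * s ^ n) sums (a (t1 + s) $ i $ j)" for i j s
  proof -
    have "(\<lambda>n. s ^ n *\<^sub>R c n) sums a (t1 + s)"
      unfolding a_shift c_def
      using bounded_linear.sums[OF mm.bounded_linear_left[of M]
          bounded_linear.sums[OF mm.bounded_linear_right[of "L ** mat_exp (t1 *\<^sub>R B)"] mat_exp_sums]]
      by (simp add: mm.scaleR_left mm.scaleR_right)
    from bounded_linear.sums[OF bounded_linear_vec_nth[of j]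
        bounded_linear.sums[OF bounded_linear_vec_nth[of i] this]]
    show ?thesis by (simp add: mult.commute)
  qed
  show ?thesis
  proof (cases "\<forall>n. c n = 0")
    case True
    have "a t = 0" for t
    proof -
      have "a t $ i $ j = 0" for i j
        using sums[of i j "t - t1"] True sums_unique2[OF sums_zero] by simp
      then show ?thesis by (simp add: vec_eq_iff)
    qed
    moreover have "0 \<in> H" using scaleR_H[OF P_H, of 0] by simp
    ultimately show ?thesis using that[of 1] by (simp add: a_def)
  next
    case False
    define m where "m = (LEAST n. c n \<noteq> 0)"
    have cm: "c m \<noteq> 0" unfolding m_def by (rule LeastI_ex) (use False in simp)
    have below: "c n = 0" if "n < m" for n using not_less_Least that unfolding m_def by blast
    have "\<exists>g. entire g \<and> (\<forall>s. a (t1 + s) $ i $ j = s ^ m * g s) \<and> g 0 = c m $ i $ j" for i j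
    proof -
      have z: "c n $ i $ j = 0" if "n < m" for n using below[OF that] by simp
      show ?thesis by (rule entire_shift_coeff[where m = m, OF sums[of i j] z]) blast+
    qed
    then obtain g where g: "\<And>i j. entire (g i j)" "\<And>i j s. a (t1 + s) $ i $ j = s ^ m * g i j s"
      "\<And>i j. g i j 0 = c m $ i $ j" by metis
    define e where "e s = (\<chi> i j. g i j s)" for s
    have e_ent: "entire_matrix e" using g(1) by (simp add: entire_matrix_def e_def)
    have ae: "a (t1 + s) = s ^ m *\<^sub>R e s" for s using g(2) by (simp add: vec_eq_iff e_def)
    have e0: "e 0 = c m" using g(3) by (simp add: vec_eq_iff e_def)
    have eH: "e s \<in> H" if "0 < s" for s
    proof -
      have "e s = inverse (s ^ m) *\<^sub>R a (t1 + s)" using that by (simp add: ae)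
      then show ?thesis using right[of "t1 + s"] that scaleR_H by (simp add: a_def)
    qed
    have eH0: "e 0 \<in> H"
    proof (rule Lim_in_closed_set[OF closed_H])
      show "\<forall>\<^sub>F s in at_right 0. e s \<in> H"
        using eH by (simp add: eventually_at_filter)
      show "(e \<longlongrightarrow> e 0) (at_right 0)"
        using entire_matrix_isCont[OF e_ent, of 0] unfolding isCont_def
        by (rule tendsto_mono[rotated]) (simp add: at_le)
    qed simp
    define b where "b s = P ** e s ** P + (mat 1 - P)" for s
    have b_H: "b s = e s + (mat 1 - P)" if "e s \<in> H" for s
      using that by (simp add: b_def P_left P_right)
    have b_ent: "entire_matrix b"
      unfolding b_def by (intro entire_matrix_add entire_matrix_mult entire_matrix_const e_ent)
    have "b 0 \<in> unital_extension"
      using eH0 cm e0 unfolding b_H[OF eH0] unital_extension_def by auto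
    then have det0: "det (b 0) \<noteq> 0" by (rule unital_det)
    have "\<forall>\<^sub>F s in at 0. det (b s) \<noteq> 0 \<and> e s \<noteq> 0"
      using tendsto_imp_eventually_ne[OF entire_isCont[OF entire_det[OF b_ent], of 0, unfolded isCont_def] det0]
        tendsto_imp_eventually_ne[OF entire_matrix_isCont[OF e_ent, of 0, unfolded isCont_def], of 0] cm e0
      by (auto intro: eventually_conj)
    then obtain \<epsilon> where \<epsilon>': "0 < \<epsilon>"
      "\<And>s. s \<noteq> 0 \<Longrightarrow> \<bar>s\<bar> < \<epsilon> \<Longrightarrow> det (b s) \<noteq> 0 \<and> e s \<noteq> 0"
      unfolding eventually_at by (auto simp: dist_real_def)
    then have \<epsilon>: "0 < \<epsilon>" "\<And>s. \<bar>s\<bar> < \<epsilon> \<Longrightarrow> det (b s) \<noteq> 0" "\<And>s. \<bar>s\<bar> < \<epsilon> \<Longrightarrow> e s \<noteq> 0"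
      using det0 cm e0 by metis+
    have b_in: "b s \<in> unital_extension" if s: "\<bar>s\<bar> < \<epsilon>" for s
    proof (rule entire_curve_stays_in_group[OF unital_one unital_mult_closed unital_inverse unital_closed b_ent])
      show "b s \<in> unital_extension" if s: "0 \<le> s" "s < \<epsilon>" for s
      proof -
        have "e s \<in> H" using eH eH0 s by (cases "s = 0") auto
        then show ?thesis using \<epsilon>(3)[of s] s unfolding b_H[OF \<open>e s \<in> H\<close>] unital_extension_def by auto
      qed
    qed (use \<epsilon> s in auto)
    have aH: "a (t1 + s) \<in> H" if s: "\<bar>s\<bar> < \<epsilon>" for s
    proof -
      obtain R where R: "R \<in> H" "b s = R + (mat 1 - P)" using b_in[OF s] unfolding unital_extension_def by blast
      then have "P ** e s ** P = R" by (simp add: b_def)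
      moreover have "a (t1 + s) = s ^ m *\<^sub>R (P ** e s ** P)"
      proof -
        have "a (t1 + s) = P ** a (t1 + s) ** P" unfolding a_def by (rule Pa[symmetric])
        then show ?thesis unfolding ae by (simp only: mm.scaleR_left mm.scaleR_right)
      qed
      ultimately show ?thesis using scaleR_H[OF R(1)] by simp
    qed
    have "a t \<in> H" if "t1 - \<epsilon> < t" for t
      using aH[of "t - t1"] right[of t] that by (cases "t1 < t") (auto simp: a_def)
    then show ?thesis using \<epsilon>(1) that unfolding a_def by blast
  qed
qed

lemma exp_curve_stays:
  fixes L B M :: "real^'d^'d"
  assumes Pa: "\<And>t. P ** (L ** mat_exp (t *\<^sub>R B) ** M) ** P = L ** mat_exp (t *\<^sub>R B) ** M"
    and right: "\<And>t. \<tau> \<le> t \<Longrightarrow> L ** mat_exp (t *\<^sub>R B) ** M \<in> H"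
  shows "L ** mat_exp (t *\<^sub>R B) ** M \<in> H"
proof (rule ccontr)
  let ?a = "\<lambda>t. L ** mat_exp (t *\<^sub>R B) ** M"
  assume t: "?a t \<notin> H"
  define T where "T = {u. \<forall>s>u. ?a s \<in> H}"
  have "\<tau> \<in> T" using right by (auto simp: T_def)
  have lower: "t \<le> u" if "u \<in> T" for u using that t by (force simp: T_def)
  then have bdd: "bdd_below T" by (rule bdd_belowI)
  have "?a s \<in> H" if sT: "Inf T < s" for s
  proof -
    obtain u where "u \<in> T" "u < s" using cInf_less_iff[OF _ bdd, of s] sT \<open>\<tau> \<in> T\<close> by auto
    then show ?thesis by (auto simp: T_def)
  qed
  then obtain \<epsilon> where \<epsilon>: "0 < \<epsilon>" "\<And>t. Inf T - \<epsilon> < t \<Longrightarrow> ?a t \<in> H"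
    using continuation_step[OF Pa] by blast
  then have "Inf T - \<epsilon> \<in> T" by (simp add: T_def)
  then have "Inf T \<le> Inf T - \<epsilon>" using bdd by (rule cInf_lower)
  then show False using \<epsilon>(1) by simp
qed
end

section \<open>Elements of least rank in a closed semigroup of matrices\<close>

lemma mpow_add: "mpow R (m + n) = mpow R m ** mpow R n"
  by (induction m) (simp_all add: matrix_mul_assoc)

lemma matrix_eq_on_decomposition:
  fixes R R' :: "real^'d^'d"
  assumes "\<And>x. \<exists>v\<in>V. \<exists>w\<in>W. x = v + w" "\<And>v. v \<in> V \<Longrightarrow> R *v v = R' *v v"
    "\<And>w. w \<in> W \<Longrightarrow> R *v w = R' *v w"
  shows "R = R'"
proof -
  have "R *v x = R' *v x" for x
  proof -
    obtain v w where "v \<in> V" "w \<in> W" "x = v + w" using assms(1)[of x] by blast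
    then show ?thesis using assms(2,3) by (simp add: mv.add_right)
  qed
  then show ?thesis by (simp add: matrix_eq)
qed

text \<open>A nonzero element \<open>R0\<close> of least rank, multiplied by a suitable \<open>Z\<close>, gives \<open>Q = R0 Z\<close> whose image \<open>V\<close>
and kernel \<open>W\<close> together span the space. The elements of \<open>T\<close> with image in \<open>V\<close> that vanish on \<open>W\<close>
have full rank on \<open>V\<close> unless they vanish, so that the normalised ones form a compact semigroup
without zero divisors. As in every compact cancellative semigroup, inverses are limits of
powers.\<close>

lemma exists_scaled_matrix_group:
  fixes T :: "(real^'d^'d) set"
  assumes closed_T: "closed T" and scaleR_T: "\<And>X c. X \<in> T \<Longrightarrow> c *\<^sub>R X \<in> T"
    and mult_T: "\<And>X Y. X \<in> T \<Longrightarrow> Y \<in> T \<Longrightarrow> X ** Y \<in> T"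
    and nz_T: "\<exists>X\<in>T. X \<noteq> 0"
    and irr_T: "\<And>X Y. X \<in> T \<Longrightarrow> Y \<in> T \<Longrightarrow> X \<noteq> 0 \<Longrightarrow> Y \<noteq> 0 \<Longrightarrow> \<exists>Z\<in>T. X ** Z ** Y \<noteq> 0"
  obtains H P where "scaled_matrix_group H P" "H \<subseteq> T" "\<And>X. X \<in> T \<Longrightarrow> P ** X ** P \<in> H"
proof -
  let ?rk = "\<lambda>R :: real^'d^'d. dim (range ((*v) R))"
  obtain R0 where R0: "R0 \<in> T" "R0 \<noteq> 0" and min: "\<And>R. R \<in> T \<Longrightarrow> R \<noteq> 0 \<Longrightarrow> ?rk R0 \<le> ?rk R"
  proof -
    obtain X where X: "X \<in> T \<and> X \<noteq> 0" using nz_T by blast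
    show ?thesis
      using that arg_min_natI[of "\<lambda>X. X \<in> T \<and> X \<noteq> 0", OF X]
        arg_min_nat_le[of "\<lambda>X. X \<in> T \<and> X \<noteq> 0" _ ?rk] by blast
  qed
  define V where "V = range ((*v) R0)"
  have subV: "subspace V" unfolding V_def
    by (intro linear_subspace_image matrix_vector_mul_linear subspace_UNIV)
  have full: "range ((*v) R) = V" if "R \<in> T" "R \<noteq> 0" "range ((*v) R) \<subseteq> V" for R
  proof (rule subspace_dim_equal[OF _ subV that(3)])
    show "subspace (range ((*v) R))"
      by (intro linear_subspace_image matrix_vector_mul_linear subspace_UNIV)
    show "dim V \<le> dim (range ((*v) R))" using min[OF that(1,2)] by (simp add: V_def)
  qed
  obtain Z where Z: "Z \<in> T" "R0 ** Z ** R0 \<noteq> 0" using irr_T[OF R0(1) R0(1) R0(2) R0(2)] by blast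
  define Q where "Q = R0 ** Z"
  have Q: "Q \<in> T" "Q \<noteq> 0" using mult_T[OF R0(1) Z(1)] Z(2) by (auto simp: Q_def)
  have QR0: "range ((*v) (Q ** R0)) = V"
    using Z(2) by (intro full mult_T Q R0)
      (auto simp: Q_def V_def simp flip: matrix_vector_mul_assoc)
  define W where "W = {x. Q *v x = 0}"
  have decomp: "\<exists>v\<in>V. \<exists>w\<in>W. x = v + w" for x
  proof -
    have "Q *v x \<in> V" by (auto simp: Q_def V_def simp flip: matrix_vector_mul_assoc)
    then obtain y where y: "Q *v x = Q *v (R0 *v y)"
      unfolding QR0[symmetric] by (auto simp flip: matrix_vector_mul_assoc)
    have "x = R0 *v y + (x - R0 *v y)" "R0 *v y \<in> V" "x - R0 *v y \<in> W"
      using y by (auto simp: V_def W_def mv.diff_right)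
    then show ?thesis by blast
  qed
  define H where "H = {R \<in> T. range ((*v) R) \<subseteq> V \<and> (\<forall>w\<in>W. R *v w = 0)}"
  have HT: "H \<subseteq> T" by (auto simp: H_def)
  have H_range: "R *v x \<in> V" if "R \<in> H" for R x using that by (auto simp: H_def)
  have H_ker: "R *v w = 0" if "R \<in> H" "w \<in> W" for R w using that by (auto simp: H_def)
  have HV: "range ((*v) R) = V" if "R \<in> H" "R \<noteq> 0" for R
    using that by (intro full) (auto simp: H_def)
  have scaleR_H: "c *\<^sub>R R \<in> H" if "R \<in> H" for R c
    using that scaleR_T subspace_mul[OF subV] unfolding H_def by (auto simp: mv.scaleR_left)
  have mult_H: "R ** R' \<in> H" if "R \<in> H" "R' \<in> H" for R R'
    using that mult_T unfolding H_def by (auto simp: mv.zero_right simp flip: matrix_vector_mul_assoc)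
  have QH: "Q \<in> H" using Q by (auto simp: H_def W_def V_def Q_def simp flip: matrix_vector_mul_assoc)
  have eqH: "R = R'" if "R \<in> H" "R' \<in> H" "\<And>v. v \<in> V \<Longrightarrow> R *v v = R' *v v" for R R'
    by (rule matrix_eq_on_decomposition[OF decomp]) (use that H_ker in auto)
  have zero_H: "0 \<in> H" using scaleR_H[OF QH, of 0] by simp
  have mult_nz: "R ** R' \<noteq> 0" if "R \<in> H" "R' \<in> H" "R \<noteq> 0" "R' \<noteq> 0" for R R'
  proof
    assume 0: "R ** R' = 0"
    have "R *v v = 0 *v v" if "v \<in> V" for v
    proof -
      obtain y where "v = R' *v y" using HV \<open>R' \<in> H\<close> \<open>R' \<noteq> 0\<close> \<open>v \<in> V\<close> by blast
      then show ?thesis using 0 by (simp add: matrix_vector_mul_assoc)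
    qed
    then show False using eqH[OF \<open>R \<in> H\<close> zero_H] \<open>R \<noteq> 0\<close> by blast
  qed
  have closed_H: "closed H"
  proof -
    have "H = T \<inter> (\<Inter>x. {R. R *v x \<in> V}) \<inter> (\<Inter>w\<in>W. {R. R *v w = 0})" by (auto simp: H_def)
    moreover have "closed {R :: real^'d^'d. R *v x \<in> V}" for x
    proof -
      have "closed ((\<lambda>R :: real^'d^'d. R *v x) -` V)"
        by (intro continuous_closed_vimage closed_subspace subV)
          (rule linear_continuous_at[OF mv.bounded_linear_left])
      then show ?thesis by (simp add: vimage_def)
    qed
    moreover have "closed {R :: real^'d^'d. R *v w = 0}" for w
      by (intro closed_Collect_eq continuous_intros linear_continuous_on[OF mv.bounded_linear_left])
    ultimately show ?thesis using closed_T by (auto intro!: closed_Int closed_INT)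
  qed
  have inv: "\<exists>R'\<in>H. \<forall>v\<in>V. R' *v (R *v v) = v" if R: "R \<in> H" "R \<noteq> 0" for R
  proof -
    have pow: "mpow R (Suc n) \<in> H \<and> mpow R (Suc n) \<noteq> 0" for n
    proof (induction n)
      case 0 then show ?case using R by simp
    next
      case (Suc n)
      then show ?case
        unfolding mpow_simps(2)[of R "Suc n"] using mult_H R(1) mult_nz[OF R(1) _ R(2)] by blast
    qed
    define A where "A n = (1 / norm (mpow R (Suc n))) *\<^sub>R mpow R (Suc n)" for n
    have A: "A n \<in> H" "norm (A n) = 1" for n using pow[of n] scaleR_H by (auto simp: A_def)
    have normalize: "M = norm M *\<^sub>R A j" if "M = c *\<^sub>R mpow R (Suc j)" "0 \<le> c" for M c j
      using that pow[of j] by (simp add: A_def)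
    have comp: "compact (H \<inter> sphere 0 1)" using closed_H by (simp add: closed_Int_compact)
    then obtain Ai r where r: "Ai \<in> H \<inter> sphere 0 1" "strict_mono r" "(A \<circ> r) \<longlonglongrightarrow> Ai"
      using A unfolding compact_def by (metis IntI dist_0_norm mem_sphere)
    (* Two steps of r make the exponent of R in the numerator at least one, also after splitting
       off the factor R; A n belongs to the power n + 1. *)
    define X where "X n = A (r (n + 2) - r n - 2)" for n
    obtain Xi s where s: "Xi \<in> H \<inter> sphere 0 1" "strict_mono s" "(X \<circ> s) \<longlonglongrightarrow> Xi"
      using comp A unfolding compact_def X_def[abs_def] by (metis (no_types, lifting) IntI dist_0_norm mem_sphere)
    let ?M = "\<lambda>n. X n ** R ** A (r n)"
    have M: "?M n = norm (?M n) *\<^sub>R A (r (n + 2))" for n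
    proof (rule normalize)
      have "r n < r (n + 1)" "r (n + 1) < r (n + 2)" using r(2) by (auto simp: strict_mono_def)
      then have e: "Suc (r (n + 2)) = Suc (r (n + 2) - r n - 2) + (1 + Suc (r n))" by simp
      show "?M n = ((1 / norm (mpow R (Suc (r (n + 2) - r n - 2)))) * (1 / norm (mpow R (Suc (r n)))))
          *\<^sub>R mpow R (Suc (r (n + 2)))"
        unfolding X_def A_def mm.scaleR_left mm.scaleR_right scaleR_scaleR
        by (subst e, subst mpow_add, subst mpow_add) (simp add: matrix_mul_assoc)
    qed simp
    define Zi where "Zi = Xi ** R ** Ai"
    have lim_M: "(\<lambda>n. ?M (s n)) \<longlonglongrightarrow> Zi"
      unfolding Zi_def
    proof (intro mm.tendsto tendsto_const)
      show "(\<lambda>n. X (s n)) \<longlonglongrightarrow> Xi" using s(3) by (simp add: o_def)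
      show "(\<lambda>n. A (r (s n))) \<longlonglongrightarrow> Ai"
        using LIMSEQ_subseq_LIMSEQ[OF r(3) s(2)] by (simp add: o_def)
    qed
    have sm: "strict_mono (\<lambda>n. s n + 2)" using s(2) by (simp add: strict_mono_def)
    have "(\<lambda>n. norm (?M (s n)) *\<^sub>R A (r (s n + 2))) \<longlonglongrightarrow> norm Zi *\<^sub>R Ai"
      using LIMSEQ_subseq_LIMSEQ[OF r(3) sm]
      by (intro tendsto_scaleR tendsto_norm lim_M) (simp add: o_def)
    then have "(\<lambda>n. ?M (s n)) \<longlonglongrightarrow> norm Zi *\<^sub>R Ai" using M by simp
    then have ZA: "Zi = norm Zi *\<^sub>R Ai" by (rule LIMSEQ_unique[OF lim_M])
    have nz: "Xi \<noteq> 0" "Ai \<noteq> 0" using r(1) s(1) by auto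
    then have Zi: "Zi \<noteq> 0" unfolding Zi_def using r(1) s(1) R by (intro mult_nz mult_H) auto
    (* Xi R Ai is a positive multiple of Ai, and the image of Ai is V; so Xi inverts R on V up
       to a scalar. *)
    define R' where "R' = (1 / norm Zi) *\<^sub>R Xi"
    have "R' *v (R *v v) = v" if v: "v \<in> V" for v
    proof -
      obtain y where y: "v = Ai *v y" using HV[of Ai] r(1) nz v by blast
      have "R' *v (R *v v) = (1 / norm Zi) *\<^sub>R (Zi *v y)"
        unfolding R'_def y Zi_def by (simp add: mv.scaleR_left mm.scaleR_left matrix_vector_mul_assoc matrix_mul_assoc)
      also have "Zi *v y = (norm Zi *\<^sub>R Ai) *v y" using ZA by (rule arg_cong)
      also have "\<dots> = norm Zi *\<^sub>R v" by (simp add: mv.scaleR_left y)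
      finally show ?thesis using Zi by simp
    qed
    moreover have "R' \<in> H" using s(1) scaleR_H by (simp add: R'_def)
    ultimately show ?thesis by blast
  qed
  obtain Q' where Q': "Q' \<in> H" "\<And>v. v \<in> V \<Longrightarrow> Q' *v (Q *v v) = v" using inv[OF QH Q(2)] by blast
  define P where "P = Q' ** Q"
  have PH: "P \<in> H" unfolding P_def by (rule mult_H[OF Q'(1) QH])
  have PV: "P *v v = v" if "v \<in> V" for v using Q'(2)[OF that] by (simp add: P_def matrix_vector_mul_assoc)
  have P_left: "P ** R = R" if "R \<in> H" for R
    using PV H_range[OF that] by (simp add: matrix_eq flip: matrix_vector_mul_assoc)
  have P_right: "R ** P = R" if "R \<in> H" for R
    by (rule eqH[OF mult_H[OF that PH] that]) (simp add: PV flip: matrix_vector_mul_assoc)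
  have Pnz: "P \<noteq> 0" using P_left[OF QH] Q(2) by auto
  have left_inv: "\<exists>R'\<in>H. R' ** R = P" if Rn: "R \<in> H" "R \<noteq> 0" for R
  proof -
    obtain R' where R': "R' \<in> H" "\<And>v. v \<in> V \<Longrightarrow> R' *v (R *v v) = v" using inv[OF Rn] by blast
    have "R' ** R = P"
      by (rule eqH[OF mult_H[OF R'(1) Rn(1)] PH]) (simp add: R' PV flip: matrix_vector_mul_assoc)
    then show ?thesis using R'(1) by blast
  qed
  have "scaled_matrix_group H P"
  proof
    fix R assume R: "R \<in> H" "R \<noteq> 0"
    obtain R' where R': "R' \<in> H" "R' ** R = P" using left_inv[OF R] by blast
    then have "R' \<noteq> 0" using Pnz by auto
    then obtain R'' where R'': "R'' \<in> H" "R'' ** R' = P" using left_inv R'(1) by blast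
    have "R'' = R'' ** R' ** R" using P_right[OF R''(1)] R'(2) by (simp flip: matrix_mul_assoc)
    then have "R'' = R" using R''(2) P_left[OF R(1)] by simp
    then show "\<exists>R'\<in>H. R ** R' = P" using R'' R'(1) by blast
  qed (use closed_H scaleR_H mult_H PH Pnz P_left P_right in auto)
  moreover have "P ** X ** P \<in> H" if "X \<in> T" for X
    unfolding H_def using that PH HT H_range[OF PH] H_ker[OF PH]
    by (auto intro!: mult_T simp: mv.zero_right simp flip: matrix_vector_mul_assoc)
  ultimately show ?thesis using that HT by blast
qed

section \<open>Projective space and irreducibility\<close>

text \<open>Sets of lines are handled through the nonzero vectors spanning them; this turns the quotient
topology into the topology of the vector space.\<close>

definition vectors_over :: "(real^'d) set set \<Rightarrow> (real^'d) set" where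
  "vectors_over U = {x. x \<noteq> 0 \<and> span {x} \<in> U}"

lemma span_singleton_eq_iff:
  fixes x y :: "'a::real_vector"
  assumes "x \<noteq> 0" "y \<noteq> 0"
  shows "span {x} = span {y} \<longleftrightarrow> (\<exists>c. c \<noteq> 0 \<and> y = c *\<^sub>R x)"
proof
  assume "span {x} = span {y}"
  then have "y \<in> span {x}" using span_base[of y "{y}"] by simp
  then obtain c where "y = c *\<^sub>R x" by (auto simp: span_singleton)
  then show "\<exists>c. c \<noteq> 0 \<and> y = c *\<^sub>R x" using assms by auto
next
  assume "\<exists>c. c \<noteq> 0 \<and> y = c *\<^sub>R x"
  then obtain c where c: "c \<noteq> 0" "y = c *\<^sub>R x" by blast
  have "(1 / c) *\<^sub>R y \<in> span {y}" by (rule span_mul) (simp add: span_base)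
  then have "x \<in> span {y}" using c by simp
  moreover have "y \<in> span {x}" unfolding c(2) by (rule span_mul) (simp add: span_base)
  ultimately show "span {x} = span {y}" by (simp add: span_eq)
qed

lemma proj_points_iff: "s \<in> proj_points \<longleftrightarrow> (\<exists>x. x \<noteq> 0 \<and> s = span {x})"
proof
  assume "s \<in> proj_points"
  then have s: "subspace s" "dim s = 1" by (auto simp: proj_points_def)
  obtain B where B: "B \<subseteq> s" "independent B" "s \<subseteq> span B" "card B = dim s"
    using basis_exists by blast
  then obtain x where "B = {x}" using s by (auto simp: card_1_singleton_iff)
  moreover have "span B = s" using B s(1) by (metis span_minimal subset_antisym)
  moreover have "x \<noteq> 0" using B(2) \<open>B = {x}\<close> dependent_zero by blast
  ultimately show "\<exists>x. x \<noteq> 0 \<and> s = span {x}" by blast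
qed (auto simp: proj_points_def dim_singleton)

lemma topspace_proj_space [simp]: "topspace (proj_space :: (real^'d) set topology) = proj_points"
proof -
  have "openin (proj_space :: (real^'d) set topology) proj_points"
  proof -
    have "{x::real^'d. x \<noteq> 0 \<and> span {x} \<in> proj_points} = - {0}" by (auto simp: proj_points_iff)
    then show ?thesis unfolding openin_proj_space by (simp add: open_Compl)
  qed
  then show ?thesis
    using openin_subset[of proj_space "proj_points :: (real^'d) set set"]
      openin_topspace[of "proj_space :: (real^'d) set topology"]
    unfolding openin_proj_space[of "topspace _"] by blast
qed

lemma vectors_over_scaleR: "x \<in> vectors_over U \<Longrightarrow> c \<noteq> 0 \<Longrightarrow> c *\<^sub>R x \<in> vectors_over U"
  using span_singleton_eq_iff[of x "c *\<^sub>R x"] by (auto simp: vectors_over_def)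

lemma closure_vectors_over_scaleR: assumes "x \<in> closure (vectors_over U)" "c \<noteq> 0" shows "c *\<^sub>R x \<in> closure (vectors_over U)"
proof -
  have "(*\<^sub>R) c ` closure (vectors_over U) \<subseteq> closure (vectors_over U)"
    unfolding closure_scaleR using assms(2) by (intro closure_mono) (auto simp: vectors_over_scaleR)
  then show ?thesis using assms(1) by blast
qed

text \<open>Both closures are tested on open sets that are invariant under nonzero scalars, and the complement
of the closure of such a set of vectors is again one.\<close>

lemma span_in_closure_of_iff:
  fixes x :: "real^'d"
  assumes X: "X \<subseteq> proj_points" and x: "x \<noteq> 0"
  shows "span {x} \<in> proj_space closure_of X \<longleftrightarrow> x \<in> closure (vectors_over X)"
proof
  assume cl: "span {x} \<in> proj_space closure_of X"
  show "x \<in> closure (vectors_over X)"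
  proof (rule ccontr)
    assume n: "x \<notin> closure (vectors_over X)"
    define W where "W = - closure (vectors_over X) - {0}"
    (* The lines outside the closure form an open set separating span {x} from X. *)
    define U where "U = (\<lambda>z. span {z}) ` W"
    have "{z. z \<noteq> 0 \<and> span {z} \<in> U} = W"
    proof -
      have "z \<in> W" if z: "z \<noteq> 0" "span {z} = span {w}" "w \<in> W" for z w
      proof -
        have "w \<noteq> 0" using z(3) by (auto simp: W_def)
        then obtain c where c: "c \<noteq> 0" "w = c *\<^sub>R z" using span_singleton_eq_iff[OF z(1), of w] z(2) by blast
        then show ?thesis using z(1,3) closure_vectors_over_scaleR[of z X c] by (auto simp: W_def)
      qed
      then show ?thesis by (auto simp: U_def W_def)
    qed
    moreover have "open W" unfolding W_def by (intro open_Diff open_Compl closed_closure closed_singleton)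
    moreover have "U \<subseteq> proj_points" by (auto simp: U_def W_def proj_points_iff)
    ultimately have "openin proj_space U" by (simp add: openin_proj_space)
    moreover have "span {x} \<in> U" using n x by (auto simp: U_def W_def)
    ultimately obtain y where y: "y \<in> X" "y \<in> U" using cl unfolding in_closure_of by blast
    then obtain z where z: "z \<in> W" "y = span {z}" by (auto simp: U_def)
    then have "z \<in> vectors_over X" using y by (auto simp: vectors_over_def W_def)
    then show False using z closure_subset[of "vectors_over X"] by (auto simp: W_def)
  qed
next
  assume cl: "x \<in> closure (vectors_over X)"
  show "span {x} \<in> proj_space closure_of X"
    unfolding in_closure_of
  proof (intro conjI allI impI)
    show "span {x} \<in> topspace proj_space" using x by (auto simp: proj_points_iff)
    fix U :: "(real^'d) set set" assume U: "span {x} \<in> U \<and> openin proj_space U"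
    then have "open {z. z \<noteq> 0 \<and> span {z} \<in> U}" "x \<in> {z. z \<noteq> 0 \<and> span {z} \<in> U}"
      using x by (auto simp: openin_proj_space)
    then obtain z where "z \<in> vectors_over X" "z \<noteq> 0" "span {z} \<in> U"
      using cl unfolding closure_iff_nhds_not_empty by blast
    then show "\<exists>y. y \<in> X \<and> y \<in> U" by (auto simp: vectors_over_def)
  qed
qed

lemma proj_act_span: "proj_act M (span {x}) = span {M *v x}"
  unfolding proj_act_def using linear_span_image[OF matrix_vector_mul_linear, of M "{x}"] by simp

lemma flow_prod_nz: "x \<noteq> 0 \<Longrightarrow> flow_prod ws *v x \<noteq> 0"
  by (metis flow_prod_inv_left matrix_vector_mul_assoc matrix_vector_mul_lid mv.zero_right)

lemma dwell_mult: "\<Phi> \<in> dwell_semigroup S \<tau> \<Longrightarrow> \<Psi> \<in> dwell_semigroup S \<tau> \<Longrightarrow> \<Phi> ** \<Psi> \<in> dwell_semigroup S \<tau>"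
  unfolding dwell_semigroup_def
proof clarify
  fix ws vs :: "((real^'a^'a) \<times> real) list"
  assume "ws \<noteq> []" "\<forall>(A, t)\<in>set ws. A \<in> S \<and> \<tau> \<le> t" "vs \<noteq> []" "\<forall>(A, t)\<in>set vs. A \<in> S \<and> \<tau> \<le> t"
  then show "\<exists>us. flow_prod ws ** flow_prod vs = flow_prod us \<and> us \<noteq> [] \<and> (\<forall>(A, t)\<in>set us. A \<in> S \<and> \<tau> \<le> t)"
    by (intro exI[of _ "vs @ ws"]) (auto simp: flow_prod_append)
qed

lemma mat_exp_in_dwell: "A \<in> S \<Longrightarrow> \<tau> \<le> t \<Longrightarrow> mat_exp (t *\<^sub>R A) \<in> dwell_semigroup S \<tau>"
  unfolding dwell_semigroup_def by (intro CollectI exI[of _ "[(A, t)]"]) simp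

lemma dwell_subset_group: "dwell_semigroup S \<tau> \<subseteq> flow_group S"
  unfolding dwell_semigroup_def flow_group_def by blast

lemma flow_group_mult: "\<Phi> \<in> flow_group S \<Longrightarrow> \<Psi> \<in> flow_group S \<Longrightarrow> \<Phi> ** \<Psi> \<in> flow_group S"
  unfolding flow_group_def
proof clarify
  fix ws vs :: "((real^'a^'a) \<times> real) list"
  assume "ws \<noteq> []" "\<forall>(A, t)\<in>set ws. A \<in> S" "vs \<noteq> []" "\<forall>(A, t)\<in>set vs. A \<in> S"
  then show "\<exists>us. flow_prod ws ** flow_prod vs = flow_prod us \<and> us \<noteq> [] \<and> (\<forall>(A, t)\<in>set us. A \<in> S)"
    by (intro exI[of _ "vs @ ws"]) (auto simp: flow_prod_append)
qed

lemma flow_group_inverse: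
  assumes "g \<in> flow_group S" obtains h where "h \<in> flow_group S" "h ** g = mat 1" "g ** h = mat 1"
proof -
  obtain ws where ws: "g = flow_prod ws" "ws \<noteq> []" "\<forall>(A, t)\<in>set ws. A \<in> S"
    using assms unfolding flow_group_def by blast
  then have "flow_prod (inv_word ws) \<in> flow_group S"
    unfolding flow_group_def by (intro CollectI exI[of _ "inv_word ws"]) (auto simp: inv_word_def)
  then show ?thesis using that ws(1) by simp
qed

lemma flow_group_nz: "g \<in> flow_group S \<Longrightarrow> x \<noteq> 0 \<Longrightarrow> g *v x \<noteq> 0"
  unfolding flow_group_def using flow_prod_nz by blast

lemma flow_group_one: "S \<noteq> {} \<Longrightarrow> mat 1 \<in> flow_group S"
  unfolding flow_group_def
proof -
  assume "S \<noteq> {}"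
  then obtain A where "A \<in> S" by blast
  then show "mat 1 \<in> {flow_prod ws |ws. ws \<noteq> [] \<and> (\<forall>(A, t)\<in>set ws. A \<in> S)}"
    by (intro CollectI exI[of _ "[(A, 0)]"]) simp
qed

text \<open>An injective linear map that sends a finite-dimensional subspace into itself maps it onto itself.
So invariance for large times implies invariance for all times, negative ones included.\<close>

lemma one_parameter_invariant:
  fixes E :: "real \<Rightarrow> 'a::euclidean_space \<Rightarrow> 'a"
  assumes lin: "\<And>t. linear (E t)" and add: "\<And>s t x. E (s + t) x = E s (E t x)"
    and zero: "\<And>x. E 0 x = x" and U: "subspace U"
    and inv: "\<And>t x. \<tau> \<le> t \<Longrightarrow> x \<in> U \<Longrightarrow> E t x \<in> U" and x: "x \<in> U"
  shows "E h x \<in> U"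
proof -
  define s where "s = \<bar>\<tau>\<bar> + \<bar>h\<bar>"
  have cancel: "E (- s) (E s y) = y" for y using add[of "- s" s y] zero by simp
  have "inj (E s)" by (metis cancel injI)
  then have "dim (E s ` U) = dim U"
    by (intro dim_image_eq lin) (auto intro: inj_on_subset)
  then have "E s ` U = U"
    using inv[of s] by (intro subspace_dim_equal linear_subspace_image lin U) (auto simp: s_def)
  then obtain y where y: "y \<in> U" "x = E s y" using x by blast
  have "E h x = E (h + s) y" using add[of h s y] y(2) by simp
  also have "\<dots> \<in> U" using y(1) by (intro inv) (auto simp: s_def)
  finally show ?thesis .
qed

text \<open>Irreducibility speaks of the matrices in \<open>S\<close>, the semigroup only of their flows after time \<open>\<tau>\<close>.
The flows preserve \<open>U\<close> for all times, and differentiating at time zero gives the matrices back.\<close>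

lemma invariant_subspace_trivial:
  fixes S :: "(real^'d^'d) set"
  assumes irr: "irreducible_matrices S" and U: "subspace U" "U \<noteq> {0}"
    and inv: "\<And>A t x. A \<in> S \<Longrightarrow> \<tau> \<le> t \<Longrightarrow> x \<in> U \<Longrightarrow> mat_exp (t *\<^sub>R A) *v x \<in> U"
  shows "U = UNIV"
proof -
  have "A *v x \<in> U" if A: "A \<in> S" and x: "x \<in> U" for A x
  proof -
    have all: "mat_exp (h *\<^sub>R A) *v x \<in> U" for h
      by (rule one_parameter_invariant[where E = "\<lambda>t. (*v) (mat_exp (t *\<^sub>R A))" and \<tau> = \<tau>])
        (use U(1) inv[OF A] x in \<open>auto simp: mat_exp_add matrix_vector_mul_assoc\<close>)
    have "orthogonal y (A *v x)" if y: "y \<in> U\<^sup>\<bottom>" for y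
    proof -
      have "((\<lambda>h. mat_exp (h *\<^sub>R A)) has_vector_derivative A) (at 0)"
        using mat_exp_has_vector_derivative[of A 0] by simp
      from bounded_linear.has_vector_derivative[OF bounded_linear_compose[OF bounded_linear_inner_right mv.bounded_linear_left] this]
      have "((\<lambda>h. y \<bullet> (mat_exp (h *\<^sub>R A) *v x)) has_vector_derivative y \<bullet> (A *v x)) (at 0)" .
      moreover have "y \<bullet> (mat_exp (h *\<^sub>R A) *v x) = 0" for h
        using y all[of h] by (auto simp: orthogonal_comp_def orthogonal_def inner_commute)
      ultimately have "((\<lambda>h::real. 0::real) has_vector_derivative y \<bullet> (A *v x)) (at 0)" by simp
      then have "y \<bullet> (A *v x) = 0"
        using vector_derivative_unique_at has_vector_derivative_const by blast
      then show ?thesis by (simp add: orthogonal_def)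
    qed
    then have "A *v x \<in> U\<^sup>\<bottom>\<^sup>\<bottom>" by (simp add: orthogonal_comp_def)
    then show ?thesis using orthogonal_comp_self[OF U(1)] by simp
  qed
  then show ?thesis using irr U unfolding irreducible_matrices_def by blast
qed

lemma dwell_semigroup_escapes_kernel:
  fixes S :: "(real^'d^'d) set" and R :: "real^'d^'d"
  assumes irr: "irreducible_matrices S" and ne: "S \<noteq> {}" and R: "R \<noteq> 0" and x: "x \<noteq> 0"
  obtains \<Phi> where "\<Phi> \<in> dwell_semigroup S \<tau>" "R *v (\<Phi> *v x) \<noteq> 0"
proof (rule ccontr)
  assume neg: "\<not> thesis"
  define G where "G = (\<lambda>\<Phi>. \<Phi> *v x) ` dwell_semigroup S \<tau>"
  have "span G = UNIV"
  proof (rule invariant_subspace_trivial[OF irr subspace_span])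
    obtain A where "A \<in> S" using ne by blast
    then have "flow_prod [(A, \<tau>)] *v x \<in> G"
      unfolding G_def using mat_exp_in_dwell[of A S \<tau> \<tau>] by auto
    then show "span G \<noteq> {0}" using flow_prod_nz[OF x, of "[(A, \<tau>)]"] span_base by blast
    fix A t y assume A: "A \<in> S" "\<tau> \<le> t" and y: "y \<in> span G"
    let ?E = "mat_exp (t *\<^sub>R A)"
    have "(*v) ?E ` G \<subseteq> G"
      unfolding G_def using dwell_mult[OF mat_exp_in_dwell[OF A]] by (auto simp: matrix_vector_mul_assoc)
    then have "(*v) ?E ` span G \<subseteq> span G"
      unfolding linear_span_image[OF matrix_vector_mul_linear, symmetric] by (rule span_mono)
    then show "?E *v y \<in> span G" using y by blast
  qed
  moreover have "span G \<subseteq> {y. R *v y = 0}"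
  proof (rule span_minimal)
    show "G \<subseteq> {y. R *v y = 0}" using neg that by (auto simp: G_def)
    show "subspace {y. R *v y = 0}"
      by (auto simp: subspace_def mv.add_right mv.scaleR_right)
  qed
  ultimately have "R *v y = 0 *v y" for y by auto
  then show False using R by (simp add: matrix_eq)
qed

section \<open>A common point of all closures of reachable sets\<close>

text \<open>Only directions matter in projective space, so limits of matrices are taken up to scalars. The
limits may be singular.\<close>

definition scaled_closure :: "(real^'d^'d) set \<Rightarrow> (real^'d^'d) set" where
  "scaled_closure M = closure {c *\<^sub>R X | c X. X \<in> M}"

lemma scaled_closure_scaleR: assumes "X \<in> scaled_closure M" shows "c *\<^sub>R X \<in> scaled_closure M"
proof -
  have "(*\<^sub>R) c ` {c *\<^sub>R X | c X. X \<in> M} \<subseteq> {c *\<^sub>R X | c X. X \<in> M}"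
    by (force simp: image_iff)
  then have "(*\<^sub>R) c ` scaled_closure M \<subseteq> scaled_closure M"
    unfolding scaled_closure_def closure_scaleR by (rule closure_mono)
  then show ?thesis using assms by blast
qed

lemma scaled_closure_mult:
  assumes M: "\<And>X Y. X \<in> M \<Longrightarrow> Y \<in> M \<Longrightarrow> X ** Y \<in> M"
    and "X \<in> scaled_closure M" "Y \<in> scaled_closure M" shows "X ** Y \<in> scaled_closure M"
proof -
  let ?C = "{c *\<^sub>R X | c X. X \<in> M}"
  obtain x y where x: "\<And>n. x n \<in> ?C" "x \<longlonglongrightarrow> X" and y: "\<And>n. y n \<in> ?C" "y \<longlonglongrightarrow> Y"
    using assms(2,3) unfolding scaled_closure_def closure_sequential by blast
  have "x n ** y n \<in> ?C" for n
  proof -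
    obtain c A where 1: "x n = c *\<^sub>R A" "A \<in> M" using x(1)[of n] by blast
    obtain e B where 2: "y n = e *\<^sub>R B" "B \<in> M" using y(1)[of n] by blast
    have "x n ** y n = (c * e) *\<^sub>R (A ** B)" unfolding 1 2 by (simp add: mm.scaleR_left mm.scaleR_right)
    then show ?thesis using M[OF 1(2) 2(2)] by blast
  qed
  moreover have "(\<lambda>n. x n ** y n) \<longlonglongrightarrow> X ** Y" by (rule mm.tendsto[OF x(2) y(2)])
  ultimately show ?thesis unfolding scaled_closure_def closure_sequential
    by (intro exI[of _ "\<lambda>n. x n ** y n"] conjI allI)
qed

lemma reach_subset_orbit:
  assumes "q \<in> orbit S s0" shows "reach S \<tau> q \<subseteq> orbit S s0"
proof -
  obtain g where g: "g \<in> flow_group S" "q = proj_act g s0" using assms unfolding orbit_def by blast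
  have "proj_act (M ** g) s0 = proj_act M q" for M
    unfolding g(2) proj_act_def image_image by (simp add: matrix_vector_mul_assoc)
  then show ?thesis
    using g flow_group_mult dwell_subset_group unfolding reach_def orbit_def by blast
qed

lemma orbit_iff:
  assumes "s0 = span {x0}" shows "s \<in> orbit S s0 \<longleftrightarrow> (\<exists>g\<in>flow_group S. s = span {g *v x0})"
  unfolding orbit_def assms by (auto simp: proj_act_span)

lemma span_in_proj_points: "x \<noteq> 0 \<Longrightarrow> span {x} \<in> proj_points"
  unfolding proj_points_iff by blast

lemma orbit_subset_proj_points:
  assumes "s0 \<in> proj_points" shows "orbit S s0 \<subseteq> proj_points"
proof -
  obtain x0 where "x0 \<noteq> 0" "s0 = span {x0}" using assms by (auto simp: proj_points_iff)
  then show ?thesis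
    using orbit_iff[of s0 x0] flow_group_nz[of _ S x0] by (auto simp: span_in_proj_points)
qed

lemma reach_span: "reach S \<tau> (span {x}) = {span {\<Phi> *v x} | \<Phi>. \<Phi> \<in> dwell_semigroup S \<tau>}"
  unfolding reach_def by (auto simp: proj_act_span)

lemma reach_subset_proj_points: "x \<noteq> 0 \<Longrightarrow> reach S \<tau> (span {x}) \<subseteq> proj_points"
proof
  fix p assume "x \<noteq> 0" "p \<in> reach S \<tau> (span {x})"
  then obtain \<Phi> where "\<Phi> \<in> flow_group S" "p = span {\<Phi> *v x}"
    unfolding reach_span using dwell_subset_group by blast
  then show "p \<in> proj_points" using flow_group_nz[of \<Phi> S x] \<open>x \<noteq> 0\<close> by (simp add: span_in_proj_points)
qed

text \<open>A singular limit still acts continuously on the lines outside its kernel.\<close>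

lemma scaled_closure_reach:
  fixes x :: "real^'d"
  assumes R: "R \<in> scaled_closure (dwell_semigroup S \<tau>)" and x: "x \<noteq> 0" "R *v x \<noteq> 0"
  shows "span {R *v x} \<in> proj_space closure_of reach S \<tau> (span {x})"
proof -
  let ?C = "{c *\<^sub>R X | c X. X \<in> dwell_semigroup S \<tau>}"
  have "R *v x \<in> closure ((\<lambda>M. M *v x) ` ?C)"
    using closure_bounded_linear_image_subset[OF mv.bounded_linear_left, of x ?C] R
    unfolding scaled_closure_def by blast
  moreover have "(\<lambda>M. M *v x) ` ?C \<subseteq> insert 0 (vectors_over (reach S \<tau> (span {x})))"
  proof clarify
    fix c \<Phi> assume \<Phi>: "\<Phi> \<in> dwell_semigroup S \<tau>" and n: "(c *\<^sub>R \<Phi>) *v x \<notin> vectors_over (reach S \<tau> (span {x}))"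
    have "\<Phi> *v x \<in> vectors_over (reach S \<tau> (span {x}))"
      unfolding vectors_over_def reach_span using \<Phi> flow_group_nz[OF _ x(1)] dwell_subset_group by blast
    then show "(c *\<^sub>R \<Phi>) *v x = 0" using n vectors_over_scaleR[of "\<Phi> *v x" _ c] by (auto simp: mv.scaleR_left)
  qed
  ultimately have "R *v x \<in> closure (insert 0 (vectors_over (reach S \<tau> (span {x}))))" using closure_mono by blast
  then have "R *v x \<in> closure (vectors_over (reach S \<tau> (span {x})))" using x(2) by (simp add: closure_insert)
  then show ?thesis
    using span_in_closure_of_iff[OF reach_subset_proj_points[OF x(1)] x(2)] by blast
qed

lemma reach_closure_trans:
  fixes q :: "(real^'d) set"
  assumes q: "q \<in> proj_points" and p: "p \<in> proj_space closure_of reach S \<tau> q"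
  shows "proj_space closure_of reach S \<tau> p \<subseteq> proj_space closure_of reach S \<tau> q"
proof -
  obtain x where x: "x \<noteq> 0" "q = span {x}" using q by (auto simp: proj_points_iff)
  have "p \<in> proj_points" using p closure_of_subset_topspace[of proj_space] by auto
  then obtain y where y: "y \<noteq> 0" "p = span {y}" by (auto simp: proj_points_iff)
  note sub = reach_subset_proj_points[OF x(1), of S \<tau>]
  have ycl: "y \<in> closure (vectors_over (reach S \<tau> q))"
    using p span_in_closure_of_iff[OF sub y(1)] x(2) y(2) by simp
  have "reach S \<tau> p \<subseteq> proj_space closure_of reach S \<tau> q"
  proof
    fix r assume "r \<in> reach S \<tau> p"
    then obtain \<Phi> where \<Phi>: "\<Phi> \<in> dwell_semigroup S \<tau>" "r = span {\<Phi> *v y}" unfolding y(2) reach_span by blast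
    have nz: "\<Phi> *v z \<noteq> 0" if "z \<noteq> 0" for z
      using flow_group_nz[OF _ that] \<Phi>(1) dwell_subset_group by blast
    have "(*v) \<Phi> ` vectors_over (reach S \<tau> q) \<subseteq> vectors_over (reach S \<tau> q)"
    proof (intro image_subsetI)
      fix z assume "z \<in> vectors_over (reach S \<tau> q)"
      then obtain \<Psi> where z: "z \<noteq> 0" "\<Psi> \<in> dwell_semigroup S \<tau>" "span {z} = span {\<Psi> *v x}"
        unfolding vectors_over_def x(2) reach_span by blast
      have "span {\<Phi> *v z} = span {(\<Phi> ** \<Psi>) *v x}"
        using arg_cong[OF z(3), of "proj_act \<Phi>"] by (simp add: proj_act_span matrix_vector_mul_assoc)
      then show "\<Phi> *v z \<in> vectors_over (reach S \<tau> q)"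
        unfolding vectors_over_def x(2) reach_span using nz[OF z(1)] dwell_mult[OF \<Phi>(1) z(2)] by blast
    qed
    then have "(*v) \<Phi> ` closure (vectors_over (reach S \<tau> q)) \<subseteq> closure (vectors_over (reach S \<tau> q))"
      using closure_bounded_linear_image_subset[OF mv.bounded_linear_right, of \<Phi> "vectors_over (reach S \<tau> q)"]
        closure_mono by blast
    then have "\<Phi> *v y \<in> closure (vectors_over (reach S \<tau> q))" using ycl by blast
    then show "r \<in> proj_space closure_of reach S \<tau> q"
      using span_in_closure_of_iff[OF sub nz[OF y(1)]] by (simp add: \<Phi>(2) x(2))
  qed
  then show ?thesis by (rule closure_of_minimal) simp
qed

text \<open>Induction over the flow factors of \<open>g\<close>. Each factor \<open>exp (t B)\<close> with \<open>t \<ge> \<tau>\<close> can be absorbed in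
the element \<open>\<Phi>\<close> of the semigroup, and exp_curve_stays removes the restriction on \<open>t\<close>. The induction
has to carry \<open>\<Phi>\<close> along for this purpose.\<close>

lemma (in scaled_matrix_group) flow_group_compression:
  fixes S :: "(real^'d^'d) set"
  assumes semi: "\<And>\<Phi>. \<Phi> \<in> dwell_semigroup S \<tau> \<Longrightarrow> P ** \<Phi> ** P \<in> H"
    and g: "g \<in> flow_group S"
  shows "P ** g ** P \<in> H"
proof -
  obtain ws where ws: "g = flow_prod ws" "\<forall>(A, t)\<in>set ws. A \<in> S"
    using g unfolding flow_group_def by blast
  have "\<forall>\<Phi> \<in> insert (mat 1) (dwell_semigroup S \<tau>). P ** \<Phi> ** flow_prod ws ** P \<in> H"
    using ws(2)
  proof (induction ws rule: rev_induct)
    case Nil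
    have "P ** P \<in> H" using P_left[OF P_H] P_H by simp
    then show ?case using semi by auto
  next
    case (snoc w ws)
    obtain A t where w: "w = (A, t)" "A \<in> S" using snoc.prems by auto
    show ?case
    proof
      fix \<Phi> assume \<Phi>: "\<Phi> \<in> insert (mat 1) (dwell_semigroup S \<tau>)"
      have PP: "P ** P = P" using P_left[OF P_H] .
      have "(P ** \<Phi>) ** mat_exp (t *\<^sub>R A) ** (flow_prod ws ** P) \<in> H"
      proof (rule exp_curve_stays[where \<tau> = \<tau>])
        fix t
        show "P ** ((P ** \<Phi>) ** mat_exp (t *\<^sub>R A) ** (flow_prod ws ** P)) ** P
            = (P ** \<Phi>) ** mat_exp (t *\<^sub>R A) ** (flow_prod ws ** P)"
          proof -
          have "P ** (P ** X) = P ** X" for X using PP by (simp add: matrix_mul_assoc)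
          then show ?thesis by (simp add: PP flip: matrix_mul_assoc)
        qed
        assume t: "\<tau> \<le> t"
        have "\<Phi> ** mat_exp (t *\<^sub>R A) \<in> dwell_semigroup S \<tau>"
          using \<Phi> dwell_mult[OF _ mat_exp_in_dwell[OF w(2) t]] mat_exp_in_dwell[OF w(2) t] by auto
        then have "P ** (\<Phi> ** mat_exp (t *\<^sub>R A)) ** flow_prod ws ** P \<in> H"
          using snoc by simp
        then show "(P ** \<Phi>) ** mat_exp (t *\<^sub>R A) ** (flow_prod ws ** P) \<in> H"
          by (simp add: matrix_mul_assoc)
      qed
      then show "P ** \<Phi> ** flow_prod (ws @ [w]) ** P \<in> H"
        by (simp add: w(1) flow_prod_append matrix_mul_assoc)
    qed
  qed
  then show ?thesis using ws(1) by simp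
qed

lemma exists_common_limit_point:
  fixes S :: "(real^'d^'d) set" and \<tau> :: real and s0 :: "(real^'d) set"
  assumes ne: "S \<noteq> {}" and irr: "irreducible_matrices S" and s0: "s0 \<in> proj_points"
    and cl: "closedin proj_space (orbit S s0)"
  obtains p where "p \<in> orbit S s0" "\<And>s. s \<in> orbit S s0 \<Longrightarrow> p \<in> proj_space closure_of reach S \<tau> s"
proof -
  let ?SG = "dwell_semigroup S \<tau>"
  define T where "T = scaled_closure ?SG"
  obtain x0 where x0: "x0 \<noteq> 0" "s0 = span {x0}" using s0 by (auto simp: proj_points_iff)
  have SG_T: "?SG \<subseteq> T"
  proof
    fix X assume "X \<in> ?SG"
    then have "1 *\<^sub>R X \<in> {c *\<^sub>R X | c X. X \<in> ?SG}" by blast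
    then show "X \<in> T" unfolding T_def scaled_closure_def using closure_subset by fastforce
  qed
  obtain A where A: "A \<in> S" using ne by blast
  have nzSG: "\<Phi> *v x \<noteq> 0" if "\<Phi> \<in> ?SG" "x \<noteq> 0" for \<Phi> x
    using flow_group_nz[OF _ that(2)] that(1) dwell_subset_group by blast
  obtain H P where H: "scaled_matrix_group H P" "H \<subseteq> T" "\<And>X. X \<in> T \<Longrightarrow> P ** X ** P \<in> H"
  proof (rule exists_scaled_matrix_group[of T])
    show "closed T" by (simp add: T_def scaled_closure_def)
    show "c *\<^sub>R X \<in> T" if "X \<in> T" for X c using that scaled_closure_scaleR by (simp add: T_def)
    show "X ** Y \<in> T" if "X \<in> T" "Y \<in> T" for X Y
      unfolding T_def by (rule scaled_closure_mult[OF dwell_mult]) (use that in \<open>simp_all add: T_def\<close>)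
    have "mat_exp (\<tau> *\<^sub>R A) \<in> ?SG" by (rule mat_exp_in_dwell[OF A]) simp
    moreover from nzSG[OF this x0(1)] have "mat_exp (\<tau> *\<^sub>R A) \<noteq> 0" by auto
    ultimately show "\<exists>X\<in>T. X \<noteq> 0" using SG_T by blast
    show "\<exists>Z\<in>T. X ** Z ** Y \<noteq> 0" if "X \<in> T" "Y \<in> T" "X \<noteq> 0" "Y \<noteq> 0" for X Y
    proof -
      obtain y where y: "Y *v y \<noteq> 0" using \<open>Y \<noteq> 0\<close> by (metis matrix_eq mv.zero_left)
      obtain \<Phi> where "\<Phi> \<in> ?SG" "X *v (\<Phi> *v (Y *v y)) \<noteq> 0"
        using dwell_semigroup_escapes_kernel[OF irr ne \<open>X \<noteq> 0\<close> y] by blast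
      then show ?thesis using SG_T by (intro bexI[of _ \<Phi>]) (auto simp: matrix_vector_mul_assoc matrix_mul_assoc)
    qed
  qed blast
  interpret scaled_matrix_group H P by (rule H(1))
  have PT: "P \<in> T" using P_H H(2) by blast
  have grp: "P ** g ** P \<in> H" if "g \<in> flow_group S" for g
    using flow_group_compression[of S \<tau>] H(3) SG_T that by blast
  have closure_orbit: "proj_space closure_of reach S \<tau> s \<subseteq> orbit S s0" if "s \<in> orbit S s0" for s
    by (rule closure_of_minimal[OF reach_subset_orbit[OF that] cl])
  have compress: "\<exists>g\<in>flow_group S. \<exists>c y. c \<noteq> 0 \<and> y = c *\<^sub>R (g *v x0) \<and> y \<noteq> 0 \<and> P *v y = y \<and>
      span {y} \<in> proj_space closure_of reach S \<tau> s" if s: "s \<in> orbit S s0" for s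
  proof -
    obtain g where g: "g \<in> flow_group S" "s = span {g *v x0}" using s orbit_iff[OF x0(2)] by blast
    have gx: "g *v x0 \<noteq> 0" by (rule flow_group_nz[OF g(1) x0(1)])
    obtain \<Phi> where \<Phi>: "\<Phi> \<in> ?SG" "P *v (\<Phi> *v (g *v x0)) \<noteq> 0"
      using dwell_semigroup_escapes_kernel[OF irr ne P_nz gx] by blast
    define y where "y = (P ** \<Phi>) *v (g *v x0)"
    have y: "y \<noteq> 0" "P *v y = y" using \<Phi>(2) P_left[OF P_H] by (simp_all add: y_def matrix_vector_mul_assoc matrix_mul_assoc)
    have "P ** \<Phi> \<in> T" unfolding T_def
      by (rule scaled_closure_mult[OF dwell_mult]) (use PT SG_T \<Phi>(1) in \<open>auto simp: T_def\<close>)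
    then have r: "span {y} \<in> proj_space closure_of reach S \<tau> s"
      unfolding g(2) y_def by (intro scaled_closure_reach gx) (use y in \<open>auto simp: T_def y_def\<close>)
    then have "span {y} \<in> orbit S s0" using closure_orbit[OF s] by blast
    then obtain h where h: "h \<in> flow_group S" "span {y} = span {h *v x0}" using orbit_iff[OF x0(2)] by blast
    then obtain c where "c \<noteq> 0" "y = c *\<^sub>R (h *v x0)"
      using span_singleton_eq_iff[OF flow_group_nz[OF h(1) x0(1)] y(1)] by auto
    then show ?thesis using y r h(1) by blast
  qed
  have s0O: "s0 \<in> orbit S s0"
    unfolding orbit_iff[OF x0(2)] using flow_group_one[OF ne] x0(2) by (intro bexI[of _ "mat 1"]) auto
  obtain g1 c1 y where y: "g1 \<in> flow_group S" "c1 \<noteq> 0" "y = c1 *\<^sub>R (g1 *v x0)" "y \<noteq> 0" "P *v y = y"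
    "span {y} \<in> proj_space closure_of reach S \<tau> s0" using compress[OF s0O] by blast
  show ?thesis
  proof (rule that[of "span {y}"])
    show "span {y} \<in> orbit S s0" using y(6) closure_orbit[OF s0O] by blast
    fix s assume s: "s \<in> orbit S s0"
    obtain g2 c2 z where z: "g2 \<in> flow_group S" "c2 \<noteq> 0" "z = c2 *\<^sub>R (g2 *v x0)" "z \<noteq> 0" "P *v z = z"
      "span {z} \<in> proj_space closure_of reach S \<tau> s" using compress[OF s] by blast
    obtain k where k: "k \<in> flow_group S" "k ** g2 = mat 1" using flow_group_inverse[OF z(1)] by blast
    (* R sends z to y and compresses an element of the flow group. *)
    define R where "R = (c1 / c2) *\<^sub>R (P ** (g1 ** k) ** P)"
    have "R \<in> H" unfolding R_def by (intro scaleR_H grp flow_group_mult y(1) k(1))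
    have "k *v z = c2 *\<^sub>R x0" unfolding z(3) by (simp add: mv.scaleR_right matrix_vector_mul_assoc k(2))
    then have "R *v z = y"
      using y(5) z(2,5) unfolding R_def
      by (simp add: mv.scaleR_left mv.scaleR_right y(3) flip: matrix_vector_mul_assoc)
    have "span {R *v z} \<in> proj_space closure_of reach S \<tau> (span {z})"
      by (rule scaled_closure_reach) (use \<open>R \<in> H\<close> H(2) z(4) y(4) \<open>R *v z = y\<close> in \<open>auto simp: T_def\<close>)
    moreover have "proj_space closure_of reach S \<tau> (span {z}) \<subseteq> proj_space closure_of reach S \<tau> s"
      using s orbit_subset_proj_points[OF s0] by (intro reach_closure_trans z(6)) auto
    ultimately show "span {y} \<in> proj_space closure_of reach S \<tau> s" using \<open>R *v z = y\<close> by auto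
  qed
qed

section \<open>A word whose time derivatives span the Lie algebra\<close>

text \<open>The adjoint action of a word of flows; the inverse is given by the inverse word.\<close>

definition conj_word :: "((real^'d^'d) \<times> real) list \<Rightarrow> real^'d^'d \<Rightarrow> real^'d^'d" where
  "conj_word ws X = flow_prod ws ** X ** flow_prod (inv_word ws)"

lemma inv_word_append: "inv_word (xs @ ys) = inv_word ys @ inv_word xs"
  by (simp add: inv_word_def)

lemma conj_word_append: "conj_word (xs @ ys) X = conj_word ys (conj_word xs X)"
  by (simp add: conj_word_def flow_prod_append inv_word_append matrix_mul_assoc)

lemma conj_word_Nil [simp]: "conj_word [] X = X"
  by (simp add: conj_word_def inv_word_def)

lemma linear_conj_word: "linear (conj_word ws)"
  unfolding conj_word_def
  by (auto intro!: linearI simp: mm.add_left mm.add_right mm.scaleR_left mm.scaleR_right)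

lemma conj_word_inverse [simp]: "conj_word (inv_word ws) (conj_word ws X) = X"
  and conj_word_inverse' [simp]: "conj_word ws (conj_word (inv_word ws) X) = X"
proof -
  have inv_inv: "inv_word (inv_word ws) = ws" for ws :: "((real^'a^'a) \<times> real) list"
    by (simp add: inv_word_def rev_map case_prod_beta' comp_def)
  show *: "conj_word (inv_word ws) (conj_word ws X) = X" for ws and X :: "real^'a^'a"
  proof -
    have "conj_word (inv_word ws) (conj_word ws X)
        = (flow_prod (inv_word ws) ** flow_prod ws) ** X ** (flow_prod (inv_word ws) ** flow_prod ws)"
      unfolding conj_word_def inv_inv by (simp only: matrix_mul_assoc)
    then show ?thesis by simp
  qed
  show "conj_word ws (conj_word (inv_word ws) X) = X" using *[of "inv_word ws"] by (simp add: inv_inv)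
qed

lemma inj_conj_word: "inj (conj_word ws)"
  by (metis conj_word_inverse injI)

lemma conj_word_single_commutes: "conj_word [(A, t)] A = A"
proof -
  have "conj_word [(A, t)] A = A ** (mat_exp (t *\<^sub>R A) ** mat_exp ((- t) *\<^sub>R A))"
    by (simp add: conj_word_def inv_word_def mat_exp_commute matrix_mul_assoc)
  then show ?thesis unfolding mat_exp_inverse by simp
qed

lemma conj_word_single_add: "conj_word [(B, s + t)] X = conj_word [(B, s)] (conj_word [(B, t)] X)"
proof -
  have "mat_exp ((- (s + t)) *\<^sub>R B) = mat_exp ((- t) *\<^sub>R B) ** mat_exp ((- s) *\<^sub>R B)"
    using mat_exp_add[of "- t" "- s" B] by (simp add: add.commute)
  then show ?thesis
    by (simp add: conj_word_def inv_word_def mat_exp_add matrix_mul_assoc del: scaleR_minus_left minus_add_distrib)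
qed

text \<open>The matrices \<open>X\<^sub>i\<close> such that the derivative of the product of flows with respect to the \<open>i\<close>-th time
is \<open>X\<^sub>i\<close> times the product.\<close>

fun log_partials :: "((real^'d^'d) \<times> real) list \<Rightarrow> (real^'d^'d) list" where
  "log_partials [] = []"
| "log_partials ((A, t) # ws) = conj_word ws A # log_partials ws"

lemma length_log_partials [simp]: "length (log_partials ws) = length ws"
  by (induction ws rule: log_partials.induct) auto

lemma log_partials_append: "log_partials (xs @ ys) = map (conj_word ys) (log_partials xs) @ log_partials ys"
  by (induction xs rule: log_partials.induct) (auto simp: conj_word_append)

definition word_in :: "(real^'d^'d) set \<Rightarrow> ((real^'d^'d) \<times> real) list \<Rightarrow> bool" where
  "word_in S ws \<longleftrightarrow> (\<forall>(A, t)\<in>set ws. A \<in> S)"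

lemma word_in_simps [simp]: "word_in S []" "word_in S ((A, t) # ws) \<longleftrightarrow> A \<in> S \<and> word_in S ws"
  "word_in S (xs @ ys) \<longleftrightarrow> word_in S xs \<and> word_in S ys"
  by (auto simp: word_in_def)

lemma word_in_inv_word [simp]: "word_in S (inv_word ws) \<longleftrightarrow> word_in S ws"
  by (auto simp: word_in_def inv_word_def)

text \<open>Such a space contains the Lie algebra generated by \<open>S\<close>; invariance under conjugation replaces
closure under brackets.\<close>

definition ad_space :: "(real^'d^'d) set \<Rightarrow> (real^'d^'d) set \<Rightarrow> bool" where
  "ad_space S E \<longleftrightarrow> subspace E \<and> S \<subseteq> E \<and> (\<forall>ws X. word_in S ws \<longrightarrow> X \<in> E \<longrightarrow> conj_word ws X \<in> E)"

lemma log_partials_in_ad_space: "ad_space S E \<Longrightarrow> word_in S ws \<Longrightarrow> set (log_partials ws) \<subseteq> E"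
  by (induction ws rule: log_partials.induct) (auto simp: ad_space_def)

text \<open>Choose a word \<open>ws\<close> with times greater than \<open>\<tau>\<close> for which the span \<open>L ws\<close> of the logarithmic partial
derivatives has the largest dimension. Appending \<open>ys\<close> changes \<open>L ws\<close> into a space containing its conjugate by
\<open>ys\<close>, hence equal to it. For a single letter \<open>B\<close> this puts \<open>B\<close> into \<open>L ws\<close>, as \<open>B\<close> commutes with
its flow; for general \<open>ys\<close> it puts all conjugates of \<open>S\<close> by inverse words into \<open>L ws\<close>. These span an
invariant space, first for the inverse flows at times greater than \<open>\<tau>\<close>, then for all times, and
this space contains every logarithmic derivative.\<close>

lemma exists_word_spanning_ad_space:
  fixes S :: "(real^'d^'d) set"
  assumes ne: "S \<noteq> {}"
  obtains ws where "ws \<noteq> []" "\<forall>(A, t)\<in>set ws. A \<in> S \<and> \<tau> < t" "ad_space S (span (set (log_partials ws)))"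
proof -
  define val where "val ws \<longleftrightarrow> ws \<noteq> [] \<and> (\<forall>(A, t)\<in>set ws. A \<in> S \<and> \<tau> < t)" for ws :: "((real^'d^'d) \<times> real) list"
  define L where "L ws = span (set (log_partials ws))" for ws :: "((real^'d^'d) \<times> real) list"
  have val_append: "val (xs @ ys)" if "val xs" "val ys" for xs ys using that by (auto simp: val_def)
  have val1: "val [(B, t)]" if "B \<in> S" "\<tau> < t" for B t using that by (simp add: val_def)
  have val_word: "word_in S ws" if "val ws" for ws using that by (auto simp: val_def word_in_def)
  obtain A0 where A0: "A0 \<in> S" using ne by blast
  have "\<exists>ws. val ws \<and> (\<forall>ys. val ys \<longrightarrow> dim (L ys) \<le> dim (L ws))"
  proof (rule ex_has_greatest_nat[where P = val and f = "\<lambda>ws. dim (L ws)" and b = "Suc DIM(real^'d^'d)"])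
    show "val [(A0, \<tau> + 1)]" using A0 by (intro val1) auto
    show "\<forall>ys. val ys \<longrightarrow> dim (L ys) < Suc DIM(real^'d^'d)" using dim_subset_UNIV le_imp_less_Suc by blast
  qed
  then obtain ws where ws: "val ws" and max: "\<And>ys. val ys \<Longrightarrow> dim (L ys) \<le> dim (L ws)" by blast
  have L_append: "L (ws @ ys) = conj_word ys ` L ws" if ys: "val ys" for ys
  proof (rule subspace_dim_equal[symmetric])
    show "subspace (conj_word ys ` L ws)"
      unfolding L_def by (intro linear_subspace_image linear_conj_word subspace_span)
    show "subspace (L (ws @ ys))" by (simp add: L_def)
    show "conj_word ys ` L ws \<subseteq> L (ws @ ys)"
      unfolding L_def linear_span_image[OF linear_conj_word, symmetric]
      by (intro span_mono) (auto simp: log_partials_append)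
    have "dim (conj_word ys ` L ws) = dim (L ws)"
      by (intro dim_image_eq linear_conj_word inj_on_subset[OF inj_conj_word]) auto
    then show "dim (L (ws @ ys)) \<le> dim (conj_word ys ` L ws)"
      using max[OF val_append[OF ws ys]] by simp
  qed
  have letter: "B \<in> L (ws @ ys)" if B: "B \<in> S" and ys: "ys = [] \<or> val ys" for B ys
  proof -
    (* Any time greater than \<tau> would do. *)
    let ?y = "[(B, \<tau> + 1)]"
    have v: "val ?y" using B by (intro val1) auto
    have "B \<in> L (ws @ ys @ ?y)" unfolding L_def by (rule span_base) (simp add: log_partials_append)
    also have "L (ws @ ys @ ?y) = conj_word ?y ` L (ws @ ys)"
      using ys v by (auto simp: L_append val_append conj_word_append image_image)
    finally obtain X where X: "X \<in> L (ws @ ys)" "B = conj_word ?y X" by blast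
    have "X = B" using X(2) conj_word_single_commutes[of B "\<tau> + 1"] inj_conj_word[of ?y] by (simp add: inj_def)
    then show ?thesis using X(1) by simp
  qed
  define G where "G = {conj_word (inv_word ys) A | ys A. val ys \<and> A \<in> S}"
  define E where "E = span G"
  have GL: "G \<subseteq> L ws"
  proof
    fix X assume "X \<in> G"
    then obtain ys A where X: "X = conj_word (inv_word ys) A" "val ys" "A \<in> S" unfolding G_def by blast
    then have "A \<in> conj_word ys ` L ws" using letter[of A ys] L_append by auto
    then show "X \<in> L ws" using X(1) by auto
  qed
  have conj1: "conj_word [(B, t)] X \<in> E" if B: "B \<in> S" and X: "X \<in> E" for B t X
  proof -
    (* Invariance is known for the inverse flows at times greater than \<tau>. *)
    have "conj_word [(B, - (- t))] X \<in> E"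
    proof (rule one_parameter_invariant[where E = "\<lambda>t. conj_word [(B, - t)]" and \<tau> = "\<tau> + 1" and U = E])
      show "linear (conj_word [(B, - t)])" for t by (rule linear_conj_word)
      show "conj_word [(B, - (s + t))] X = conj_word [(B, - s)] (conj_word [(B, - t)] X)" for s t X
        using conj_word_single_add[of B "- s" "- t" X] by simp
      show "conj_word [(B, - 0)] X = X" for X by (simp add: conj_word_def inv_word_def)
      fix t X assume t: "\<tau> + 1 \<le> t" and X: "X \<in> E"
      have "conj_word [(B, - t)] ` G \<subseteq> G"
      proof clarify
        fix X assume "X \<in> G"
        then obtain ys A where X: "X = conj_word (inv_word ys) A" "val ys" "A \<in> S" unfolding G_def by blast
        have "conj_word [(B, - t)] X = conj_word (inv_word ([(B, t)] @ ys)) A"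
          unfolding X(1) by (simp add: inv_word_def flip: conj_word_append)
        moreover have "val ([(B, t)] @ ys)" using B t X(2) by (intro val_append val1) auto
        ultimately show "conj_word [(B, - t)] X \<in> G" unfolding G_def using X(3) by blast
      qed
      then have "conj_word [(B, - t)] ` E \<subseteq> E"
        unfolding E_def linear_span_image[OF linear_conj_word, symmetric] by (rule span_mono)
      then show "conj_word [(B, - t)] X \<in> E" using X by blast
    qed (use X in \<open>auto simp: E_def\<close>)
    then show ?thesis by simp
  qed
  have conjE: "conj_word vs X \<in> E" if "word_in S vs" "X \<in> E" for vs X
    using that
  proof (induction vs rule: rev_induct)
    case (snoc w vs)
    then show ?case by (cases w) (auto simp: conj_word_append conj1)
  qed simp
  have SE: "S \<subseteq> E"
  proof
    fix B assume B: "B \<in> S"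
    have "conj_word (inv_word [(B, \<tau> + 1)]) B \<in> G" unfolding G_def using B val1[OF B, of "\<tau> + 1"] by auto
    moreover have "conj_word (inv_word [(B, \<tau> + 1)]) B = B"
      using conj_word_single_commutes[of B "- (\<tau> + 1)"] by (simp add: inv_word_def)
    ultimately show "B \<in> E" by (simp add: E_def span_base)
  qed
  have ad: "ad_space S E" using SE conjE by (auto simp: ad_space_def E_def)
  have "L ws \<subseteq> E"
    unfolding L_def using log_partials_in_ad_space[OF ad val_word[OF ws]] ad
    by (intro span_minimal) (auto simp: ad_space_def)
  moreover have "E \<subseteq> L ws" unfolding E_def L_def using GL by (intro span_minimal) (auto simp: L_def)
  ultimately have "L ws = E" by blast
  then show ?thesis using that[of ws] ws ad by (auto simp: val_def L_def)
qed

section \<open>Words with variable times\<close>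

text \<open>The same matrices with times that differ by less than \<open>r\<close>.\<close>

definition near :: "real \<Rightarrow> ((real^'d^'d) \<times> real) list \<Rightarrow> ((real^'d^'d) \<times> real) list \<Rightarrow> bool" where
  "near r = list_all2 (\<lambda>(A, t) (B, s). A = B \<and> \<bar>s - t\<bar> < r)"

lemma near_mono: "near r ws vs \<Longrightarrow> r \<le> r' \<Longrightarrow> near r' ws vs"
  unfolding near_def by (auto elim!: list_all2_mono)

lemma flow_prod_near:
  assumes "0 < e"
  shows "\<exists>r>0. \<forall>vs. near r ws vs \<longrightarrow> dist (flow_prod vs) (flow_prod ws) < e"
  using assms
proof (induction ws arbitrary: e rule: flow_prod.induct)
  case 1
  then show ?case by (auto simp: near_def intro: exI[of _ 1])
next
  case (2 A t ws)
  have "continuous_on UNIV (\<lambda>p :: (real^'a^'a) \<times> (real^'a^'a). fst p ** snd p)"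
    by (intro mm.continuous_on continuous_intros)
  then have "isCont (\<lambda>p :: (real^'a^'a) \<times> (real^'a^'a). fst p ** snd p) (flow_prod ws, mat_exp (t *\<^sub>R A))"
    by (simp add: continuous_on_eq_continuous_at)
  then obtain d where d: "d > 0" "\<And>p. dist p (flow_prod ws, mat_exp (t *\<^sub>R A)) < d \<Longrightarrow>
      dist (fst p ** snd p) (flow_prod ws ** mat_exp (t *\<^sub>R A)) < e"
    using \<open>0 < e\<close> unfolding continuous_at_eps_delta by force
  obtain r1 where r1: "r1 > 0" "\<And>vs. near r1 ws vs \<Longrightarrow> dist (flow_prod vs) (flow_prod ws) < d / 2"
    using "2.IH"[of "d / 2"] d(1) by auto
  have "isCont (\<lambda>t. mat_exp (t *\<^sub>R A)) t"
    using mat_exp_has_vector_derivative by (rule has_vector_derivative_continuous)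
  then obtain r2 where r2: "r2 > 0" "\<And>s. \<bar>s - t\<bar> < r2 \<Longrightarrow> dist (mat_exp (s *\<^sub>R A)) (mat_exp (t *\<^sub>R A)) < d / 2"
    using d(1) unfolding continuous_at_eps_delta dist_real_def by (metis half_gt_zero)
  have "dist (flow_prod vs) (flow_prod ((A, t) # ws)) < e" if vs_near: "near (min r1 r2) ((A, t) # ws) vs" for vs
  proof -
    obtain s us where vs: "vs = (A, s) # us" "\<bar>s - t\<bar> < r2" "near (min r1 r2) ws us"
      using vs_near unfolding near_def by (auto simp: list_all2_Cons1)
    have "near r1 ws us" using vs(3) near_mono by force
    then have "dist (flow_prod us, mat_exp (s *\<^sub>R A)) (flow_prod ws, mat_exp (t *\<^sub>R A)) < d"
      using r1(2)[of us] r2(2)[OF vs(2)] sqrt_sum_squares_le_sum[of "dist (flow_prod us) (flow_prod ws)"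
          "dist (mat_exp (s *\<^sub>R A)) (mat_exp (t *\<^sub>R A))"]
      by (simp add: dist_Pair_Pair)
    from d(2)[OF this] show ?thesis by (simp add: vs(1))
  qed
  then show ?case using r1(1) r2(1) by (intro exI[of _ "min r1 r2"]) auto
qed

text \<open>The open sets of the finest topology for which the product of flows depends continuously on the
times. The orbit topology is its quotient under the action on a point.\<close>

definition fine_open :: "(real^'d^'d) set \<Rightarrow> (real^'d^'d) set \<Rightarrow> bool" where
  "fine_open S X \<longleftrightarrow> (\<forall>ws. word_in S ws \<and> flow_prod ws \<in> X \<longrightarrow>
     (\<exists>r>0. \<forall>vs. near r ws vs \<longrightarrow> flow_prod vs \<in> X))"

text \<open>A letter with a variable time: a matrix, its time as a function of a parameter, and the derivative
of this function, which is the same at all parameters in every application.\<close>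

type_synonym ('d, 'a) letter = "(real^'d^'d) \<times> ('a \<Rightarrow> real) \<times> ('a \<Rightarrow> real)"

definition word_at :: "('d, 'a) letter list \<Rightarrow> 'a \<Rightarrow> ((real^'d^'d) \<times> real) list" where
  "word_at ps Y = map (\<lambda>(A, f, f'). (A, f Y)) ps"

text \<open>The factor on the left of the product of flows in its derivative in direction \<open>h\<close>.\<close>

fun log_velocity :: "('d, 'a) letter list \<Rightarrow> 'a \<Rightarrow> 'a \<Rightarrow> real^'d^'d" where
  "log_velocity [] Y h = 0"
| "log_velocity ((A, f, f') # ps) Y h = f' h *\<^sub>R conj_word (word_at ps Y) A + log_velocity ps Y h"

lemma word_at_simps [simp]: "word_at [] Y = []" "word_at ((A, f, f') # ps) Y = (A, f Y) # word_at ps Y"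
  by (simp_all add: word_at_def)

lemma flow_word_at_has_derivative:
  fixes ps :: "('d::finite, 'a::real_normed_vector) letter list"
  assumes "\<forall>(A, f, f')\<in>set ps. (f has_derivative f') (at Y)"
  shows "((\<lambda>Y. flow_prod (word_at ps Y)) has_derivative (\<lambda>h. log_velocity ps Y h ** flow_prod (word_at ps Y))) (at Y)"
  using assms
proof (induction ps)
  case Nil then show ?case by simp
next
  case (Cons p ps)
  obtain A f f' where p: "p = (A, f, f')" by (cases p)
  let ?W = "flow_prod (word_at ps Y)" and ?E = "mat_exp (f Y *\<^sub>R A)"
  have f: "(f has_derivative f') (at Y)" using Cons.prems p by auto
  have "((\<lambda>Y. mat_exp (f Y *\<^sub>R A)) has_derivative (\<lambda>h. f' h *\<^sub>R (A ** ?E))) (at Y)"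
    using has_derivative_compose[OF f mat_exp_has_vector_derivative[unfolded has_vector_derivative_def]] .
  with Cons have "((\<lambda>Y. flow_prod (word_at ps Y) ** mat_exp (f Y *\<^sub>R A)) has_derivative
      (\<lambda>h. ?W ** (f' h *\<^sub>R (A ** ?E)) + (log_velocity ps Y h ** ?W) ** ?E)) (at Y)"
    by (intro mm.FDERIV) auto
  moreover have "?W ** (f' h *\<^sub>R (A ** ?E)) = f' h *\<^sub>R (conj_word (word_at ps Y) A ** (?W ** ?E))" for h
  proof -
    have "conj_word (word_at ps Y) A ** (?W ** ?E) = ?W ** A ** (flow_prod (inv_word (word_at ps Y)) ** ?W) ** ?E"
      unfolding conj_word_def by (simp only: matrix_mul_assoc)
    then show ?thesis by (simp add: mm.scaleR_right matrix_mul_assoc)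
  qed
  ultimately show ?case
    by (simp add: p mm.add_left mm.scaleR_left matrix_mul_assoc)
qed

lemma flow_word_at_continuous:
  fixes ps :: "('d::finite, 'a::real_normed_vector) letter list"
  assumes "\<forall>(A, f, f')\<in>set ps. \<forall>Y. (f has_derivative f') (at Y)"
  shows "continuous_on UNIV (\<lambda>Y. flow_prod (word_at ps Y))"
proof (intro continuous_at_imp_continuous_on ballI)
  fix Y
  have "\<forall>(A, f, f')\<in>set ps. (f has_derivative f') (at Y)" using assms by auto
  from has_derivative_continuous[OF flow_word_at_has_derivative[OF this]]
  show "isCont (\<lambda>Y. flow_prod (word_at ps Y)) Y" .
qed

lemma log_velocity_continuous:
  fixes ps :: "('d::finite, 'a::real_normed_vector) letter list"
  assumes "\<forall>(A, f, f')\<in>set ps. \<forall>Y. (f has_derivative f') (at Y)"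
  shows "continuous_on UNIV (\<lambda>Y. log_velocity ps Y h)"
  using assms
proof (induction ps)
  case Nil then show ?case by simp
next
  case (Cons p ps)
  obtain A f f' where p: "p = (A, f, f')" by (cases p)
  define qs :: "('d, 'a) letter list" where "qs = rev (map (\<lambda>(A, f, f'). (A, \<lambda>Y. - f Y, \<lambda>h. - f' h)) ps)"
  have qs: "inv_word (word_at ps Y) = word_at qs Y" for Y
    by (simp add: inv_word_def word_at_def qs_def rev_map case_prod_beta' comp_def)
  have "\<forall>(A, f, f')\<in>set qs. \<forall>Y. (f has_derivative f') (at Y)"
    using Cons.prems by (auto simp: qs_def intro!: has_derivative_minus)
  then have "continuous_on UNIV (\<lambda>Y. flow_prod (word_at qs Y))"
    by (rule flow_word_at_continuous)
  moreover have "continuous_on UNIV (\<lambda>Y. flow_prod (word_at ps Y))"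
    using Cons.prems by (intro flow_word_at_continuous) simp
  ultimately have "continuous_on UNIV (\<lambda>Y. conj_word (word_at ps Y) A)"
    unfolding conj_word_def qs by (intro mm.continuous_on continuous_on_const)
  then show ?case using Cons by (auto simp: p intro!: continuous_intros)
qed

lemma linear_log_velocity:
  assumes "\<forall>(A, f, f')\<in>set ps. linear f'" shows "linear (log_velocity ps Y)"
  using assms
proof (induction ps)
  case Nil then show ?case by (auto intro!: linearI)
next
  case (Cons p ps)
  obtain A f f' where p: "p = (A, f, f')" by (cases p)
  then have "linear f'" "linear (log_velocity ps Y)" using Cons by auto
  then show ?case
    by (auto intro!: linearI simp: p linear_add linear_scale algebra_simps)
qed

lemma log_velocity_in_ad_space:
  assumes "ad_space S E" "word_in S (word_at ps Y)" shows "log_velocity ps Y h \<in> E"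
  using assms(2)
proof (induction ps)
  case Nil then show ?case using assms(1) by (simp add: ad_space_def subspace_0)
next
  case (Cons p ps)
  obtain A f f' where p: "p = (A, f, f')" by (cases p)
  then show ?case using Cons assms(1) unfolding ad_space_def by (auto intro!: subspace_add subspace_mul)
qed

fun combination :: "('a \<Rightarrow> real) list \<Rightarrow> 'b::real_vector list \<Rightarrow> 'a \<Rightarrow> 'b" where
  "combination (f # fs) (X # Xs) h = f h *\<^sub>R X + combination fs Xs h"
| "combination _ _ h = 0"

text \<open>Linear coordinates with respect to a spanning list that may be redundant: earlier entries that
depend on later ones get the coordinate zero.\<close>

lemma coordinate_functionals:
  fixes Xs :: "'b::euclidean_space list"
  obtains fs :: "('b \<Rightarrow> real) list" where "length fs = length Xs" "\<forall>f\<in>set fs. linear f"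
    "\<And>Y. Y \<in> span (set Xs) \<Longrightarrow> combination fs Xs Y = Y"
proof -
  have "\<exists>fs :: ('b \<Rightarrow> real) list. length fs = length Xs \<and> (\<forall>f\<in>set fs. linear f) \<and>
    (\<forall>Y\<in>span (set Xs). combination fs Xs Y = Y)"
  proof (induction Xs)
    case Nil then show ?case by simp
  next
    case (Cons X Xs)
    then obtain fs :: "('b \<Rightarrow> real) list" where fs: "length fs = length Xs" "\<forall>f\<in>set fs. linear f"
      "\<And>Y. Y \<in> span (set Xs) \<Longrightarrow> combination fs Xs Y = Y" by blast
    obtain f :: "'b \<Rightarrow> real" where f: "linear f" "\<And>Y. Y \<in> span (set Xs) \<Longrightarrow> f Y = 0"
      "\<And>Y. Y \<in> span (set (X # Xs)) \<Longrightarrow> Y - f Y *\<^sub>R X \<in> span (set Xs)"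
    proof (cases "X \<in> span (set Xs)")
      case True
      then have "span (set (X # Xs)) = span (set Xs)" by (simp add: span_redundant)
      then show ?thesis by (intro that[of "\<lambda>_. 0"]) (auto intro: linearI)
    next
      case False
      obtain y z where yz: "y \<in> span (set Xs)" "\<And>w. w \<in> span (set Xs) \<Longrightarrow> orthogonal z w" "X = y + z"
        using orthogonal_subspace_decomp_exists[of "set Xs" X] by blast
      have z: "z \<bullet> z \<noteq> 0" using False yz by auto
      have zX: "z \<bullet> X = z \<bullet> z" using yz by (simp add: inner_add_right orthogonal_def)
      show ?thesis
      proof (rule that[of "\<lambda>Y. (z \<bullet> Y) / (z \<bullet> z)"])
        show "linear (\<lambda>Y. (z \<bullet> Y) / (z \<bullet> z))" by (auto intro!: linearI simp: inner_add_right add_divide_distrib)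
        show "(z \<bullet> Y) / (z \<bullet> z) = 0" if "Y \<in> span (set Xs)" for Y using yz(2)[OF that] by (simp add: orthogonal_def)
        show "Y - ((z \<bullet> Y) / (z \<bullet> z)) *\<^sub>R X \<in> span (set Xs)" if YX: "Y \<in> span (set (X # Xs))" for Y
        proof -
          obtain k where k: "Y - k *\<^sub>R X \<in> span (set Xs)"
            using YX by (auto simp: span_breakdown_eq)
          then have "z \<bullet> (Y - k *\<^sub>R X) = 0" using yz(2) by (simp add: orthogonal_def)
          then have "(z \<bullet> Y) / (z \<bullet> z) = k" using z zX by (simp add: inner_diff_right)
          then show ?thesis using k by simp
        qed
      qed
    qed
    define gs where "gs = map (\<lambda>g Y. g (Y - f Y *\<^sub>R X)) fs"
    have comb: "combination (map (\<lambda>g Y. g (k Y)) fs) Xs Y = combination fs Xs (k Y)" for k Y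
      by (induction fs Xs "k Y" rule: combination.induct) auto
    have "linear (\<lambda>Y. g (Y - f Y *\<^sub>R X))" if "linear g" for g :: "'b \<Rightarrow> real"
      using that f(1) by (auto intro!: linearI simp: linear_add linear_diff linear_scale algebra_simps)
    then have "\<forall>g\<in>set (f # gs). linear g" using fs(2) f(1) by (auto simp: gs_def)
    moreover have "combination (f # gs) (X # Xs) Y = Y" if "Y \<in> span (set (X # Xs))" for Y
      using fs(3)[OF f(3)[OF that]] by (simp add: gs_def comb)
    ultimately show ?case using fs(1) by (intro exI[of _ "f # gs"]) (auto simp: gs_def)
  qed
  then show ?thesis using that by blast
qed

section \<open>Open charts of the flow group\<close>

text \<open>The times of \<open>ws\<close>, each shifted by a linear functional of the parameter.\<close>

definition shifted_letters :: "((real^'d^'d) \<times> real) list \<Rightarrow> ('a::real_normed_vector \<Rightarrow> real) list \<Rightarrow> ('d, 'a) letter list" where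
  "shifted_letters ws fs = map (\<lambda>((A, t), f). (A, \<lambda>Y. t + f Y, f)) (zip ws fs)"

lemma log_velocity_shifted_letters:
  assumes "length ws = length fs"
  shows "log_velocity (shifted_letters ws fs) Y h = combination fs (log_partials (word_at (shifted_letters ws fs) Y)) h"
  using assms by (induction ws fs rule: list_induct2) (auto simp: shifted_letters_def)

lemma word_at_zero:
  assumes "length ws = length fs" "\<forall>f\<in>set fs. linear f" shows "word_at (shifted_letters ws fs) 0 = ws"
  using assms by (induction ws fs rule: list_induct2) (auto simp: shifted_letters_def linear_0)

lemma word_in_word_at:
  "length ws = length fs \<Longrightarrow> word_in S (word_at (shifted_letters ws fs) Y) \<longleftrightarrow> word_in S ws"
  by (induction ws fs rule: list_induct2) (auto simp: shifted_letters_def)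

lemma shifted_letters_has_derivative:
  fixes ws :: "((real^'d^'d) \<times> real) list" and fs :: "('a::euclidean_space \<Rightarrow> real) list"
  assumes "\<forall>f\<in>set fs. linear f"
  shows "\<forall>(A, f, f')\<in>set (shifted_letters ws fs). \<forall>Y. (f has_derivative f') (at Y)"
proof -
  have "((\<lambda>Y. t + f Y) has_derivative f) (at Y)" if "linear f" for t and f :: "'a \<Rightarrow> real" and Y
  proof -
    have "(f has_derivative f) (at Y)"
      using that by (simp add: bounded_linear_imp_has_derivative linear_conv_bounded_linear)
    then show ?thesis using has_derivative_add[OF has_derivative_const] by fastforce
  qed
  then show ?thesis using assms by (auto simp: shifted_letters_def dest: set_zip_rightD)
qed

lemma word_at_times_greater:
  assumes "\<forall>(A, f, f')\<in>set ps. isCont f (0::'a::real_normed_vector) \<and> \<tau> < f 0"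
  shows "\<exists>\<delta>>0. \<forall>Y. norm Y < \<delta> \<longrightarrow> (\<forall>(A, t)\<in>set (word_at ps Y). \<tau> < t)"
  using assms
proof (induction ps)
  case Nil then show ?case by (auto intro: exI[of _ 1])
next
  case (Cons p ps)
  obtain A f f' where p: "p = (A, f, f')" by (cases p)
  obtain \<delta> where \<delta>: "\<delta> > 0" "\<And>Y. norm Y < \<delta> \<Longrightarrow> \<forall>(A, t)\<in>set (word_at ps Y). \<tau> < t"
    using Cons by auto
  have "isCont f 0" "0 < f 0 - \<tau>" using Cons.prems p by auto
  then obtain d where d: "d > 0" "\<And>Y. dist Y 0 < d \<Longrightarrow> dist (f Y) (f 0) < f 0 - \<tau>"
    unfolding continuous_at_eps_delta by blast
  have f: "\<tau> < f Y" if "norm Y < d" for Y using d(2)[of Y] that by (auto simp: dist_real_def)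
  show ?case
  proof (intro exI[of _ "min \<delta> d"] conjI allI impI)
    fix Y :: 'a assume "norm Y < min \<delta> d"
    then show "\<forall>(A, t)\<in>set (word_at (p # ps) Y). \<tau> < t" using \<delta>(2)[of Y] f[of Y] by (simp add: p)
  qed (use \<delta>(1) d(1) in simp)
qed

text \<open>A path of words joining two words that differ only in their times; the coordinates of a chart are
differentiated along it.\<close>

definition segment_letters ::
  "((real^'d^'d) \<times> real) list \<Rightarrow> ((real^'d^'d) \<times> real) list \<Rightarrow> ('d, real) letter list" where
  "segment_letters ws vs = map (\<lambda>((A, t), (B, s)). (A, \<lambda>l. t + l * (s - t), \<lambda>h. h * (s - t))) (zip ws vs)"

lemma word_at_segment_letters:
  assumes "near r ws vs"
  shows "word_at (segment_letters ws vs) 0 = ws" "word_at (segment_letters ws vs) 1 = vs"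
    "0 \<le> l \<Longrightarrow> l \<le> 1 \<Longrightarrow> near r ws (word_at (segment_letters ws vs) l)"
    "word_in S ws \<Longrightarrow> word_in S (word_at (segment_letters ws vs) l)"
proof -
  have len: "length ws = length vs" using assms by (auto simp: near_def dest: list_all2_lengthD)
  show "word_at (segment_letters ws vs) 0 = ws" "word_at (segment_letters ws vs) 1 = vs"
    "word_in S ws \<Longrightarrow> word_in S (word_at (segment_letters ws vs) l)"
    using len assms
    by (induction ws vs rule: list_induct2) (auto simp: segment_letters_def near_def)
  show "near r ws (word_at (segment_letters ws vs) l)" if "0 \<le> l" "l \<le> 1"
    using len assms
  proof (induction ws vs rule: list_induct2)
    case (Cons x xs y ys)
    obtain A t s where xy: "x = (A, t)" "y = (A, s)" "\<bar>s - t\<bar> < r"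
      using Cons.prems by (cases x; cases y) (auto simp: near_def)
    have "\<bar>l * (s - t)\<bar> \<le> 1 * \<bar>s - t\<bar>"
      unfolding abs_mult using that by (intro mult_right_mono) auto
    then have "\<bar>l * (s - t)\<bar> < r" using xy(3) by simp
    then show ?case using Cons by (auto simp: segment_letters_def near_def xy)
  qed (simp add: near_def segment_letters_def)
qed

lemma segment_letters_has_derivative:
  "\<forall>(A, f, f')\<in>set (segment_letters ws vs). (f has_derivative f') (at l)"
  by (auto simp: segment_letters_def intro!: derivative_eq_intros)

lemma linear_inj_on_subspace_surj:
  fixes f :: "'a::euclidean_space \<Rightarrow> 'a"
  assumes "linear f" "subspace E" "f ` E \<subseteq> E" "\<And>x. x \<in> E \<Longrightarrow> f x = 0 \<Longrightarrow> x = 0" "z \<in> E"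
  obtains x where "x \<in> E" "f x = z"
proof -
  have "inj_on f E" using assms(1,2,4) by (simp add: linear_inj_on_iff_eq_0 linear_injective_on_subspace_0)
  then have "dim (f ` E) = dim E"
    using assms(1,2) by (intro dim_image_eq) (simp_all add: span_eq_iff[THEN iffD2])
  then have "f ` E = E" using assms by (intro subspace_dim_equal linear_subspace_image) auto
  with assms(5) have "z \<in> f ` E" by simp
  then show ?thesis using that by (elim imageE) simp
qed

text \<open>Take the word from exists_word_spanning_ad_space, let \<open>E\<close> be the spanned space and shift the times
by coordinate functionals of \<open>E\<close>; this gives \<open>G Y\<close> with derivative \<open>h \<mapsto> h (G 0)\<close> on \<open>E\<close> at the
origin. With a projection onto \<open>E\<close> and its complementary part \<open>c\<close>, the map
\<open>F Y = G Y (1 + c Y)\<close> is a local diffeomorphism of the space of all matrices. Any path of words has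
logarithmic velocity in \<open>E\<close>, and in the coordinates of \<open>F\<close> this says that \<open>c\<close> is constant along
the path. So a path starting in the slice \<open>c = 0\<close>, the image of \<open>E\<close> under \<open>G\<close>, remains there.\<close>

lemma exists_fine_open_chart:
  fixes S :: "(real^'d^'d) set"
  assumes ne: "S \<noteq> {}"
  obtains ps :: "('d, real^'d^'d) letter list" and E \<delta>0 where
    "ps \<noteq> []" "\<forall>(A, f, f')\<in>set ps. \<forall>Y. (f has_derivative f') (at Y)" "subspace E" "0 < \<delta>0"
    "\<And>Y. word_in S (word_at ps Y)"
    "\<And>Y. norm Y < \<delta>0 \<Longrightarrow> \<forall>(A, t)\<in>set (word_at ps Y). \<tau> < t"
    "\<And>\<delta>. 0 < \<delta> \<Longrightarrow> \<delta> \<le> \<delta>0 \<Longrightarrow> fine_open S ((\<lambda>Y. flow_prod (word_at ps Y)) ` (E \<inter> ball 0 \<delta>))"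
proof -
  obtain ws where ws: "ws \<noteq> []" "\<forall>(A, t)\<in>set ws. A \<in> S \<and> \<tau> < t" and ad: "ad_space S (span (set (log_partials ws)))"
    using exists_word_spanning_ad_space[OF ne] by blast
  have wS: "word_in S ws" using ws(2) by (auto simp: word_in_def)
  define E where "E = span (set (log_partials ws))"
  have adE: "ad_space S E" using ad by (simp add: E_def)
  have subE: "subspace E" by (simp add: E_def)
  obtain fs :: "(real^'d^'d \<Rightarrow> real) list" where fs: "length fs = length (log_partials ws)" "\<forall>f\<in>set fs. linear f"
    "\<And>Y. Y \<in> E \<Longrightarrow> combination fs (log_partials ws) Y = Y"
    unfolding E_def using coordinate_functionals[of "log_partials ws"] by blast
  have len: "length ws = length fs" using fs(1) by simp
  define ps where "ps = shifted_letters ws fs"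
  have ps_der: "\<forall>(A, f, f')\<in>set ps. \<forall>Y. (f has_derivative f') (at Y)"
    unfolding ps_def by (rule shifted_letters_has_derivative[OF fs(2)])
  have ps_lin: "\<forall>(A, f, f')\<in>set ps. linear f'"
    using fs(2) by (auto simp: ps_def shifted_letters_def dest: set_zip_rightD)
  have ps0: "word_at ps 0 = ws" unfolding ps_def by (rule word_at_zero[OF len fs(2)])
  have psS: "word_in S (word_at ps Y)" for Y unfolding ps_def word_in_word_at[OF len] by (rule wS)
  have lin_vel: "linear (log_velocity ps Y)" for Y by (rule linear_log_velocity[OF ps_lin])
  have velE: "log_velocity ps Y h \<in> E" for Y h by (rule log_velocity_in_ad_space[OF adE psS])
  define \<pi> where "\<pi> h = log_velocity ps 0 h" for h
  have \<pi>: "\<pi> h = combination fs (log_partials ws) h" for h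
    unfolding \<pi>_def using log_velocity_shifted_letters[OF len, of 0 h] ps0 by (simp add: ps_def)
  have \<pi>E: "\<pi> h \<in> E" for h unfolding \<pi>_def by (rule velE)
  have \<pi>id: "\<pi> h = h" if "h \<in> E" for h unfolding \<pi> by (rule fs(3)[OF that])
  have lin_\<pi>: "linear \<pi>" using lin_vel[of 0] by (simp add: \<pi>_def[abs_def])
  define c where "c h = h - \<pi> h" for h
  have lin_c: "linear c" unfolding c_def using lin_\<pi> by (intro linear_compose_sub linear_ident)
  have c0_iff: "c h = 0 \<longleftrightarrow> h \<in> E" for h using \<pi>E[of h] \<pi>id[of h] by (auto simp: c_def)
  define G where "G Y = flow_prod (word_at ps Y)" for Y
  define F where "F Y = G Y ** (mat 1 + c Y)" for Y
  define DF where "DF Y h = G Y ** c h + (log_velocity ps Y h ** G Y) ** (mat 1 + c Y)" for Y h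
  have G_der: "(G has_derivative (\<lambda>h. log_velocity ps Y h ** G Y)) (at Y)" for Y
    unfolding G_def[abs_def] using ps_der by (intro flow_word_at_has_derivative) auto
  have c_der: "(c has_derivative c) (at Y)" for Y
    using lin_c by (simp add: bounded_linear_imp_has_derivative linear_conv_bounded_linear)
  have F_der: "(F has_derivative DF Y) (at Y)" for Y
  proof -
    have "((\<lambda>Y. mat 1 + c Y) has_derivative c) (at Y)"
      using has_derivative_add[OF has_derivative_const c_der, of "mat 1"] by simp
    from mm.FDERIV[OF G_der this] show ?thesis unfolding F_def DF_def .
  qed
  have FE: "F Y = G Y" if "Y \<in> E" for Y using that c0_iff[of Y] by (simp add: F_def)
  have bl: "bounded_linear (DF Y)" for Y using F_der by (rule has_derivative_bounded_linear)
  define DFb where "DFb Y = Blinfun (DF Y)" for Y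
  have DFb: "blinfun_apply (DFb Y) = DF Y" for Y
    unfolding DFb_def by (rule bounded_linear_Blinfun_apply[OF bl])
  have cont: "continuous_on UNIV DFb"
  proof (rule continuous_on_blinfun_componentwise)
    fix h :: "real^'d^'d"
    have "continuous_on UNIV G"
      by (intro continuous_at_imp_continuous_on ballI has_derivative_continuous[OF G_der])
    moreover have "continuous_on UNIV c"
      by (intro continuous_at_imp_continuous_on ballI has_derivative_continuous[OF c_der])
    moreover have "continuous_on UNIV (\<lambda>Y. log_velocity ps Y h)" by (rule log_velocity_continuous[OF ps_der])
    ultimately have "continuous_on UNIV (\<lambda>Y. DF Y h)"
      unfolding DF_def by (intro continuous_on_add mm.continuous_on continuous_on_const)
    then show "continuous_on UNIV (\<lambda>Y. DFb Y h)" by (simp add: DFb)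
  qed
  have "inj (DF 0)"
    unfolding linear_injective_0[OF bounded_linear.linear[OF bl]]
  proof (intro allI impI)
    fix h assume "DF 0 h = 0"
    moreover have "c 0 = 0" using c0_iff[of 0] subspace_0[OF subE] by simp
    ultimately have eq: "G 0 ** c h + \<pi> h ** G 0 = 0" by (simp add: DF_def \<pi>_def)
    have G0: "G 0 = flow_prod ws" by (simp add: G_def ps0)
    let ?I = "flow_prod (inv_word ws)"
    have "c h = ?I ** (G 0 ** c h)" unfolding G0 by (simp add: matrix_mul_assoc)
    also have "G 0 ** c h = - (\<pi> h ** G 0)" using eq by (simp add: eq_neg_iff_add_eq_0)
    also have "?I ** - (\<pi> h ** G 0) = - conj_word (inv_word ws) (\<pi> h)"
      by (simp add: G0 conj_word_def mm.minus_right matrix_mul_assoc inv_word_def rev_map case_prod_beta' comp_def)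
    finally have "c h = - conj_word (inv_word ws) (\<pi> h)" .
    moreover have "conj_word (inv_word ws) (\<pi> h) \<in> E"
      using adE \<pi>E[of h] wS unfolding ad_space_def by simp
    ultimately have "c h \<in> E" using subspace_neg[OF subE] by simp
    then have "c h + \<pi> h \<in> E" using \<pi>E subspace_add[OF subE] by blast
    then have hE: "h \<in> E" by (simp add: c_def)
    then have "c h = 0" by (simp add: c0_iff)
    then have "\<pi> h ** G 0 = 0" using eq by (simp add: mm.zero_right)
    then have "\<pi> h ** (G 0 ** ?I) = 0" by (simp add: matrix_mul_assoc mm.zero_left)
    then show "h = 0" using \<pi>id[OF hE] by (simp add: G0)
  qed
  then obtain inv0 where inv0: "linear inv0" "inv0 \<circ> DF 0 = id"
    using linear_injective_left_inverse[OF bounded_linear.linear[OF bl]] by blast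
  have inv_eq: "Blinfun inv0 o\<^sub>L DFb 0 = id_blinfun"
  proof (rule blinfun_eqI)
    fix h
    have "bounded_linear inv0" using inv0(1) by (simp add: linear_conv_bounded_linear)
    then show "(Blinfun inv0 o\<^sub>L DFb 0) h = id_blinfun h"
      using inv0(2) by (simp add: DFb bounded_linear_Blinfun_apply fun_eq_iff)
  qed
  have F_derb: "(F has_derivative blinfun_apply (DFb Y)) (at Y)" for Y by (simp add: DFb F_der)
  obtain U' V g g' where IFT: "open U'" "0 \<in> U'" "open V" "homeomorphism U' V F g"
    "\<And>y. y \<in> V \<Longrightarrow> (g has_derivative g' y) (at y)"
    "\<And>y. y \<in> V \<Longrightarrow> g' y = inv (DF (g y))" "\<And>y. y \<in> V \<Longrightarrow> bij (DF (g y))"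
    by (rule inverse_function_theorem[OF open_UNIV F_derb cont UNIV_I inv_eq], unfold DFb, rule that)
  have gF: "g (F Y) = Y" if "Y \<in> U'" for Y using IFT(4) that by (auto simp: homeomorphism_def)
  have Fg: "F (g y) = y" if "y \<in> V" for y using IFT(4) that by (auto simp: homeomorphism_def)
  have "\<forall>(A, f, f')\<in>set ps. isCont f 0 \<and> \<tau> < f 0"
  proof -
    have "\<forall>(A, f, f')\<in>set ps. isCont f 0" using ps_der has_derivative_continuous by fastforce
    moreover have "\<forall>(A, f, f')\<in>set ps. \<tau> < f 0"
    proof -
      have "\<forall>(A, t)\<in>set (word_at ps 0). \<tau> < t" unfolding ps0 using ws(2) by auto
      then show ?thesis by (auto simp: word_at_def)
    qed
    ultimately show ?thesis by fast
  qed
  from word_at_times_greater[OF this] obtain \<delta>1 where \<delta>1: "\<delta>1 > 0"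
    "\<And>Y. norm Y < \<delta>1 \<Longrightarrow> \<forall>(A, t)\<in>set (word_at ps Y). \<tau> < t" by blast
  obtain \<delta>2 where \<delta>2: "\<delta>2 > 0" "ball 0 \<delta>2 \<subseteq> U'" using IFT(1,2) open_contains_ball by blast
  show ?thesis
  proof (rule that[of ps E "min \<delta>1 \<delta>2"])
    show "ps \<noteq> []" using ps0 ws(1) by auto
    show "\<forall>(A, t)\<in>set (word_at ps Y). \<tau> < t" if "norm Y < min \<delta>1 \<delta>2" for Y
      by (rule \<delta>1(2)) (use that in simp)
    fix \<delta> assume \<delta>: "0 < \<delta>" "\<delta> \<le> min \<delta>1 \<delta>2"
    define V' where "V' = F ` ball 0 \<delta>"
    have BU: "ball 0 \<delta> \<subseteq> U'" using \<delta>(2) \<delta>2(2) subset_ball[of \<delta> \<delta>2] by auto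
    have V'V: "V' \<subseteq> V" using BU IFT(4) by (auto simp: V'_def homeomorphism_def)
    have "open V'"
    proof -
      have "openin (top_of_set U') (ball 0 \<delta>)" using BU by (simp add: openin_open_eq IFT(1))
      then have "openin (top_of_set V) V'"
        unfolding V'_def by (rule homeomorphism_imp_open_map[OF IFT(4)])
      then show ?thesis using IFT(3) by (simp add: openin_open_eq)
    qed
    have gV': "g y \<in> ball 0 \<delta>" if "y \<in> V'" for y using that BU gF by (auto simp: V'_def)
    show "fine_open S ((\<lambda>Y. flow_prod (word_at ps Y)) ` (E \<inter> ball 0 \<delta>))"
      unfolding fine_open_def
    proof (intro allI impI, elim conjE)
      fix vs assume vS: "word_in S vs" and "flow_prod vs \<in> (\<lambda>Y. flow_prod (word_at ps Y)) ` (E \<inter> ball 0 \<delta>)"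
      then obtain Y0 where Y0: "Y0 \<in> E" "Y0 \<in> ball 0 \<delta>" "flow_prod vs = F Y0"
        using FE by (auto simp: G_def)
      then have "flow_prod vs \<in> V'" by (simp add: V'_def)
      then obtain e where e: "e > 0" "ball (flow_prod vs) e \<subseteq> V'" using \<open>open V'\<close> open_contains_ball by blast
      obtain r where r: "r > 0" "\<And>us. near r vs us \<Longrightarrow> dist (flow_prod us) (flow_prod vs) < e"
        using flow_prod_near[OF e(1)] by blast
      have "flow_prod us \<in> (\<lambda>Y. flow_prod (word_at ps Y)) ` (E \<inter> ball 0 \<delta>)" if nr: "near r vs us" for us
      proof -
        let ?q = "segment_letters vs us"
        define \<gamma> where "\<gamma> l = flow_prod (word_at ?q l)" for l
        note seg = word_at_segment_letters[OF nr]
        have \<gamma>V': "\<gamma> l \<in> V'" if "0 \<le> l" "l \<le> 1" for l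
          using r(2)[OF seg(3)[OF that]] e(2) by (auto simp: \<gamma>_def dist_commute)
        define y where "y l = g (\<gamma> l)" for l
        have \<gamma>_der: "(\<gamma> has_derivative (\<lambda>h. log_velocity ?q l h ** \<gamma> l)) (at l)" for l
          unfolding \<gamma>_def[abs_def] by (rule flow_word_at_has_derivative[OF segment_letters_has_derivative])
        have der0: "((\<lambda>l. c (y l)) has_derivative (\<lambda>h. 0)) (at l)" if l: "0 \<le> l" "l \<le> 1" for l
        proof -
          have inV: "\<gamma> l \<in> V" using \<gamma>V'[OF l] V'V by blast
          have bij: "bij (DF (y l))" using IFT(7)[OF inV] by (simp add: y_def)
          have Fy: "F (y l) = \<gamma> l" using Fg[OF inV] by (simp add: y_def)
          have "(y has_derivative (\<lambda>h. g' (\<gamma> l) (log_velocity ?q l h ** \<gamma> l))) (at l)"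
            unfolding y_def[abs_def] by (rule has_derivative_compose[OF \<gamma>_der IFT(5)[OF inV]])
          then have "((\<lambda>l. c (y l)) has_derivative (\<lambda>h. c (g' (\<gamma> l) (log_velocity ?q l h ** \<gamma> l)))) (at l)"
            by (rule has_derivative_compose[OF _ c_der])
          moreover have "c (g' (\<gamma> l) (log_velocity ?q l h ** \<gamma> l)) = 0" for h
          proof -
            have zE: "log_velocity ?q l h \<in> E" by (rule log_velocity_in_ad_space[OF adE seg(4)[OF vS]])
            have tangent: "DF (y l) X = log_velocity ps (y l) X ** \<gamma> l" if "X \<in> E" for X
              using that Fy c0_iff[of X] by (simp add: DF_def F_def mm.zero_right flip: matrix_mul_assoc)
            (* The derivative of F maps E injectively, hence onto the tangent directions in E; so the
               logarithmic velocity of the path is attained by a vector of E, on which c vanishes. *)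
            obtain X where X: "X \<in> E" "log_velocity ps (y l) X = log_velocity ?q l h"
            proof (rule linear_inj_on_subspace_surj[OF lin_vel subE _ _ zE, of "y l"])
              show "log_velocity ps (y l) ` E \<subseteq> E" using velE by blast
              fix X assume "X \<in> E" "log_velocity ps (y l) X = 0"
              then have "DF (y l) X = DF (y l) 0"
                using tangent[of X] tangent[of 0] subspace_0[OF subE] linear_0[OF lin_vel] by simp
              then show "X = 0" using bij by (metis bij_is_inj injD)
            qed blast
            have "g' (\<gamma> l) (log_velocity ?q l h ** \<gamma> l) = inv (DF (y l)) (DF (y l) X)"
              using IFT(6)[OF inV] X tangent by (simp add: y_def)
            also have "\<dots> = X" using bij by (simp add: bij_is_inj)
            finally show ?thesis using X(1) c0_iff by simp
          qed
          ultimately show ?thesis by simp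
        qed
        have "c (y 1) = c (y 0)"
        proof (rule has_derivative_zero_unique[where s = "{0..1}" and f = "\<lambda>l. c (y l)"])
          show "((\<lambda>l. c (y l)) has_derivative (\<lambda>h. 0)) (at l within {0..1})" if "l \<in> {0..1}" for l
            by (rule has_derivative_at_withinI[OF der0]) (use that in simp_all)
        qed simp_all
        moreover have "y 0 = Y0" using gF[of Y0] Y0 BU by (auto simp: y_def \<gamma>_def seg(1))
        moreover have "c Y0 = 0" using Y0(1) c0_iff by blast
        ultimately have "c (y 1) = 0" by simp
        then have "y 1 \<in> E" using c0_iff by blast
        moreover have "y 1 \<in> ball 0 \<delta>" unfolding y_def by (intro gV' \<gamma>V') auto
        moreover have "flow_prod us = G (y 1)"
          using Fg[of "\<gamma> 1"] \<gamma>V'[of 1] V'V FE[OF \<open>y 1 \<in> E\<close>] by (auto simp: y_def \<gamma>_def seg(2))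
        ultimately show ?thesis by (auto simp: G_def)
      qed
      then show "\<exists>r>0. \<forall>us. near r vs us \<longrightarrow> flow_prod us \<in> (\<lambda>Y. flow_prod (word_at ps Y)) ` (E \<inter> ball 0 \<delta>)"
        using r(1) by blast
    qed
  next
    show "0 < min \<delta>1 \<delta>2" using \<delta>1(1) \<delta>2(1) by simp
  qed (rule ps_der subE psS)+
qed

section \<open>Countable covers by translates\<close>

lemma near_refl: "0 < r \<Longrightarrow> near r ws ws"
  unfolding near_def by (intro list.rel_refl) auto

lemma near_append: "near r xs xs' \<Longrightarrow> near r ys ys' \<Longrightarrow> near r (xs @ ys) (xs' @ ys')"
  unfolding near_def by (rule list_all2_appendI)

lemma near_inv_word: "near r ws vs \<Longrightarrow> near r (inv_word ws) (inv_word vs)"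
  unfolding near_def inv_word_def list_all2_rev
  by (auto simp: list_all2_map1 list_all2_map2 elim!: list_all2_mono)

lemma near_word_in: "near r ws vs \<Longrightarrow> word_in S ws \<Longrightarrow> word_in S vs"
  unfolding near_def word_in_def by (induction rule: list_all2_induct) auto

lemma near_Nil_iff: "near r ws vs \<Longrightarrow> vs = [] \<longleftrightarrow> ws = []"
  unfolding near_def by (auto dest: list_all2_lengthD)

lemma exists_rational_near:
  assumes "0 < r"
  obtains vs where "near r ws vs" "snd ` set vs \<subseteq> \<rat>" "fst ` set vs = fst ` set ws"
proof -
  have "\<exists>vs. near r ws vs \<and> snd ` set vs \<subseteq> \<rat> \<and> fst ` set vs = fst ` set ws"
  proof (induction ws)
    case Nil then show ?case by (auto simp: near_def)
  next
    case (Cons w ws)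
    then obtain vs where vs: "near r ws vs" "snd ` set vs \<subseteq> \<rat>" "fst ` set vs = fst ` set ws" by blast
    obtain A t where w: "w = (A, t)" by (cases w)
    obtain s where "s \<in> \<rat>" "t < s" "s < t + r" using Rats_dense_in_real[of t "t + r"] assms by auto
    then show ?case using vs by (intro exI[of _ "(A, s) # vs"]) (auto simp: w near_def)
  qed
  then show ?thesis using that by blast
qed

lemma word_at_near:
  fixes ps :: "('d::finite, 'a::real_normed_vector) letter list"
  assumes "\<forall>(A, f, f')\<in>set ps. \<forall>Y. (f has_derivative f') (at Y)" "0 < r"
  shows "\<exists>\<delta>>0. \<forall>Y. norm Y < \<delta> \<longrightarrow> near r (word_at ps 0) (word_at ps Y)"
  using assms(1)
proof (induction ps)
  case Nil then show ?case by (auto simp: near_def intro: exI[of _ 1])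
next
  case (Cons p ps)
  obtain A f f' where p: "p = (A, f, f')" by (cases p)
  obtain \<delta> where \<delta>: "\<delta> > 0" "\<And>Y. norm Y < \<delta> \<Longrightarrow> near r (word_at ps 0) (word_at ps Y)"
    using Cons by auto
  have "isCont f 0" using Cons.prems p has_derivative_continuous by fastforce
  then obtain d where d: "d > 0" "\<And>Y. dist Y 0 < d \<Longrightarrow> dist (f Y) (f 0) < r"
    using assms(2) unfolding continuous_at_eps_delta by blast
  show ?case
  proof (intro exI[of _ "min \<delta> d"] conjI allI impI)
    fix Y :: 'a assume "norm Y < min \<delta> d"
    then show "near r (word_at (p # ps) 0) (word_at (p # ps) Y)"
      using \<delta>(2)[of Y] d(2)[of Y] by (auto simp: p near_def dist_real_def)
  qed (use \<delta>(1) d(1) in simp)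
qed

lemma word_in_mono: "word_in S0 ws \<Longrightarrow> S0 \<subseteq> S \<Longrightarrow> word_in S ws"
  by (auto simp: word_in_def)

lemma flow_prod_in_group:
  assumes "S \<noteq> {}" "word_in S ws" shows "flow_prod ws \<in> flow_group S"
proof (cases "ws = []")
  case True then show ?thesis using flow_group_one[OF assms(1)] by simp
next
  case False then show ?thesis using assms(2) unfolding flow_group_def word_in_def by blast
qed

text \<open>The subgroup generated by the flows of \<open>S0\<close> contains a fine-open set. So it contains the flows of
each \<open>A\<close> in \<open>S\<close> for small times, and their powers.\<close>

lemma letters_generate:
  fixes S S0 :: "(real^'d^'d) set"
  assumes N: "fine_open S N" "N \<subseteq> {flow_prod us | us. word_in S0 us}"
    and ws0: "word_in S0 ws0" "flow_prod ws0 \<in> N" and S0: "S0 \<subseteq> S" and ws: "word_in S ws"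
  obtains us where "word_in S0 us" "flow_prod us = flow_prod ws"
proof -
  define G where "G = {flow_prod us | us. word_in S0 us}"
  have mult: "X ** Y \<in> G" if XY: "X \<in> G" "Y \<in> G" for X Y
  proof -
    obtain us vs where "X = flow_prod us" "Y = flow_prod vs" "word_in S0 us" "word_in S0 vs"
      using XY unfolding G_def by blast
    then have "X ** Y = flow_prod (vs @ us)" "word_in S0 (vs @ us)" by (simp_all add: flow_prod_append)
    then show ?thesis unfolding G_def by blast
  qed
  have one: "mat 1 \<in> G" unfolding G_def by (intro CollectI exI[of _ "[]"]) simp
  have gen: "mat_exp (t *\<^sub>R A) \<in> G" if A: "A \<in> S" for A t
  proof -
    have "word_in S ((A, 0) # ws0)" "flow_prod ((A, 0) # ws0) \<in> N"
      using A ws0 word_in_mono[OF ws0(1) S0] by auto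
    then obtain r where r: "r > 0" "\<And>vs. near r ((A, 0) # ws0) vs \<Longrightarrow> flow_prod vs \<in> N"
      using N(1) unfolding fine_open_def by metis
    have small: "mat_exp (s *\<^sub>R A) \<in> G" if "\<bar>s\<bar> < r" for s
    proof -
      have "near r ((A, 0) # ws0) ((A, s) # ws0)"
        using near_refl[OF r(1), of ws0] that by (auto simp: near_def)
      then have "flow_prod ws0 ** mat_exp (s *\<^sub>R A) \<in> G" using r(2) N(2) by (force simp: G_def)
      moreover have "flow_prod (inv_word ws0) \<in> G" unfolding G_def using ws0(1) by auto
      ultimately have "flow_prod (inv_word ws0) ** (flow_prod ws0 ** mat_exp (s *\<^sub>R A)) \<in> G" using mult by blast
      then show ?thesis by (simp add: matrix_mul_assoc)
    qed
    obtain n :: nat where n: "\<bar>t\<bar> / r < real n" using reals_Archimedean2 by blast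
    then have n0: "0 < real n" using r(1) by (meson abs_ge_zero divide_nonneg_pos le_less_trans)
    have "\<bar>t / n\<bar> < r" using n n0 r(1) by (simp add: field_simps)
    have "mat_exp ((real k * (t / n)) *\<^sub>R A) \<in> G" for k
    proof (induction k)
      case (Suc k)
      have "mat_exp ((real (Suc k) * (t / n)) *\<^sub>R A) = mat_exp ((t / n) *\<^sub>R A) ** mat_exp ((real k * (t / n)) *\<^sub>R A)"
        unfolding mat_exp_add[symmetric] by (simp add: algebra_simps add_divide_distrib)
      then show ?case using mult[OF small[OF \<open>\<bar>t / n\<bar> < r\<close>] Suc] by simp
    qed (simp add: one)
    from this[of n] show ?thesis using n0 by simp
  qed
  have "flow_prod ws \<in> G"
    using ws by (induction ws rule: flow_prod.induct) (auto simp: one intro: mult gen)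
  then show ?thesis using that unfolding G_def by auto
qed

text \<open>A group element \<open>g\<close> is a word in the finitely many matrices of \<open>S0\<close>. Perturbing the second copy of this
word in \<open>ws0 g\<inverse> g\<close> to rational times keeps the product in \<open>N\<close>. This works although \<open>S\<close> may be
uncountable.\<close>

lemma countable_translates_cover:
  fixes S S0 :: "(real^'d^'d) set"
  assumes N: "fine_open S N" "N \<subseteq> {flow_prod us | us. word_in S0 us}"
    and ws0: "word_in S0 ws0" "flow_prod ws0 \<in> N" and S0: "S0 \<subseteq> S" "finite S0" and ne: "S \<noteq> {}"
  obtains Q where "countable Q" "Q \<subseteq> flow_group S" "\<And>g. g \<in> flow_group S \<Longrightarrow> \<exists>q\<in>Q. \<exists>n\<in>N. g = q ** n"
proof -
  define W where "W = lists (S0 \<times> (\<rat> :: real set))"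
  define Q where "Q = (\<lambda>ws. flow_prod (inv_word ws0 @ ws)) ` W"
  have "countable W"
    unfolding W_def by (intro countable_lists countable_SIGMA countable_finite S0 countable_rat)
  then have "countable Q" unfolding Q_def by (rule countable_image)
  moreover have "Q \<subseteq> flow_group S"
  proof
    fix q assume "q \<in> Q"
    then obtain ws where ws: "q = flow_prod (inv_word ws0 @ ws)" "ws \<in> W" by (auto simp: Q_def)
    have "word_in S0 ws" using ws(2) by (auto simp: W_def word_in_def)
    then have "word_in S (inv_word ws0 @ ws)"
      using word_in_mono[OF _ S0(1)] ws0(1) by simp
    then show "q \<in> flow_group S" unfolding ws(1) by (rule flow_prod_in_group[OF ne])
  qed
  moreover have "\<exists>q\<in>Q. \<exists>n\<in>N. g = q ** n" if g: "g \<in> flow_group S" for g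
  proof -
    obtain ws where "g = flow_prod ws" "word_in S ws"
      using g unfolding flow_group_def word_in_def by blast
    then obtain us where us: "word_in S0 us" "flow_prod us = g"
      using letters_generate[OF N ws0 S0(1)] by metis
    let ?w = "us @ inv_word us @ ws0"
    have "flow_prod ?w = flow_prod ws0" by (simp add: flow_prod_append flip: matrix_mul_assoc)
    moreover have "word_in S ?w" using us(1) ws0(1) word_in_mono[OF _ S0(1)] by simp
    ultimately obtain r where r: "r > 0" "\<And>vs. near r ?w vs \<Longrightarrow> flow_prod vs \<in> N"
      using N(1) ws0(2) unfolding fine_open_def by metis
    obtain vs where vs: "near r us vs" "snd ` set vs \<subseteq> \<rat>" "fst ` set vs = fst ` set us"
      using exists_rational_near[OF r(1)] by blast
    have "vs \<in> W"
      unfolding W_def using vs(2,3) us(1) by (force simp: word_in_def lists_eq_set)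
    have n: "flow_prod (us @ inv_word vs @ ws0) \<in> N"
      by (intro r(2) near_append near_refl near_inv_word vs(1) r(1))
    have "flow_prod (inv_word ws0 @ vs) ** flow_prod (us @ inv_word vs @ ws0)
        = flow_prod vs ** (flow_prod (inv_word ws0) ** flow_prod ws0) ** flow_prod (inv_word vs) ** g"
      by (simp add: flow_prod_append us(2) matrix_mul_assoc del: flow_prod_inv_left)
    also have "\<dots> = g" by simp
    finally show ?thesis using n \<open>vs \<in> W\<close> unfolding Q_def by force
  qed
  ultimately show ?thesis using that by blast
qed

lemma Baire_countable_closed_cover:
  fixes K :: "'a::{real_normed_vector, heine_borel} set"
  assumes K: "closed K" "K \<noteq> {}" and Q: "countable Q" "\<And>q. q \<in> Q \<Longrightarrow> closed (C q)" "K \<subseteq> (\<Union>q\<in>Q. C q)"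
  obtains q x e where "q \<in> Q" "x \<in> K" "0 < e" "K \<inter> ball x e \<subseteq> C q"
proof (rule ccontr)
  assume neg: "\<not> thesis"
  have "K \<subseteq> closure (\<Inter>((\<lambda>q. K - C q) ` Q))"
  proof (rule Baire[OF K(1)])
    show "countable ((\<lambda>q. K - C q) ` Q)" using Q(1) by blast
    fix T assume "T \<in> (\<lambda>q. K - C q) ` Q"
    then obtain q where q: "q \<in> Q" "T = K - C q" by blast
    have "openin (top_of_set K) T"
      unfolding q(2) using Q(2)[OF q(1)] by (metis Diff_eq open_Compl openin_open_Int)
    moreover have "K \<subseteq> closure T"
    proof
      fix x assume x: "x \<in> K"
      show "x \<in> closure T"
        unfolding closure_approachable
      proof (intro allI impI)
        fix e :: real assume "0 < e"
        then have "\<not> K \<inter> ball x e \<subseteq> C q" using neg that q(1) x by blast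
        then show "\<exists>y\<in>T. dist y x < e" by (auto simp: q(2) dist_commute)
      qed
    qed
    ultimately show "openin (top_of_set K) T \<and> K \<subseteq> closure T" ..
  qed
  moreover have "\<Inter>((\<lambda>q. K - C q) ` Q) = {}"
  proof -
    obtain x where "x \<in> K" using K(2) by blast
    then obtain q where "q \<in> Q" using Q(3) by blast
    then show ?thesis using Q(3) by blast
  qed
  ultimately show False using K(2) by simp
qed

section \<open>The orbit topology of a closed orbit\<close>

lemma openin_powertop_real_iff:
  fixes W :: "(nat \<Rightarrow> real) set"
  shows "openin (powertop_real {..<n}) W \<longleftrightarrow> W \<subseteq> topspace (powertop_real {..<n}) \<and>
    (\<forall>t\<in>W. \<exists>r>0. \<forall>u\<in>topspace (powertop_real {..<n}). (\<forall>i<n. \<bar>u i - t i\<bar> < r) \<longrightarrow> u \<in> W)"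
  (is "?L \<longleftrightarrow> ?R")
proof
  assume L: ?L
  have "\<exists>r>0. \<forall>u\<in>topspace (powertop_real {..<n}). (\<forall>i<n. \<bar>u i - t i\<bar> < r) \<longrightarrow> u \<in> W" if t: "t \<in> W" for t
  proof -
    obtain U where U: "\<forall>i\<in>{..<n}. openin euclideanreal (U i)" "t \<in> Pi\<^sub>E {..<n} U" "Pi\<^sub>E {..<n} U \<subseteq> W"
      using L t unfolding openin_product_topology_alt by blast
    have "\<exists>e>0. ball (t i) e \<subseteq> U i" if "i < n" for i
      using U(1,2) that open_contains_ball[of "U i"] by (auto simp: PiE_iff)
    then obtain e where e: "\<And>i. i < n \<Longrightarrow> e i > 0 \<and> ball (t i) (e i) \<subseteq> U i" by metis
    define r where "r = Min (insert 1 (e ` {..<n}))"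
    have "r > 0" using e by (auto simp: r_def)
    moreover have "u \<in> W" if "u \<in> topspace (powertop_real {..<n})" "\<forall>i<n. \<bar>u i - t i\<bar> < r" for u
    proof -
      have "u i \<in> U i" if "i < n" for i
      proof -
        have "r \<le> e i" unfolding r_def using that by (intro Min_le) auto
        then have "u i \<in> ball (t i) (e i)"
          using \<open>\<forall>i<n. \<bar>u i - t i\<bar> < r\<close> that by (force simp: dist_real_def)
        then show ?thesis using e[OF that] by blast
      qed
      then have "u \<in> Pi\<^sub>E {..<n} U" using that(1) by (auto simp: PiE_iff)
      then show ?thesis using U(3) by blast
    qed
    ultimately show ?thesis by blast
  qed
  then show ?R using openin_subset[OF L] by blast
next
  assume R: ?R
  show ?L
    unfolding openin_product_topology_alt
  proof
    fix t assume t: "t \<in> W"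
    then obtain r where r: "r > 0" "\<forall>u\<in>topspace (powertop_real {..<n}). (\<forall>i<n. \<bar>u i - t i\<bar> < r) \<longrightarrow> u \<in> W"
      using R by blast
    have tt: "t \<in> topspace (powertop_real {..<n})" using t R by blast
    show "\<exists>U. finite {i \<in> {..<n}. U i \<noteq> topspace euclideanreal} \<and>
        (\<forall>i\<in>{..<n}. openin euclideanreal (U i)) \<and> t \<in> Pi\<^sub>E {..<n} U \<and> Pi\<^sub>E {..<n} U \<subseteq> W"
    proof (intro exI[of _ "\<lambda>i. ball (t i) r"] conjI)
      show "t \<in> (\<Pi>\<^sub>E i\<in>{..<n}. ball (t i) r)" using tt r(1) by (auto simp: PiE_iff)
      show "(\<Pi>\<^sub>E i\<in>{..<n}. ball (t i) r) \<subseteq> W"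
      proof
        fix u assume u: "u \<in> (\<Pi>\<^sub>E i\<in>{..<n}. ball (t i) r)"
        then have "\<forall>i<n. \<bar>u i - t i\<bar> < r" by (auto simp: PiE_iff dist_real_def abs_minus_commute)
        moreover have "u \<in> topspace (powertop_real {..<n})" using u by (auto simp: PiE_iff)
        ultimately show "u \<in> W" using r(2) by blast
      qed
    qed auto
  qed
qed

text \<open>The indexing of times by functions on \<open>{..<n}\<close> is translated once and for all into words.\<close>

lemma openin_orbit_topology_iff:
  fixes S :: "(real^'d^'d) set"
  shows "openin (orbit_topology S q) U \<longleftrightarrow> U \<subseteq> orbit S q \<and> fine_open S {g. proj_act g q \<in> U}"
proof -
  let ?w = "\<lambda>As t. zip As (map t [0..<length As])"
  let ?T = "\<lambda>n::nat. topspace (powertop_real {..<n})"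
  have near_iff: "near r (?w As t) (?w As u) \<longleftrightarrow> (\<forall>i<length As. \<bar>u i - t i\<bar> < r)"
    for r and As :: "(real^'d^'d) list" and t u
    by (auto simp: near_def list_all2_conv_all_nth)
  have word: "word_in S (?w As t) \<longleftrightarrow> set As \<subseteq> S" for As :: "(real^'d^'d) list" and t
    by (force simp: word_in_def set_zip in_set_conv_nth)
  have repr: "\<exists>t\<in>?T (length As). vs = ?w As t" if "map fst vs = As" for As and vs :: "((real^'d^'d) \<times> real) list"
  proof (intro bexI[of _ "restrict (\<lambda>i. snd (vs ! i)) {..<length As}"])
    show "vs = ?w As (restrict (\<lambda>i. snd (vs ! i)) {..<length As})"
      using that by (auto intro!: nth_equalityI prod_eqI)
  qed auto
  have near_fst: "map fst vs = map fst ws" if "near r ws vs" for r and ws vs :: "((real^'d^'d) \<times> real) list"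
    using that unfolding near_def by (induction rule: list_all2_induct) auto
  have "fine_open S X \<longleftrightarrow> (\<forall>As. As \<noteq> [] \<and> set As \<subseteq> S \<longrightarrow>
      openin (powertop_real {..<length As}) {t \<in> ?T (length As). flow_prod (?w As t) \<in> X})" for X
  proof (intro iffI allI impI; (elim conjE)?)
    fix As assume f: "fine_open S X" and As: "set As \<subseteq> S"
    show "openin (powertop_real {..<length As}) {t \<in> ?T (length As). flow_prod (?w As t) \<in> X}"
      unfolding openin_powertop_real_iff
    proof (intro conjI ballI)
      fix t assume "t \<in> {t \<in> ?T (length As). flow_prod (?w As t) \<in> X}"
      then obtain r where "r > 0" "\<forall>vs. near r (?w As t) vs \<longrightarrow> flow_prod vs \<in> X"
        using f word As unfolding fine_open_def by blast
      then show "\<exists>r>0. \<forall>u\<in>?T (length As). (\<forall>i<length As. \<bar>u i - t i\<bar> < r) \<longrightarrow>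
          u \<in> {t \<in> ?T (length As). flow_prod (?w As t) \<in> X}"
        using near_iff by blast
    qed blast
  next
    assume o: "\<forall>As. As \<noteq> [] \<and> set As \<subseteq> S \<longrightarrow>
      openin (powertop_real {..<length As}) {t \<in> ?T (length As). flow_prod (?w As t) \<in> X}"
    show "fine_open S X"
      unfolding fine_open_def
    proof (intro allI impI, elim conjE)
      fix ws assume ws: "word_in S ws" "flow_prod ws \<in> X"
      show "\<exists>r>0. \<forall>vs. near r ws vs \<longrightarrow> flow_prod vs \<in> X"
      proof (cases "ws = []")
        case True
        then show ?thesis using ws(2) near_Nil_iff by (intro exI[of _ 1]) fastforce
      next
        case False
        define As where "As = map fst ws"
        obtain t where t: "t \<in> ?T (length As)" "ws = ?w As t" using repr As_def by blast
        have "As \<noteq> []" "set As \<subseteq> S" using False ws(1) by (auto simp: As_def word_in_def)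
        then have "openin (powertop_real {..<length As}) {t \<in> ?T (length As). flow_prod (?w As t) \<in> X}"
          using o by blast
        moreover have "t \<in> {t \<in> ?T (length As). flow_prod (?w As t) \<in> X}" using t ws(2) by simp
        ultimately obtain r where r: "r > 0" "\<And>u. u \<in> ?T (length As) \<Longrightarrow>
            \<forall>i<length As. \<bar>u i - t i\<bar> < r \<Longrightarrow> flow_prod (?w As u) \<in> X"
          unfolding openin_powertop_real_iff by blast
        have "flow_prod vs \<in> X" if nr: "near r ws vs" for vs
        proof -
          obtain u where u: "u \<in> ?T (length As)" "vs = ?w As u"
            using repr near_fst[OF nr] unfolding As_def by blast
          then show ?thesis using r(2)[OF u(1)] nr near_iff[of r As t u] t(2) by blast
        qed
        then show ?thesis using r(1) by blast
      qed
    qed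
  qed
  then show ?thesis unfolding openin_orbit_topology by auto
qed

lemma orbit_open_if_proj_open:
  fixes S :: "(real^'d^'d) set"
  assumes s0: "s0 \<in> proj_points" and ne: "S \<noteq> {}" and V: "openin proj_space V"
  shows "openin (orbit_topology S s0) (V \<inter> orbit S s0)"
  unfolding openin_orbit_topology_iff fine_open_def
proof (intro conjI allI impI; (elim conjE)?)
  fix ws assume ws: "word_in S ws" "flow_prod ws \<in> {g. proj_act g s0 \<in> V \<inter> orbit S s0}"
  obtain x0 where x0: "x0 \<noteq> 0" "s0 = span {x0}" using s0 by (auto simp: proj_points_iff)
  have "open {M :: real^'d^'d. M *v x0 \<in> vectors_over V}"
  proof -
    have "open (vectors_over V)" using V by (simp add: openin_proj_space vectors_over_def)
    then have "open ((\<lambda>M :: real^'d^'d. M *v x0) -` vectors_over V)"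
      by (rule continuous_open_vimage) (rule linear_continuous_at[OF mv.bounded_linear_left])
    then show ?thesis by (simp add: vimage_def)
  qed
  moreover have "flow_prod ws \<in> {M. M *v x0 \<in> vectors_over V}"
    using ws(2) flow_prod_nz[OF x0(1)] by (simp add: x0(2) proj_act_span vectors_over_def)
  ultimately obtain e where e: "e > 0" "ball (flow_prod ws) e \<subseteq> {M. M *v x0 \<in> vectors_over V}"
    using open_contains_ball by blast
  obtain r where r: "r > 0" "\<And>vs. near r ws vs \<Longrightarrow> dist (flow_prod vs) (flow_prod ws) < e"
    using flow_prod_near[OF e(1)] by blast
  have "proj_act (flow_prod vs) s0 \<in> V \<inter> orbit S s0" if nr: "near r ws vs" for vs
  proof -
    have "flow_prod vs *v x0 \<in> vectors_over V" using r(2)[OF nr] e(2) by (auto simp: dist_commute)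
    moreover have "flow_prod vs \<in> flow_group S"
      by (rule flow_prod_in_group[OF ne near_word_in[OF nr ws(1)]])
    ultimately show ?thesis by (auto simp: x0(2) proj_act_span vectors_over_def orbit_def)
  qed
  then show "\<exists>r>0. \<forall>vs. near r ws vs \<longrightarrow> flow_prod vs \<in> {g. proj_act g s0 \<in> V \<inter> orbit S s0}"
    using r(1) by blast
qed blast

text \<open>Compact pieces \<open>q G (E \<inter> cball 0 \<delta>) z0\<close> of the orbit, countably many of them, cover it. By Baire's
theorem one of them contains a neighbourhood, in the projective topology of the orbit, of some
\<open>x = q (G Y) z0\<close>. Pulling back by \<open>(q (G Y))\<inverse>\<close> gives a neighbourhood of \<open>z0\<close> consisting of
points \<open>(G Y)\<inverse> (G Y') z0\<close>. For small \<open>\<delta>\<close> these lie in \<open>U\<close>, because they are values of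
a word whose times are near to times where its value is \<open>z0\<close>.\<close>

lemma proj_neighbourhood_in_orbit_open:
  fixes S :: "(real^'d^'d) set" and s0 :: "(real^'d) set"
  assumes ne: "S \<noteq> {}" and s0: "s0 \<in> proj_points" and cl: "closedin proj_space (orbit S s0)"
    and U: "openin (orbit_topology S s0) U" and z0: "z0 \<in> vectors_over U"
  obtains \<eta> where "0 < \<eta>" "ball z0 \<eta> \<inter> vectors_over (orbit S s0) \<subseteq> vectors_over U"
proof -
  let ?O = "orbit S s0"
  have UO: "U \<subseteq> ?O" and Uf: "fine_open S {g. proj_act g s0 \<in> U}" using U unfolding openin_orbit_topology_iff by auto
  have Opp: "?O \<subseteq> proj_points" by (rule orbit_subset_proj_points[OF s0])
  obtain x0 where x0: "x0 \<noteq> 0" "s0 = span {x0}" using s0 by (auto simp: proj_points_iff)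
  obtain ps :: "('d, real^'d^'d) letter list" and E \<delta>0 where ch: "ps \<noteq> []"
    "\<forall>(A, f, f')\<in>set ps. \<forall>Y. (f has_derivative f') (at Y)" "subspace E" "0 < \<delta>0"
    "\<And>Y. word_in S (word_at ps Y)"
    "\<And>\<delta>. 0 < \<delta> \<Longrightarrow> \<delta> \<le> \<delta>0 \<Longrightarrow> fine_open S ((\<lambda>Y. flow_prod (word_at ps Y)) ` (E \<inter> ball 0 \<delta>))"
    by (rule exists_fine_open_chart[OF ne, where \<tau> = 0], rule that)
  define G where "G Y = flow_prod (word_at ps Y)" for Y
  have z0nz: "z0 \<noteq> 0" and z0U: "span {z0} \<in> U" using z0 by (auto simp: vectors_over_def)
  have z0O: "span {z0} \<in> ?O" using z0U UO by blast
  obtain h where h: "h \<in> flow_group S" "span {z0} = span {h *v x0}" using z0O orbit_iff[OF x0(2)] by blast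
  obtain ws where ws: "h = flow_prod ws" "word_in S ws"
    using h(1) unfolding flow_group_def word_in_def by blast
  have act_z0: "proj_act (M ** h) s0 = span {M *v z0}" for M
    using arg_cong[OF h(2), of "proj_act M"] by (simp add: x0(2) proj_act_span matrix_vector_mul_assoc)
  obtain r where r: "0 < r" "\<And>Y Z. near r (word_at ps 0) (word_at ps Y) \<Longrightarrow> near r (word_at ps 0) (word_at ps Z) \<Longrightarrow>
      span {(flow_prod (inv_word (word_at ps Y)) ** G Z) *v z0} \<in> U"
  proof -
    let ?w = "\<lambda>Y Z. ws @ word_at ps Z @ inv_word (word_at ps Y)"
    have fl: "flow_prod (?w Y Z) = (flow_prod (inv_word (word_at ps Y)) ** G Z) ** h" for Y Z
      by (simp add: flow_prod_append ws(1) G_def matrix_mul_assoc)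
    have "flow_prod (?w 0 0) = h" by (simp add: fl G_def)
    then have "flow_prod (?w 0 0) \<in> {g. proj_act g s0 \<in> U}"
      using act_z0[of "mat 1"] z0U by simp
    moreover have "word_in S (?w 0 0)" using ws(2) ch(5) by simp
    ultimately obtain r where r: "r > 0" "\<And>vs. near r (?w 0 0) vs \<Longrightarrow> flow_prod vs \<in> {g. proj_act g s0 \<in> U}"
      using Uf unfolding fine_open_def by metis
    show ?thesis
    proof (rule that[OF r(1)])
      fix Y Z assume YZ: "near r (word_at ps 0) (word_at ps Y)" "near r (word_at ps 0) (word_at ps Z)"
      have "flow_prod (?w Y Z) \<in> {g. proj_act g s0 \<in> U}"
        by (intro r(2) near_append near_inv_word near_refl YZ r(1))
      then show "span {(flow_prod (inv_word (word_at ps Y)) ** G Z) *v z0} \<in> U"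
        by (simp add: fl act_z0)
    qed
  qed
  obtain \<delta>1 where \<delta>1: "\<delta>1 > 0" "\<And>Y. norm Y < \<delta>1 \<Longrightarrow> near r (word_at ps 0) (word_at ps Y)"
    using word_at_near[OF ch(2) r(1)] by blast
  (* Half of the minimum, so that the closed ball of radius \<delta> has all the required properties. *)
  define \<delta> where "\<delta> = min \<delta>0 \<delta>1 / 2"
  have \<delta>: "0 < \<delta>" "\<delta> \<le> \<delta>0" "\<delta> < \<delta>1" using ch(4) \<delta>1(1) by (auto simp: \<delta>_def)
  define N where "N = G ` (E \<inter> ball 0 \<delta>)"
  define S0 where "S0 = fst ` set ps"
  have S0_word: "word_in S0 (word_at ps Y)" for Y by (force simp: word_in_def word_at_def S0_def)
  have S0S: "S0 \<subseteq> S" using ch(5)[of 0] by (force simp: word_in_def word_at_def S0_def)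
  obtain Q where Q: "countable Q" "Q \<subseteq> flow_group S" "\<And>g. g \<in> flow_group S \<Longrightarrow> \<exists>q\<in>Q. \<exists>n\<in>N. g = q ** n"
  proof (rule countable_translates_cover[of S N S0 "word_at ps 0"])
    show "fine_open S N" unfolding N_def G_def[abs_def] by (rule ch(6)[OF \<delta>(1,2)])
    show "N \<subseteq> {flow_prod us |us. word_in S0 us}" using S0_word by (auto simp: N_def G_def)
    show "flow_prod (word_at ps 0) \<in> N" using \<delta>(1) subspace_0[OF ch(3)] by (auto simp: N_def G_def)
    show "finite S0" by (simp add: S0_def)
  qed (use S0_word S0S ne in auto)
  define K where "K = sphere 0 1 \<inter> closure (vectors_over ?O)"
  have in_K: "x \<in> K \<longleftrightarrow> norm x = 1 \<and> span {x} \<in> ?O" for x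
  proof (cases "x = 0")
    case False
    have "span {x} \<in> ?O \<longleftrightarrow> x \<in> closure (vectors_over ?O)"
      using span_in_closure_of_iff[OF Opp False] closure_of_closedin[OF cl] by simp
    then show ?thesis by (auto simp: K_def)
  qed (auto simp: K_def)
  have Gnz: "(q ** G Y) *v z0 \<noteq> 0" if "q \<in> flow_group S" for q Y
    using flow_group_nz[OF that flow_prod_nz[OF z0nz]] by (simp add: G_def flip: matrix_vector_mul_assoc)
  define Z where "Z q = (\<lambda>Y. sgn ((q ** G Y) *v z0)) ` (E \<inter> cball 0 \<delta>)" for q :: "real^'d^'d"
  (* Both unit vectors on each line. *)
  define C where "C q = Z q \<union> uminus ` Z q" for q :: "real^'d^'d"
  have Cmem: "\<exists>Y\<in>E \<inter> cball 0 \<delta>. span {x} = span {(q ** G Y) *v z0}" if x: "x \<in> C q" and q: "q \<in> flow_group S" for x q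
  proof -
    obtain Y where Y: "Y \<in> E \<inter> cball 0 \<delta>" "x = sgn ((q ** G Y) *v z0) \<or> x = - sgn ((q ** G Y) *v z0)"
      using x unfolding C_def Z_def by blast
    have nz: "(q ** G Y) *v z0 \<noteq> 0"
      by (rule Gnz[OF q])
    then have "\<exists>c. c \<noteq> 0 \<and> x = c *\<^sub>R ((q ** G Y) *v z0)"
      using Y(2) by (intro exI[of _ "if x = sgn ((q ** G Y) *v z0) then inverse (norm ((q ** G Y) *v z0)) else - inverse (norm ((q ** G Y) *v z0))"])
        (auto simp: sgn_div_norm divide_inverse)
    then show ?thesis using Y(1) nz span_singleton_eq_iff[of "(q ** G Y) *v z0" x] by (metis scaleR_eq_0_iff)
  qed
  obtain q x e where B: "q \<in> Q" "x \<in> K" "0 < e" "K \<inter> ball x e \<subseteq> C q"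
  proof (rule Baire_countable_closed_cover[of K Q C])
    show "closed K" unfolding K_def by (intro closed_Int closed_sphere closed_closure)
    have "sgn z0 \<in> K"
    proof -
      have "span {sgn z0} = span {z0}"
        using span_singleton_eq_iff[of z0 "sgn z0"] z0nz
        by (metis inverse_nonzero_iff_nonzero norm_eq_zero sgn_div_norm sgn_zero_iff)
      then show ?thesis using z0O z0nz by (simp add: in_K norm_sgn)
    qed
    then show "K \<noteq> {}" by blast
    show "countable Q" by (rule Q(1))
    show "closed (C q)" if q: "q \<in> Q" for q
    proof -
      have "continuous_on (E \<inter> cball 0 \<delta>) (\<lambda>Y. sgn ((q ** G Y) *v z0))"
      proof (intro continuous_on_sgn ballI)
        have "continuous_on UNIV G" unfolding G_def by (rule flow_word_at_continuous[OF ch(2)])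
        then have "continuous_on (E \<inter> cball 0 \<delta>) G" by (rule continuous_on_subset) simp
        then show "continuous_on (E \<inter> cball 0 \<delta>) (\<lambda>Y. (q ** G Y) *v z0)"
          by (intro mv.continuous_on mm.continuous_on continuous_on_const)
        fix Y show "(q ** G Y) *v z0 \<noteq> 0"
          using q Q(2) by (intro Gnz) blast
      qed
      moreover have "compact (E \<inter> cball 0 \<delta>)"
        using closed_subspace[OF ch(3)] by (simp add: closed_Int_compact)
      ultimately have "compact (Z q)" unfolding Z_def by (rule compact_continuous_image)
      then show ?thesis unfolding C_def
        by (intro closed_Un compact_imp_closed compact_negations) auto
    qed
    show "K \<subseteq> (\<Union>q\<in>Q. C q)"
    proof
      fix x assume x: "x \<in> K"
      then have xn: "norm x = 1" "span {x} \<in> ?O" by (auto simp: in_K)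
      then have "x \<noteq> 0" by auto
      obtain g where g: "g \<in> flow_group S" "span {x} = span {g *v x0}" using xn(2) orbit_iff[OF x0(2)] by blast
      obtain h' where h': "h' \<in> flow_group S" "h' ** h = mat 1" using flow_group_inverse[OF h(1)] by blast
      obtain q n where qn: "q \<in> Q" "n \<in> N" "g ** h' = q ** n" using Q(3)[OF flow_group_mult[OF g(1) h'(1)]] by blast
      obtain Y where Y: "Y \<in> E \<inter> ball 0 \<delta>" "n = G Y" using qn(2) by (auto simp: N_def)
      let ?v = "(q ** G Y) *v z0"
      have "span {?v} = proj_act (g ** h' ** h) s0" using act_z0[of "q ** G Y"] qn(3) Y(2) by simp
      also have "g ** h' ** h = g" by (simp add: h'(2) flip: matrix_mul_assoc)
      also have "proj_act g s0 = span {x}" using g(2) by (simp add: x0(2) proj_act_span)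
      finally have sp: "span {x} = span {?v}" by simp
      have "?v \<noteq> 0"
        using qn(1) Q(2) by (intro Gnz) blast
      then obtain c where c: "c \<noteq> 0" "x = c *\<^sub>R ?v"
        using sp span_singleton_eq_iff[of ?v x] \<open>x \<noteq> 0\<close> by auto
      have "x = sgn x" using xn(1) by (simp add: sgn_div_norm)
      also have "\<dots> = sgn c *\<^sub>R sgn ?v" unfolding c(2) by (rule sgn_scaleR)
      finally have "x = sgn ?v \<or> x = - sgn ?v" using c(1) by (auto simp: sgn_real_def split: if_splits)
      moreover have "sgn ?v \<in> Z q" unfolding Z_def using Y(1) by auto
      ultimately show "x \<in> (\<Union>q\<in>Q. C q)" using qn(1) by (auto simp: C_def)
    qed
  qed blast
  have xC: "x \<in> C q" using B by auto
  have qG: "q \<in> flow_group S" using B(1) Q(2) by blast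
  obtain Y where Y: "Y \<in> E \<inter> cball 0 \<delta>" "span {x} = span {(q ** G Y) *v z0}" using Cmem[OF xC qG] by blast
  define M where "M = q ** G Y"
  have GY: "G Y \<in> flow_group S" unfolding G_def by (rule flow_prod_in_group[OF ne ch(5)])
  have MG: "M \<in> flow_group S" unfolding M_def by (rule flow_group_mult[OF qG GY])
  have Mnz: "M *v z \<noteq> 0" if "z \<noteq> 0" for z by (rule flow_group_nz[OF MG that])
  have x1: "norm x = 1" using B(2) by (simp add: in_K)
  then have xnz: "x \<noteq> 0" by auto
  obtain c where c: "c \<noteq> 0" "x = c *\<^sub>R (M *v z0)"
    using Y(2) span_singleton_eq_iff[OF Mnz[OF z0nz] xnz] by (auto simp: M_def)
  (* The sign makes \<rho> z0 equal to x instead of its antipode. *)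
  define \<rho> where "\<rho> z = sgn c *\<^sub>R sgn (M *v z)" for z
  have "\<rho> z0 = sgn x" unfolding \<rho>_def c(2) sgn_scaleR ..
  then have \<rho>0: "\<rho> z0 = x" using x1 by (simp add: sgn_div_norm)
  have "isCont \<rho> z0"
    unfolding \<rho>_def using Mnz[OF z0nz]
    by (intro continuous_intros isCont_sgn linear_continuous_at[OF mv.bounded_linear_right]) auto
  then obtain \<eta>0 where \<eta>0: "\<eta>0 > 0" "\<And>z. dist z z0 < \<eta>0 \<Longrightarrow> dist (\<rho> z) x < e"
    using B(3) unfolding continuous_at_eps_delta \<rho>0 by blast
  show ?thesis
  proof (rule that[OF \<eta>0(1)])
    show "ball z0 \<eta>0 \<inter> vectors_over ?O \<subseteq> vectors_over U"
    proof
      fix z assume z: "z \<in> ball z0 \<eta>0 \<inter> vectors_over ?O"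
      then have znz: "z \<noteq> 0" and zO: "span {z} \<in> ?O" by (auto simp: vectors_over_def)
      have "\<exists>k. k \<noteq> 0 \<and> \<rho> z = k *\<^sub>R (M *v z)"
        unfolding \<rho>_def sgn_div_norm[of "M *v z"] using c(1) Mnz[OF znz]
        by (intro exI[of _ "sgn c * inverse (norm (M *v z))"]) (auto simp: divide_inverse sgn_zero_iff)
      then obtain k where k: "k \<noteq> 0" "\<rho> z = k *\<^sub>R (M *v z)" by blast
      then have sp: "span {\<rho> z} = span {M *v z}"
        using span_singleton_eq_iff[of "M *v z" "\<rho> z"] Mnz[OF znz] by auto
      have "span {M *v z} \<in> ?O"
      proof -
        obtain g where "g \<in> flow_group S" "span {z} = span {g *v x0}" using zO orbit_iff[OF x0(2)] by blast
        then have "span {M *v z} = span {(M ** g) *v x0}" "M ** g \<in> flow_group S"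
          using flow_group_mult[OF MG] by (simp_all add: matrix_vector_mul_assoc flip: proj_act_span[of M])
            (simp add: proj_act_span matrix_vector_mul_assoc)
        then show ?thesis unfolding orbit_iff[OF x0(2)] by blast
      qed
      moreover have "norm (\<rho> z) = 1"
        unfolding \<rho>_def using c(1) Mnz[OF znz] by (simp add: norm_sgn)
      ultimately have "\<rho> z \<in> K" using sp by (simp add: in_K)
      moreover have "\<rho> z \<in> ball x e" using \<eta>0(2)[of z] z by (simp add: dist_commute)
      ultimately have "\<rho> z \<in> C q" using B(4) by blast
      then obtain Y' where Y': "Y' \<in> E \<inter> cball 0 \<delta>" "span {\<rho> z} = span {(q ** G Y') *v z0}" using Cmem[OF _ qG] by blast
      let ?I = "flow_prod (inv_word (word_at ps Y))"
      obtain q' where q': "q' ** q = mat 1" using flow_group_inverse[OF qG] by blast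
      have "span {z} = proj_act (?I ** q') (span {M *v z})"
      proof -
        have "(?I ** q') ** M = ?I ** (q' ** q) ** G Y" by (simp add: M_def matrix_mul_assoc)
        also have "\<dots> = mat 1" unfolding q' by (simp add: G_def)
        finally show ?thesis by (simp add: proj_act_span matrix_vector_mul_assoc)
      qed
      also have "\<dots> = proj_act (?I ** q') (span {(q ** G Y') *v z0})" using sp Y'(2) by simp
      also have "\<dots> = span {(?I ** G Y') *v z0}"
      proof -
        have "(?I ** q') ** (q ** G Y') = ?I ** (q' ** q) ** G Y'" by (simp add: matrix_mul_assoc)
        also have "\<dots> = ?I ** G Y'" unfolding q' by simp
        finally show ?thesis by (simp add: proj_act_span matrix_vector_mul_assoc)
      qed
      also have "\<dots> \<in> U"
        using Y(1) Y'(1) \<delta>(3) by (intro r(2) \<delta>1(2)) auto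
      finally show "z \<in> vectors_over U" using znz by (simp add: vectors_over_def)
    qed
  qed
qed

lemma orbit_topology_eq_subtopology:
  fixes S :: "(real^'d^'d) set" and s0 :: "(real^'d) set"
  assumes ne: "S \<noteq> {}" and s0: "s0 \<in> proj_points" and cl: "closedin proj_space (orbit S s0)"
  shows "orbit_topology S s0 = subtopology proj_space (orbit S s0)"
  unfolding topology_eq openin_subtopology
proof (intro allI iffI)
  let ?O = "orbit S s0"
  fix U assume U: "openin (orbit_topology S s0) U"
  then have UO: "U \<subseteq> ?O" unfolding openin_orbit_topology_iff by simp
  have Opp: "?O \<subseteq> proj_points" by (rule orbit_subset_proj_points[OF s0])
  have "proj_space closure_of (?O - U) \<subseteq> ?O - U"
  proof
    fix s assume s: "s \<in> proj_space closure_of (?O - U)"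
    then have sO: "s \<in> ?O" using closure_of_minimal[OF _ cl, of "?O - U"] by blast
    then obtain z where z: "z \<noteq> 0" "s = span {z}" using Opp proj_points_iff by blast
    have "s \<notin> U"
    proof
      assume "s \<in> U"
      then have "z \<in> vectors_over U" using z by (simp add: vectors_over_def)
      then obtain \<eta> where \<eta>: "0 < \<eta>" "ball z \<eta> \<inter> vectors_over ?O \<subseteq> vectors_over U"
        using proj_neighbourhood_in_orbit_open[OF ne s0 cl U] by blast
      have "z \<in> closure (vectors_over (?O - U))"
        using s span_in_closure_of_iff[of "?O - U" z] Opp z by auto
      then obtain y where "y \<in> vectors_over (?O - U)" "dist y z < \<eta>"
        using \<eta>(1) unfolding closure_approachable by blast
      then have "y \<in> ball z \<eta> \<inter> vectors_over ?O" "y \<notin> vectors_over U" by (auto simp: vectors_over_def dist_commute)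
      then show False using \<eta>(2) by blast
    qed
    then show "s \<in> ?O - U" using sO by blast
  qed
  then have "closedin proj_space (?O - U)"
    using Opp by (subst closure_of_subset_eq[symmetric]) auto
  then have "openin proj_space (topspace proj_space - (?O - U))" by blast
  moreover have "U = (topspace proj_space - (?O - U)) \<inter> ?O" using UO Opp by auto
  ultimately show "\<exists>T. openin proj_space T \<and> U = T \<inter> ?O" by blast
next
  fix U assume "\<exists>T. openin proj_space T \<and> U = T \<inter> orbit S s0"
  then show "openin (orbit_topology S s0) U" using orbit_open_if_proj_open[OF s0 ne] by blast
qed

section \<open>The invariant dwell-time control set\<close>

lemma constant_signal_trajectory:
  fixes A :: "real^'d^'d"
  assumes q: "q \<in> proj_points"
  shows "proj_trajectory (\<lambda>_. A) q (\<lambda>t. proj_act (mat_exp (t *\<^sub>R A)) q)"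
proof -
  obtain x where x: "x \<noteq> 0" "q = span {x}" using q by (auto simp: proj_points_iff)
  define y where "y t = mat_exp (t *\<^sub>R A) *v x" for t
  have s: "proj_act (mat_exp (t *\<^sub>R A)) q = span {y t}" for t
    by (simp add: x(2) proj_act_span y_def)
  have ynz: "y t \<noteq> 0" for t
    using flow_prod_nz[OF x(1), of "[(A, t)]"] by (simp add: y_def)
  have yd: "(y has_vector_derivative A *v y t) (at t)" for t
    unfolding y_def[abs_def] matrix_vector_mul_assoc
    by (rule bounded_linear.has_vector_derivative[OF mv.bounded_linear_left mat_exp_has_vector_derivative])
  have "continuous_map (top_of_set {0..}) proj_space (\<lambda>t. span {y t})"
    unfolding continuous_map_def
  proof (intro conjI allI impI)
    show "(\<lambda>t. span {y t}) \<in> topspace (top_of_set {0..}) \<rightarrow> topspace proj_space"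
      using ynz by (auto simp: span_in_proj_points)
    fix U :: "(real^'d) set set" assume "openin proj_space U"
    then have "open (vectors_over U)" by (simp add: openin_proj_space vectors_over_def)
    then have "open (y -` vectors_over U)"
      using has_vector_derivative_continuous[OF yd] by (intro continuous_open_vimage) auto
    moreover have "{t \<in> topspace (top_of_set {0..}). span {y t} \<in> U} = {0..} \<inter> y -` vectors_over U"
      using ynz by (auto simp: vectors_over_def)
    ultimately show "openin (top_of_set {0..}) {t \<in> topspace (top_of_set {0..}). span {y t} \<in> U}"
      by (simp add: openin_open_Int)
  qed
  moreover have "solves_proj_ode_at (\<lambda>t. span {y t}) A t" for t
    unfolding solves_proj_ode_at_def using ynz yd[of t]
    by (intro exI[of _ y] exI[of _ "A *v y t"]) (auto simp: span_zero)
  ultimately show ?thesis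
    unfolding proj_trajectory_def s by (auto simp: y_def x(2) intro!: exI[of _ "{}"])
qed

lemma dwell_signal_length: assumes "dwell_signal S \<tau> T u" shows "\<tau> \<le> T"
proof -
  obtain m p where p: "1 \<le> m" "p 0 = 0" "p m = T"
    "\<forall>i<m::nat. \<tau> \<le> p (Suc i) - p i \<and> p i \<le> p (Suc i)"
    using assms unfolding dwell_signal_def by blast
  have "\<tau> \<le> p (Suc k)" if "k < m" for k
    using that
  proof (induction k)
    case 0 then show ?case using p by force
  next
    case (Suc k) then show ?case using p(4) by force
  qed
  from this[of "m - 1"] show ?thesis using p(1,3) by simp
qed

lemma constant_dwell_signal:
  assumes "A \<in> S" "0 \<le> T" "\<tau> \<le> T" shows "dwell_signal S \<tau> T (\<lambda>_. A)"
  unfolding dwell_signal_def using assms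
  by (intro conjI ballI exI[of _ 1] exI[of _ "\<lambda>i. if i = 0 then 0 else T"]) auto

lemma constant_dwell_signal_inf:
  assumes "A \<in> S" "0 \<le> \<tau>" shows "dwell_signal_inf S \<tau> (\<lambda>_. A)"
  unfolding dwell_signal_inf_def
proof (intro exI[of _ "\<lambda>n. \<tau> + real n"] conjI allI)
  show "filterlim (\<lambda>n. \<tau> + real n) at_top sequentially"
    by (rule filterlim_tendsto_add_at_top[OF tendsto_const filterlim_real_sequentially])
  show "dwell_signal S \<tau> (\<tau> + real n) (\<lambda>_. A)" for n
    using assms by (intro constant_dwell_signal) auto
qed

text \<open>Follow a constant signal: at each time at which condition (i) asks for membership, at least
\<open>\<tau>\<close> has passed, so the state is in the reachable set.\<close>

lemma reach_closed_viable:
  fixes S :: "(real^'d^'d) set"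
  assumes "0 \<le> \<tau>" "S \<noteq> {}" "D \<subseteq> proj_points" "\<And>q. q \<in> D \<Longrightarrow> reach S \<tau> q \<subseteq> D"
  shows "cs_viable S \<tau> D"
  unfolding cs_viable_def
proof
  fix q assume q: "q \<in> D"
  obtain A where A: "A \<in> S" using assms(2) by blast
  have "proj_act (mat_exp (t *\<^sub>R A)) q \<in> D" if "dwell_signal S \<tau> t (\<lambda>_. A)" for t
    using assms(4)[OF q] mat_exp_in_dwell[OF A dwell_signal_length[OF that]] unfolding reach_def by blast
  then show "\<exists>u s. dwell_signal_inf S \<tau> u \<and> proj_trajectory u q s \<and>
        (\<forall>t>0. dwell_signal S \<tau> t u \<and> dwell_signal_inf S \<tau> (\<lambda>r. u (t + r)) \<longrightarrow> s t \<in> D)"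
    using constant_signal_trajectory[of q A] constant_dwell_signal_inf[OF A assms(1)] q assms(3)
    by (intro exI[of _ "\<lambda>_. A"] exI[of _ "\<lambda>t. proj_act (mat_exp (t *\<^sub>R A)) q"]) auto
qed

text \<open>The chart moved to \<open>p\<close>. Openness is tested at words acting on \<open>s0\<close>: a word that sends \<open>s0\<close> into
the moved chart is completed on the right by a fixed element \<open>e\<close>, which sends \<open>p\<close> to \<open>s0\<close>, to one
in the chart.\<close>

lemma reach_contains_fine_open:
  fixes S :: "(real^'d^'d) set"
  assumes ne: "S \<noteq> {}" and p: "p \<in> orbit S s0"
  obtains U where "openin (orbit_topology S s0) U" "U \<noteq> {}" "U \<subseteq> reach S \<tau> p"
proof -
  obtain ps :: "('d, real^'d^'d) letter list" and E \<delta> where ch: "ps \<noteq> []" "subspace E" "0 < \<delta>"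
    "\<And>Y. word_in S (word_at ps Y)"
    "\<And>Y. norm Y < \<delta> \<Longrightarrow> \<forall>(A, t)\<in>set (word_at ps Y). \<tau> < t"
    and charts: "\<And>\<epsilon>. 0 < \<epsilon> \<Longrightarrow> \<epsilon> \<le> \<delta> \<Longrightarrow> fine_open S ((\<lambda>Y. flow_prod (word_at ps Y)) ` (E \<inter> ball 0 \<epsilon>))"
    by (rule exists_fine_open_chart[OF ne, where \<tau> = \<tau>], rule that)
  define N where "N = (\<lambda>Y. flow_prod (word_at ps Y)) ` (E \<inter> ball 0 \<delta>)"
  have N_dwell: "N \<subseteq> dwell_semigroup S \<tau>"
  proof
    fix n assume "n \<in> N"
    then obtain Y where Y: "n = flow_prod (word_at ps Y)" "norm Y < \<delta>" by (auto simp: N_def)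
    have "word_at ps Y \<noteq> []" using ch(1) by (simp add: word_at_def)
    moreover have "\<forall>(A, t)\<in>set (word_at ps Y). A \<in> S \<and> \<tau> \<le> t"
      using ch(4)[of Y] ch(5)[OF Y(2)] unfolding word_in_def by fastforce
    ultimately show "n \<in> dwell_semigroup S \<tau>" unfolding dwell_semigroup_def Y(1) by blast
  qed
  define U where "U = (\<lambda>n. proj_act n p) ` N"
  have act_mult: "proj_act (X ** Y) s = proj_act X (proj_act Y s)" for X Y :: "real^'d^'d" and s
    by (simp add: proj_act_def image_image matrix_vector_mul_assoc)
  have act_one: "proj_act (mat 1) s = s" for s :: "(real^'d) set" by (simp add: proj_act_def)
  have Ur: "U \<subseteq> reach S \<tau> p" using N_dwell by (auto simp: U_def reach_def)
  moreover have "U \<noteq> {}" using ch(3) subspace_0[OF ch(2)] by (auto simp: U_def N_def)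
  moreover have "openin (orbit_topology S s0) U"
    unfolding openin_orbit_topology_iff fine_open_def
  proof (intro conjI allI impI; (elim conjE)?)
    show "U \<subseteq> orbit S s0" using Ur reach_subset_orbit[OF p] by blast
    fix ws assume ws: "word_in S ws" "flow_prod ws \<in> {g. proj_act g s0 \<in> U}"
    then obtain n where n: "n \<in> N" "proj_act (flow_prod ws) s0 = proj_act n p" by (auto simp: U_def)
    define e where "e = flow_prod (inv_word ws) ** n"
    have ep: "proj_act e p = s0"
      unfolding e_def act_mult n(2)[symmetric] by (simp add: act_one flip: act_mult)
    obtain vs where vs: "n = flow_prod vs" "word_in S vs" using n(1) ch(4) by (auto simp: N_def)
    have e_word: "e = flow_prod (vs @ inv_word ws)" by (simp add: e_def vs(1) flow_prod_append)
    let ?w = "vs @ inv_word ws"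
    have "flow_prod (?w @ ws) = n" by (simp add: flow_prod_append vs(1) matrix_mul_assoc)
    moreover have "word_in S (?w @ ws)" using ws(1) vs(2) by simp
    ultimately obtain r where r: "r > 0" "\<And>us. near r (?w @ ws) us \<Longrightarrow> flow_prod us \<in> N"
      using charts[OF ch(3) order_refl] n(1) unfolding fine_open_def N_def[symmetric] by metis
    have "proj_act (flow_prod us) s0 \<in> U" if "near r ws us" for us
    proof -
      have "flow_prod (?w @ us) \<in> N" by (intro r(2) near_append near_refl r(1) that)
      then have "proj_act (flow_prod us ** e) p \<in> U" by (simp add: U_def e_word flow_prod_append matrix_mul_assoc)
      then show ?thesis by (simp add: act_mult ep)
    qed
    then show "\<exists>r>0. \<forall>us. near r ws us \<longrightarrow> flow_prod us \<in> {g. proj_act g s0 \<in> U}" using r(1) by blast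
  qed
  ultimately show ?thesis using that by blast
qed

theorem theorem24:
  fixes S :: "(real^'d^'d) set" and \<tau> :: real and s0 :: "(real^'d) set"
  assumes "0 \<le> \<tau>"
    and "S \<noteq> {}"
    and "irreducible_matrices S"
    and "s0 \<in> proj_points"
    and "closedin proj_space (orbit S s0)"
  shows "(\<exists>!D. invariant_dwell_control_set S \<tau> D \<and> D \<subseteq> orbit S s0) \<and>
    (\<forall>D. invariant_dwell_control_set S \<tau> D \<and> D \<subseteq> orbit S s0 \<longrightarrow>
       D = (\<Inter>s\<in>orbit S s0. orbit_topology S s0 closure_of (reach S \<tau> s)) \<and>
       orbit_topology S s0 interior_of D \<noteq> {})"
proof -
  let ?O = "orbit S s0"
  let ?Cl = "\<lambda>s. proj_space closure_of (reach S \<tau> s)"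
  have Opp: "?O \<subseteq> proj_points" by (rule orbit_subset_proj_points[OF assms(4)])
  define D where "D = (\<Inter>s\<in>?O. ?Cl s)"
  obtain p where p: "p \<in> ?O" "\<And>s. s \<in> ?O \<Longrightarrow> p \<in> ?Cl s"
    using exists_common_limit_point[OF assms(2-5)] by metis
  have pD: "p \<in> D" using p(2) by (simp add: D_def)
  have ClO: "?Cl s \<subseteq> ?O" if "s \<in> ?O" for s
    by (rule closure_of_minimal[OF reach_subset_orbit[OF that] assms(5)])
  have DO: "D \<subseteq> ?O" using ClO p(1) by (auto simp: D_def)
  have Dpp: "D \<subseteq> proj_points" using DO Opp by blast
  have ClD: "?Cl q = D" if "q \<in> D" for q
  proof
    show "D \<subseteq> ?Cl q" using that DO by (auto simp: D_def)
    have "?Cl q \<subseteq> ?Cl s" if "s \<in> ?O" for s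
      using that \<open>q \<in> D\<close> Opp by (intro reach_closure_trans) (auto simp: D_def)
    then show "?Cl q \<subseteq> D" unfolding D_def by blast
  qed
  have Dclosed: "proj_space closure_of D = D" using ClD[OF pD] by (metis closure_of_closure_of)
  have reachD: "reach S \<tau> q \<subseteq> D" if q: "q \<in> D" for q
  proof -
    have "reach S \<tau> q \<subseteq> topspace proj_space" using reach_subset_orbit[of q S s0 \<tau>] q DO Opp by auto
    then have "reach S \<tau> q \<subseteq> ?Cl q" by (rule closure_of_subset)
    then show ?thesis using ClD[OF q] by simp
  qed
  have viable: "cs_viable S \<tau> D" by (rule reach_closed_viable[OF assms(1,2) Dpp reachD])
  have approx: "cs_approx_reachable S \<tau> D" unfolding cs_approx_reachable_def using ClD by blast
  have D_ICS: "invariant_dwell_control_set S \<tau> D"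
    unfolding invariant_dwell_control_set_def dwell_control_set_def
  proof (intro conjI allI impI ballI Dpp viable approx)
    fix D' assume D': "D' \<subseteq> proj_points \<and> D \<subseteq> D' \<and> cs_viable S \<tau> D' \<and> cs_approx_reachable S \<tau> D'"
    then have "D' \<subseteq> ?Cl p" using pD unfolding cs_approx_reachable_def by blast
    then show "D' = D" using ClD[OF pD] D' by blast
  qed (simp add: Dclosed ClD)
  note top = orbit_topology_eq_subtopology[OF assms(2,4,5)]
  obtain U where Ur: "openin (orbit_topology S s0) U" "U \<noteq> {}" "U \<subseteq> reach S \<tau> p"
    by (rule reach_contains_fine_open[OF assms(2) p(1), of \<tau>])
  then have U: "openin (orbit_topology S s0) U" "U \<noteq> {}" "U \<subseteq> D" using reachD[OF pD] by auto
  have unique: "D' = D" if D': "invariant_dwell_control_set S \<tau> D'" "D' \<subseteq> ?O" for D'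
  proof -
    have mx: "X = D'" if "X \<subseteq> proj_points" "D' \<subseteq> X" "cs_viable S \<tau> X" "cs_approx_reachable S \<tau> X" for X
      using D'(1) that unfolding invariant_dwell_control_set_def dwell_control_set_def by blast
    have "D' \<noteq> {}" using mx[OF Dpp _ viable approx] pD by blast
    then obtain q where q: "q \<in> D'" by blast
    have "D \<subseteq> ?Cl q" using q D'(2) by (auto simp: D_def)
    also have "?Cl q = proj_space closure_of D'"
      using D'(1) q unfolding invariant_dwell_control_set_def by blast
    finally have dense: "D \<subseteq> proj_space closure_of D'" .
    obtain V where V: "openin proj_space V" "U = V \<inter> ?O"
      using U(1) unfolding top openin_subtopology by blast
    obtain u where "u \<in> U" using U(2) by blast
    then have "u \<in> V" "u \<in> proj_space closure_of D'" using V(2) U(3) dense by auto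
    then obtain q' where "q' \<in> D'" "q' \<in> V" using V(1) unfolding in_closure_of by blast
    then have q': "q' \<in> D'" "q' \<in> D" using V(2) U(3) D'(2) by auto
    have "D' \<subseteq> ?Cl q'"
      using D'(1) q'(1) unfolding invariant_dwell_control_set_def dwell_control_set_def cs_approx_reachable_def by blast
    then have "D' \<subseteq> D" using ClD[OF q'(2)] by simp
    then show ?thesis using mx[OF Dpp _ viable approx] by simp
  qed
  have "orbit_topology S s0 closure_of (reach S \<tau> s) = ?Cl s" if s: "s \<in> ?O" for s
  proof -
    have "?O \<inter> reach S \<tau> s = reach S \<tau> s" using reach_subset_orbit[OF s] by blast
    then show ?thesis unfolding top closure_of_subtopology using ClO[OF s] by auto
  qed
  then have "D = (\<Inter>s\<in>?O. orbit_topology S s0 closure_of (reach S \<tau> s))" by (simp add: D_def)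
  moreover have "orbit_topology S s0 interior_of D \<noteq> {}"
    using interior_of_maximal[OF U(3,1)] U(2) by blast
  ultimately show ?thesis using D_ICS DO unique by blast
qed

end
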